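(* There exists a universal constant $C>0$ and, for every $\varepsilon\in(0,1)$, a constant $\bar{C}_\varepsilon>0$ depending only on $\varepsilon$, such that the following holds. Let $K$ be a symmetric convex body in $\mathbb{R}^n$, fix $\varepsilon\in(0,1)$, and let $k(K)$ be the largest dimension $k$ such that $$\nu_{n,k}\left(\left\{F\in G_{n,k} : (1-\varepsilon)M<\|x\|_{K}<(1+\varepsilon)M \ \text{ for all } x\in S^{n-1}\cap F\right\}\right)>\frac12.$$ Then $$C\,n\left(\frac{M}{b}\right)^2\ \ge\ k(K)\ \ge\ \bar{C}_\varepsilon\, n\left(\frac{M}{b}\right)^2,$$ where $M=M(K)$ and $b=b(K)$.
   Context: A symmetric convex body $K\subset\mathbb{R}^n$ is a compact convex set with nonempty interior satisfying $K=-K$. Its associated norm is $\|x\|_K=\inf\{r>0 : x\in rK\}$. $S^{n-1}$ is the Euclidean unit sphere of $\mathbb{R}^n$ and $\nu_n$ is its normalized (rotation-invariant probability) Haar measure. $G_{n,k}$ is the Grassmannian of $k$-dimensional linear subspaces of $\mathbb{R}^n$ and $\nu_{n,k}$ is its normalized (rotation-invariant probability) Haar measure. $M=M(K)=\int_{S^{n-1}}\|x\|_K\,d\nu_n(x)$ and $b=b(K)=\sup\{\|x\|_K : x\in S^{n-1}\}$.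
   Formalization: k(K) is the largest k ≥ 1 with the stated property; if no k ≥ 1 qualifies (possible, e.g. for a long thin rectangle with small ε, where the lower bound would fail with k(K)=0), the two inequalities are replaced by C̄_ε n(M/b)² < 1. *)

theory Defs
  imports "HOL-Probability.Probability" "HOL-Library.Function_Algebras"
begin

text \<open>
  The constant \<open>C\<close> is to be independent of the dimension, so \<open>n\<close> has to be an ordinary natural number.
  \<open>\<real>\<^sup>n\<close> is therefore the carrier of \<^const>\<open>Euclidean_space\<close>, i.e. the set of sequences
  \<open>nat \<Rightarrow> real\<close> vanishing from index \<open>n\<close> on. The pointwise scalar multiplication below makes
  \<^const>\<open>convex\<close>, \<^const>\<open>subspace\<close>, \<^const>\<open>dim\<close> and \<^const>\<open>linear\<close> available for these sequences.
\<close>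

instantiation "fun" :: (type, real_vector) real_vector
begin

definition scaleR_fun :: "real \<Rightarrow> ('a \<Rightarrow> 'b) \<Rightarrow> 'a \<Rightarrow> 'b"
  where "scaleR_fun r f = (\<lambda>x. r *\<^sub>R f x)"

instance
  by standard (simp_all add: scaleR_fun_def fun_eq_iff scaleR_add_right scaleR_add_left)

end

abbreviation Rn :: "nat \<Rightarrow> (nat \<Rightarrow> real) set"
  where "Rn n \<equiv> topspace (Euclidean_space n)"

definition inner_Rn :: "nat \<Rightarrow> (nat \<Rightarrow> real) \<Rightarrow> (nat \<Rightarrow> real) \<Rightarrow> real"
  where "inner_Rn n x y = (\<Sum>i<n. x i * y i)"

definition norm_Rn :: "nat \<Rightarrow> (nat \<Rightarrow> real) \<Rightarrow> real"
  where "norm_Rn n x = L2_set x {..<n}"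

definition unit_sphere :: "nat \<Rightarrow> (nat \<Rightarrow> real) set"
  where "unit_sphere n = {x \<in> Rn n. norm_Rn n x = 1}"

definition symmetric_convex_body :: "nat \<Rightarrow> (nat \<Rightarrow> real) set \<Rightarrow> bool"
  where "symmetric_convex_body n K \<longleftrightarrow>
    compactin (Euclidean_space n) K \<and> convex K \<and>
    (Euclidean_space n) interior_of K \<noteq> {} \<and> uminus ` K = K"

definition body_norm :: "(nat \<Rightarrow> real) set \<Rightarrow> (nat \<Rightarrow> real) \<Rightarrow> real"
  where "body_norm K x = Inf {r. r > 0 \<and> x \<in> (\<lambda>y. r *\<^sub>R y) ` K}"

text \<open>
  The orthogonal group \<open>O(n)\<close>. Its elements are linear on all sequences, but only their restriction
  to \<open>\<real>\<^sup>n\<close> is ever used; every orthogonal map of \<open>\<real>\<^sup>n\<close> has such a linear extension.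
\<close>

definition orthogonal_maps :: "nat \<Rightarrow> ((nat \<Rightarrow> real) \<Rightarrow> nat \<Rightarrow> real) set"
  where "orthogonal_maps n = {T. linear T \<and> T ` Rn n \<subseteq> Rn n \<and>
    (\<forall>x \<in> Rn n. \<forall>y \<in> Rn n. inner_Rn n (T x) (T y) = inner_Rn n x y)}"

definition borel_of :: "'a topology \<Rightarrow> 'a measure"
  where "borel_of X = sigma (topspace X) {U. openin X U}"

text \<open>
  The \<open>G\<close>-invariant Borel probability measure on \<open>X\<close>, used where it is unique, namely for the
  transitive actions of the compact group \<open>O(n)\<close> on the sphere and on the Grassmannians.
\<close>

definition haar_prob :: "'a topology \<Rightarrow> ('a \<Rightarrow> 'a) set \<Rightarrow> 'a measure"
  where "haar_prob X G = (THE \<mu>. prob_space \<mu> \<and> sets \<mu> = sets (borel_of X) \<and>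
    (\<forall>g \<in> G. distr \<mu> \<mu> g = \<mu>))"

definition sphere_measure :: "nat \<Rightarrow> (nat \<Rightarrow> real) measure"
  where "sphere_measure n =
    haar_prob (subtopology (Euclidean_space n) (unit_sphere n)) (orthogonal_maps n)"

definition Grassmannian :: "nat \<Rightarrow> nat \<Rightarrow> (nat \<Rightarrow> real) set set"
  where "Grassmannian n k = {F. subspace F \<and> F \<subseteq> Rn n \<and> dim F = k}"

text \<open>
  The Grassmannian carries the Hausdorff distance between the Euclidean unit balls of the subspaces.
  The outer maximum with 0 has no effect on subspaces of \<open>\<real>\<^sup>n\<close>; it is there because
  \<^locale>\<open>Metric_space\<close> asks for nonnegativity even off the carrier.
\<close>

definition ball_excess :: "nat \<Rightarrow> (nat \<Rightarrow> real) set \<Rightarrow> (nat \<Rightarrow> real) set \<Rightarrow> real"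
  where "ball_excess n E F =
    (SUP x \<in> {x \<in> E. norm_Rn n x \<le> 1}. INF y \<in> {y \<in> F. norm_Rn n y \<le> 1}. norm_Rn n (x - y))"

definition Grassmannian_dist :: "nat \<Rightarrow> (nat \<Rightarrow> real) set \<Rightarrow> (nat \<Rightarrow> real) set \<Rightarrow> real"
  where "Grassmannian_dist n E F = max 0 (max (ball_excess n E F) (ball_excess n F E))"

definition Grassmannian_topology :: "nat \<Rightarrow> nat \<Rightarrow> (nat \<Rightarrow> real) set topology"
  where "Grassmannian_topology n k =
    Metric_space.mtopology (Grassmannian n k) (Grassmannian_dist n)"

definition Grassmannian_measure :: "nat \<Rightarrow> nat \<Rightarrow> (nat \<Rightarrow> real) set measure"
  where "Grassmannian_measure n k =
    haar_prob (Grassmannian_topology n k) ((`) ` orthogonal_maps n)"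

definition mean_norm :: "nat \<Rightarrow> (nat \<Rightarrow> real) set \<Rightarrow> real"
  where "mean_norm n K = (\<integral>x. body_norm K x \<partial>sphere_measure n)"

definition max_norm :: "nat \<Rightarrow> (nat \<Rightarrow> real) set \<Rightarrow> real"
  where "max_norm n K = (SUP x \<in> unit_sphere n. body_norm K x)"

definition almost_Euclidean :: "nat \<Rightarrow> (nat \<Rightarrow> real) set \<Rightarrow> real \<Rightarrow> nat \<Rightarrow> (nat \<Rightarrow> real) set set"
  where "almost_Euclidean n K \<epsilon> k = {F \<in> Grassmannian n k. \<forall>x \<in> unit_sphere n \<inter> F.
    (1 - \<epsilon>) * mean_norm n K < body_norm K x \<and> body_norm K x < (1 + \<epsilon>) * mean_norm n K}"

text \<open>
  Dimensions start at 1. The set below can be empty: for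
  \<open>K = {x. \<bar>x\<^sub>1\<bar> \<le> 1, \<bar>x\<^sub>i\<bar> \<le> R for i \<ge> 2}\<close> with \<open>n \<ge> 2\<close>, \<open>R\<close> large and \<open>\<epsilon>\<close> small, no dimension qualifies.
  \<open>critical_dim\<close> is meaningful only if the set is nonempty.
\<close>

definition typical_dims :: "nat \<Rightarrow> (nat \<Rightarrow> real) set \<Rightarrow> real \<Rightarrow> nat set"
  where "typical_dims n K \<epsilon> =
    {k \<in> {1..n}. measure (Grassmannian_measure n k) (almost_Euclidean n K \<epsilon> k) > 1 / 2}"

definition critical_dim :: "nat \<Rightarrow> (nat \<Rightarrow> real) set \<Rightarrow> real \<Rightarrow> nat"
  where "critical_dim n K \<epsilon> = Max (typical_dims n K \<epsilon>)"

end

theory Submission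
  imports Defs
begin

text \<open>
  The rotation invariant measures are pushforwards of Gaussian measure: the sphere carries the law of a
  normalised Gaussian vector and the Grassmannian the law of the span of an orthonormalised Gaussian family.
  They are the Haar measures because two probability measures on a separable metric space that give
  all balls of the same radius the same mass coincide.

  Lower bound: the Prekopa--Leindler inequality bounds the exponential moments of a Lipschitz function of a
  Gaussian vector. For \<open>\<parallel>x\<parallel> - M \<bar>x\<bar>\<close>, which has mean 0, this yields
  \<open>P (\<bar>\<parallel>x\<parallel> - M\<bar> \<ge> \<eta> M) \<le> 10 exp (- \<eta>\<^sup>2 n (M/b)\<^sup>2 / 64)\<close> on the sphere. A point of the unit sphere of a random
  \<open>k\<close>-dimensional subspace is uniform on the sphere, so a union bound over a net with \<open>exp (O (k))\<close>
  points suffices.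

  Upper bound: some unit vector \<open>u\<close> satisfies \<open>b \<bar>\<langle>x, u\<rangle>\<bar> \<le> \<parallel>x\<parallel>\<close>, so \<open>b \<bar>P u\<bar> < 2 M\<close> for the projection \<open>P\<close> onto an almost
  Euclidean subspace. Rotation invariance determines the first two moments of \<open>\<bar>P u\<bar>\<^sup>2\<close> as \<open>k/n\<close> and
  \<open>k (k + 2) / (n (n + 2))\<close>, and Chebyshev's inequality shows that \<open>\<bar>P u\<bar>\<^sup>2\<close> is at least \<open>k / (2 n)\<close> with probability at
  least \<open>1 - 8/k\<close>. For small \<open>k\<close> the bound \<open>M \<ge> b / sqrt (3 n)\<close> is enough.
\<close>

section \<open>The Prekopa--Leindler inequality\<close>

text \<open>The dimension is a variable, so \<open>Rn n\<close> is a set of sequences and not a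
  type. Lebesgue measure and the random frames are therefore Borel measures on full sequence types,
  built by recursion on one coordinate or one vector at a time, and the inductions follow that
  recursion. Haar measure is given by a definite description and yields nothing before existence and
  uniqueness are proved; afterwards integrals over the sphere and the Grassmannian are moved to
  \<open>frames\<close> or \<open>gauss\<close>. Elements of \<open>orthogonal_maps\<close> are
  arbitrary linear maps off \<open>Rn n\<close>, so invariance of measures on sequences is stated
  with \<open>comb n w\<close>, which is continuous everywhere. The subtrahend M |x| is taken
  instead of the constant M because it keeps the function positively homogeneous: length and
  direction of a Gaussian vector are independent, so conditioning on |x| \<ge> sqrt n / 2 carries a
  Gaussian tail bound over to the sphere, with no detour through medians. The net is far from
  optimal, but all that matters is that its size is a k-th power of a number depending on \<epsilon>
  alone.\<close>

lemma emeasure_half_sum: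
  fixes A B C :: "real set"
  assumes [measurable]: "A \<in> sets borel" "B \<in> sets borel" "C \<in> sets borel"
    and ne: "A \<noteq> {}" "B \<noteq> {}" and bd: "bounded A" "bounded B"
    and sub: "\<And>a b. a \<in> A \<Longrightarrow> b \<in> B \<Longrightarrow> (a + b) / 2 \<in> C"
  shows "emeasure lborel A + emeasure lborel B \<le> 2 * emeasure lborel C"
proof (rule ennreal_le_epsilon)
  fix e :: real assume e: "0 < e"
  have bA: "bdd_above A" and bB: "bdd_below B"
    using bd by (auto simp: bounded_imp_bdd_above bounded_imp_bdd_below)
  obtain a where a: "a \<in> A" "Sup A - e/2 < a"
    using less_cSup_iff[OF ne(1) bA, of "Sup A - e/2"] e by auto
  obtain b where b: "b \<in> B" "b < Inf B + e/2"
    using cInf_less_iff[OF ne(2) bB, of "Inf B + e/2"] e by auto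
  \<comment> \<open>The scaled copies (?A + b) / 2 and (a + ?B) / 2 lie in \<open>C\<close> on
    different sides of (a + b) / 2, hence are disjoint, and carry half the mass of ?A and ?B. As a
    is nearly the supremum of \<open>A\<close> and b nearly the infimum of \<open>B\<close>, little
    mass is cut off.\<close>
  let ?A = "A \<inter> {..<a}" and ?B = "B \<inter> {b..}"
  let ?C = "{y. 2 * y - b \<in> ?A}" and ?D = "{y. 2 * y - a \<in> ?B}"
  have mAB: "?A \<in> sets borel" "?B \<in> sets borel" by measurable
  have mC: "?C \<in> sets borel" "?D \<in> sets borel" by measurable
  have scale: "emeasure lborel S = 2 * emeasure lborel {y. 2 * y - c \<in> S}"
    if [measurable]: "S \<in> sets borel" for S :: "real set" and c
  proof -
    have [measurable]: "{y. 2 * y - c \<in> S} \<in> sets borel" by measurable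
    have "emeasure lborel S = (\<integral>\<^sup>+x. indicator S x \<partial>lborel)" by simp
    also have "\<dots> = ennreal \<bar>2\<bar> * (\<integral>\<^sup>+x. indicator S (- c + 2 * x) \<partial>lborel)"
      by (rule nn_integral_real_affine) auto
    also have "(\<integral>\<^sup>+x. indicator S (- c + 2 * x) \<partial>lborel) = (\<integral>\<^sup>+x. indicator {y. 2 * y - c \<in> S} x \<partial>lborel)"
      by (intro nn_integral_cong) (auto simp: indicator_def)
    finally show ?thesis by simp
  qed
  have "emeasure lborel ?C + emeasure lborel ?D = emeasure lborel (?C \<union> ?D)"
    by (rule plus_emeasure) (use mC in auto)
  also have "\<dots> \<le> emeasure lborel C"
  proof (rule emeasure_mono)
    show "?C \<union> ?D \<subseteq> C"
    proof
      fix y assume "y \<in> ?C \<union> ?D"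
      then show "y \<in> C"
        using sub[of "2*y-b" b] sub[of a "2*y-a"] a b by auto
    qed
  qed auto
  finally have CD: "emeasure lborel ?A + emeasure lborel ?B \<le> 2 * emeasure lborel C"
    unfolding scale[OF mAB(1), of b] scale[OF mAB(2), of a] distrib_left[symmetric]
    by (rule mult_left_mono) simp
  have "emeasure lborel A \<le> emeasure lborel (?A \<union> {a..Sup A})"
    using bA by (intro emeasure_mono) (auto intro: cSup_upper)
  also have "\<dots> \<le> emeasure lborel ?A + emeasure lborel {a..Sup A}"
    by (rule emeasure_subadditive) auto
  also have "\<dots> \<le> emeasure lborel ?A + ennreal (e/2)"
    using a bA by (auto intro!: add_left_mono ennreal_leI simp: cSup_upper)
  finally have 1: "emeasure lborel A \<le> emeasure lborel ?A + ennreal (e/2)" .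
  have "emeasure lborel B \<le> emeasure lborel (?B \<union> {Inf B..b})"
    using bB by (intro emeasure_mono) (auto intro: cInf_lower)
  also have "\<dots> \<le> emeasure lborel ?B + emeasure lborel {Inf B..b}"
    by (rule emeasure_subadditive) auto
  also have "\<dots> \<le> emeasure lborel ?B + ennreal (e/2)"
    using b bB by (auto intro!: add_left_mono ennreal_leI simp: cInf_lower)
  finally have 2: "emeasure lborel B \<le> emeasure lborel ?B + ennreal (e/2)" .
  have "emeasure lborel A + emeasure lborel B
      \<le> (emeasure lborel ?A + emeasure lborel ?B) + (ennreal (e/2) + ennreal (e/2))"
    using add_mono[OF 1 2] by (simp add: ac_simps)
  also have "ennreal (e/2) + ennreal (e/2) = ennreal e"
    using e by (simp flip: ennreal_plus)
  finally show "emeasure lborel A + emeasure lborel B \<le> 2 * emeasure lborel C + ennreal e"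
    using CD by (meson add_right_mono order_trans)
qed

lemma ennreal_layer:
  fixes y :: ennreal
  shows "(\<integral>\<^sup>+l. indicator {l. 0 < l \<and> ennreal l < y} l \<partial>lborel) = y"
proof (cases y)
  case (real r)
  then have "{l. 0 < l \<and> ennreal l < y} = {0<..<r}"
    by (auto simp: ennreal_less_iff)
  then show ?thesis using real by simp
next
  case top
  have "{l. 0 < l \<and> ennreal l < y} = {0<..}" by (auto simp: top)
  moreover have "emeasure lborel {0::real<..} = \<infinity>"
  proof (rule ccontr)
    assume "emeasure lborel {0::real<..} \<noteq> \<infinity>"
    then obtain n where n: "emeasure lborel {0::real<..} < of_nat n"
      using ennreal_Ex_less_of_nat by (auto simp: top.not_eq_extremum)
    have "emeasure lborel {0<..<real n} \<le> emeasure lborel {0::real<..}"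
      by (rule emeasure_mono) auto
    then show False using n by (simp add: ennreal_of_nat_eq_real_of_nat)
  qed
  ultimately show ?thesis using top by simp
qed

lemma nn_integral_layer_cake:
  fixes f :: "real \<Rightarrow> ennreal"
  assumes [measurable]: "f \<in> borel_measurable borel"
  shows "(\<integral>\<^sup>+x. f x \<partial>lborel) = (\<integral>\<^sup>+l. indicator {0<..} l * emeasure lborel {x. ennreal l < f x} \<partial>lborel)"
proof -
  have "(\<integral>\<^sup>+x. f x \<partial>lborel) = (\<integral>\<^sup>+x. \<integral>\<^sup>+l. indicator {l. 0 < l \<and> ennreal l < f x} l \<partial>lborel \<partial>lborel)"
    by (simp only: ennreal_layer)
  also have "\<dots> = (\<integral>\<^sup>+x. \<integral>\<^sup>+l. indicator {p. 0 < snd p \<and> ennreal (snd p) < f (fst p)} (x, l) \<partial>lborel \<partial>lborel)"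
    by (intro nn_integral_cong) (auto simp: indicator_def)
  also have "\<dots> = (\<integral>\<^sup>+l. \<integral>\<^sup>+x. indicator {p. 0 < snd p \<and> ennreal (snd p) < f (fst p)} (x, l) \<partial>lborel \<partial>lborel)"
    by (rule lborel_pair.Fubini') (auto simp: split_beta' intro!: borel_measurable_indicator; measurable)
  also have "\<dots> = (\<integral>\<^sup>+l. indicator {0<..} l * (\<integral>\<^sup>+x. indicator {x. ennreal l < f x} x \<partial>lborel) \<partial>lborel)"
    by (subst nn_integral_cmult[symmetric])
       (auto intro!: nn_integral_cong simp: indicator_def)
  also have "\<dots> = (\<integral>\<^sup>+l. indicator {0<..} l * emeasure lborel {x. ennreal l < f x} \<partial>lborel)"
    by (subst nn_integral_indicator) auto
  finally show ?thesis .
qed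

lemma ennreal_square_less: "a * a < b\<^sup>2 \<Longrightarrow> a < (b::ennreal)"
  by (metis linorder_not_le mult_mono power2_eq_square zero_le)

text \<open>Multiplication of extended reals is strictly monotone only for finite nonzero factors.
  \<open>a\<close> is finite because it lies below \<open>c\<close>, and passing to the minimum of
  \<open>c\<close> and \<open>d\<close> reduces the claim to squares.\<close>

lemma ennreal_mult_strict: "a < c \<Longrightarrow> a < d \<Longrightarrow> a * a < c * (d::ennreal)"
proof -
  assume *: "a < c" "a < d"
  then have m: "a < min c d" by simp
  have "a * a < min c d * min c d"
  proof (cases "a = 0")
    case True
    then show ?thesis using m by (metis ennreal_zero_less_mult_iff mult_zero_left)
  next
    case False
    then have "a * a < min c d * a"
      using m by (intro ennreal_mult_strict_right_mono) (auto simp: zero_less_iff_neq_zero intro: less_le_trans)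
    also have "\<dots> \<le> min c d * min c d" using m by (intro mult_left_mono) auto
    finally show ?thesis .
  qed
  also have "\<dots> \<le> c * d" by (intro mult_mono) auto
  finally show ?thesis .
qed

text \<open>For 0 < l < 1 the normalised suprema make both superlevel sets nonempty, and half-sums
  of their points lie in the superlevel set of \<open>h\<close>, so one-dimensional Brunn--Minkowski
  applies at every level. Integration over l gives an additive bound, which is stronger than the
  product form.\<close>

lemma prekopa_leindler_normalized:
  fixes f g h :: "real \<Rightarrow> ennreal"
  assumes [measurable]: "f \<in> borel_measurable borel" "g \<in> borel_measurable borel" "h \<in> borel_measurable borel"
    and le: "\<And>s t. f s * g t \<le> (h ((s + t) / 2))\<^sup>2"
    and sup: "(SUP x. f x) = 1" "(SUP x. g x) = 1"
    and bd: "bounded {x. f x \<noteq> 0}" "bounded {x. g x \<noteq> 0}"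
  shows "(\<integral>\<^sup>+x. f x \<partial>lborel) + (\<integral>\<^sup>+x. g x \<partial>lborel) \<le> 2 * (\<integral>\<^sup>+x. h x \<partial>lborel)"
proof -
  have "indicator {0<..} l * emeasure lborel {x. ennreal l < f x} + indicator {0<..} l * emeasure lborel {x. ennreal l < g x}
     \<le> 2 * (indicator {0<..} l * emeasure lborel {x. ennreal l < h x})" for l :: real
  proof -
    have f1: "f x \<le> 1" "g x \<le> 1" for x
      using sup by (metis SUP_upper UNIV_I)+
    consider "l \<le> 0" | "1 \<le> l" | "0 < l" "l < 1" by linarith
    then show ?thesis
    proof cases
      case 2
      then have "{x. ennreal l < f x} = {}" "{x. ennreal l < g x} = {}"
        using f1 by (auto simp: not_less intro: order_trans[OF f1(1)] order_trans[OF f1(2)])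
      then show ?thesis by simp
    next
      case 3
      then have "ennreal l < 1" by (simp add: ennreal_less_one_iff)
      then obtain x y where "ennreal l < f x" "ennreal l < g y"
        using sup by (metis less_SUP_iff)
      moreover have "bounded {x. ennreal l < f x}"
        by (rule bounded_subset[OF bd(1)]) auto
      moreover have "bounded {x. ennreal l < g x}"
        by (rule bounded_subset[OF bd(2)]) auto
      moreover have "ennreal l < h ((a + b)/2)" if "ennreal l < f a" "ennreal l < g b" for a b
        by (rule ennreal_square_less)
           (rule less_le_trans[OF ennreal_mult_strict[OF that] le])
      ultimately have "emeasure lborel {x. ennreal l < f x} + emeasure lborel {x. ennreal l < g x}
        \<le> 2 * emeasure lborel {x. ennreal l < h x}"
        by (intro emeasure_half_sum) auto
      then show ?thesis using 3 by simp
    qed simp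
  qed
  then have "(\<integral>\<^sup>+l. indicator {0<..} l * emeasure lborel {x. ennreal l < f x} + indicator {0<..} l * emeasure lborel {x. ennreal l < g x} \<partial>lborel)
     \<le> (\<integral>\<^sup>+l. 2 * (indicator {0<..} l * emeasure lborel {x. ennreal l < h x}) \<partial>lborel)"
    by (intro nn_integral_mono) auto
  moreover have [measurable]: "(\<lambda>l. indicator {0<..} l * emeasure lborel {x. ennreal l < u x}) \<in> borel_measurable lborel"
    if [measurable]: "u \<in> borel_measurable borel" for u
  proof -
    have "{p \<in> space (lborel \<Otimes>\<^sub>M lborel). ennreal (fst p) < u (snd p)} \<in> sets (lborel \<Otimes>\<^sub>M lborel)"
      by measurable
    then have "{p. ennreal (fst p) < u (snd p)} \<in> sets (lborel \<Otimes>\<^sub>M lborel)"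
      by (simp add: space_pair_measure)
    from lborel.measurable_emeasure_Pair[OF this]
    have "(\<lambda>l. emeasure lborel (Pair l -` {p. ennreal (fst p) < u (snd p)})) \<in> borel_measurable lborel" .
    moreover have "Pair l -` {p. ennreal (fst p) < u (snd p)} = {x. ennreal l < u x}" for l by auto
    ultimately show ?thesis by simp
  qed
  ultimately show ?thesis
    unfolding nn_integral_layer_cake[OF assms(1)] nn_integral_layer_cake[OF assms(2)]
      nn_integral_layer_cake[OF assms(3)]
    by (simp add: nn_integral_add nn_integral_cmult)
qed

lemma ennreal_amgm: "4 * (a * b) \<le> (a + b :: ennreal)\<^sup>2"
proof (cases "a = top \<or> b = top")
  case True
  then show ?thesis by (auto simp: power2_eq_square ennreal_mult_eq_top_iff)
next
  case False
  then obtain r s where rs: "a = ennreal r" "b = ennreal s" "0 \<le> r" "0 \<le> s"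
    by (metis ennreal_cases)
  have "4 * (r * s) \<le> (r + s)\<^sup>2"
    using zero_le_power2[of "r - s"] by (simp add: power2_eq_square algebra_simps)
  then show ?thesis using rs
    by (simp add: ennreal_mult[symmetric] ennreal_plus[symmetric] ennreal_power ennreal_leI 
        del: ennreal_plus flip: ennreal_numeral)
qed

text \<open>Divide \<open>f\<close> and \<open>g\<close> by their suprema and \<open>h\<close> by
  the geometric mean of these: the hypothesis survives, the normalised case bounds the sum of the
  integrals, and the inequality of arithmetic and geometric means turns the sum into the product, in
  which the scaling cancels.\<close>

lemma prekopa_leindler_bounded:
  fixes f g h :: "real \<Rightarrow> ennreal"
  assumes [measurable]: "f \<in> borel_measurable borel" "g \<in> borel_measurable borel" "h \<in> borel_measurable borel"
    and le: "\<And>s t. f s * g t \<le> (h ((s + t) / 2))\<^sup>2"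
    and sup: "(SUP x. f x) < top" "(SUP x. g x) < top"
    and bd: "bounded {x. f x \<noteq> 0}" "bounded {x. g x \<noteq> 0}"
  shows "(\<integral>\<^sup>+x. f x \<partial>lborel) * (\<integral>\<^sup>+x. g x \<partial>lborel) \<le> (\<integral>\<^sup>+x. h x \<partial>lborel)\<^sup>2"
proof (cases "(SUP x. f x) = 0 \<or> (SUP x. g x) = 0")
  case True
  then have "(\<forall>x. f x = 0) \<or> (\<forall>x. g x = 0)"
    by (metis SUP_upper UNIV_I le_zero_eq)
  then show ?thesis by auto
next
  case False
  then obtain p q where pq: "(SUP x. f x) = ennreal p" "(SUP x. g x) = ennreal q" "0 < p" "0 < q"
    using sup by (metis ennreal_0 ennreal_cases less_irrefl order_le_less)
  define c where "c = ennreal (1 / sqrt (p * q))"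
  have cc: "c\<^sup>2 = ennreal (1/p) * ennreal (1/q)"
    using pq unfolding c_def by (simp add: ennreal_power power_divide ennreal_mult[symmetric])
  have "(\<integral>\<^sup>+x. ennreal (1/p) * f x \<partial>lborel) + (\<integral>\<^sup>+x. ennreal (1/q) * g x \<partial>lborel) \<le> 2 * (\<integral>\<^sup>+x. c * h x \<partial>lborel)"
  proof (rule prekopa_leindler_normalized)
    fix s t
    have "ennreal (1/p) * f s * (ennreal (1/q) * g t) = c\<^sup>2 * (f s * g t)"
      by (simp add: cc ac_simps)
    also have "\<dots> \<le> c\<^sup>2 * (h ((s + t) / 2))\<^sup>2" by (intro mult_left_mono le) simp
    finally show "ennreal (1/p) * f s * (ennreal (1/q) * g t) \<le> (c * h ((s + t) / 2))\<^sup>2"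
      by (simp add: power_mult_distrib)
  next
    show "(SUP x. ennreal (1/p) * f x) = 1" "(SUP x. ennreal (1/q) * g x) = 1"
      using pq by (simp_all add: SUP_mult_left_ennreal[symmetric] ennreal_mult[symmetric])
  next
    show "bounded {x. ennreal (1/p) * f x \<noteq> 0}"
      by (rule bounded_subset[OF bd(1)]) auto
    show "bounded {x. ennreal (1/q) * g x \<noteq> 0}"
      by (rule bounded_subset[OF bd(2)]) auto
  qed auto
  then have 1: "ennreal (1/p) * (\<integral>\<^sup>+x. f x \<partial>lborel) + ennreal (1/q) * (\<integral>\<^sup>+x. g x \<partial>lborel) \<le> 2 * (c * (\<integral>\<^sup>+x. h x \<partial>lborel))"
    by (simp add: nn_integral_cmult)
  let ?F = "\<integral>\<^sup>+x. f x \<partial>lborel" and ?G = "\<integral>\<^sup>+x. g x \<partial>lborel" and ?H = "\<integral>\<^sup>+x. h x \<partial>lborel"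
  have "4 * ((ennreal (1/p) * ?F) * (ennreal (1/q) * ?G)) \<le> (2 * (c * ?H))\<^sup>2"
    by (rule order_trans[OF ennreal_amgm power_mono[OF 1]]) simp
  then have "4 * (c\<^sup>2 * (?F * ?G)) \<le> 4 * (c\<^sup>2 * ?H\<^sup>2)"
    by (simp add: cc power_mult_distrib ac_simps)
  moreover have "4 * c\<^sup>2 = ennreal (4 / (p * q))"
    using pq by (simp add: cc ennreal_mult[symmetric] flip: ennreal_numeral)
  ultimately have le: "ennreal (4 / (p * q)) * (?F * ?G) \<le> ennreal (4 / (p * q)) * ?H\<^sup>2"
    by (simp flip: mult.assoc)
  have inv: "ennreal (p * q / 4) * ennreal (4 / (p * q)) = 1"
    using pq by (simp add: ennreal_mult[symmetric] del: ennreal_mult')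
  have "ennreal (p * q / 4) * (ennreal (4 / (p * q)) * (?F * ?G)) \<le> ennreal (p * q / 4) * (ennreal (4 / (p * q)) * ?H\<^sup>2)"
    by (rule mult_left_mono[OF le]) simp
  then show ?thesis by (simp only: mult.assoc[symmetric] inv mult_1)
qed

text \<open>Truncating \<open>f\<close> and \<open>g\<close> in height and in support produces the
  finite suprema and bounded supports of the previous case; monotone convergence removes the
  truncation.\<close>

lemma prekopa_leindler_real:
  fixes f g h :: "real \<Rightarrow> ennreal"
  assumes [measurable]: "f \<in> borel_measurable borel" "g \<in> borel_measurable borel" "h \<in> borel_measurable borel"
    and le: "\<And>s t. f s * g t \<le> (h ((s + t) / 2))\<^sup>2"
  shows "(\<integral>\<^sup>+x. f x \<partial>lborel) * (\<integral>\<^sup>+x. g x \<partial>lborel) \<le> (\<integral>\<^sup>+x. h x \<partial>lborel)\<^sup>2"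
proof -
  define T :: "(real \<Rightarrow> ennreal) \<Rightarrow> nat \<Rightarrow> real \<Rightarrow> ennreal"
    where "T u N x = min (u x) (of_nat N) * indicator {- real N..real N} x" for u N x
  have [measurable]: "T u N \<in> borel_measurable borel" if [measurable]: "u \<in> borel_measurable borel" for u N
    unfolding T_def by measurable
  have Tle: "T u N x \<le> u x" for u N x
    by (auto simp: T_def indicator_def)
  have TN: "T u N x \<le> of_nat N" for u N x
    by (auto simp: T_def indicator_def)
  have inc: "incseq (T u)" for u
  proof (rule incseq_SucI, rule le_funI)
    fix N x
    have "min (u x) (of_nat N) \<le> min (u x) (of_nat (Suc N))"
      by (intro min.mono order.refl) (simp add: le_iff_add)
    then show "T u N x \<le> T u (Suc N) x"
      by (auto simp: T_def indicator_def)
  qed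
  have sup: "(SUP N. T u N x) = u x" for u x
  proof (rule antisym)
    show "u x \<le> (SUP N. T u N x)"
    proof (rule dense_le)
      fix y assume y: "y < u x"
      then have "y < top" using less_le_trans top_greatest by blast
      then obtain n where n: "y < of_nat n"
        using ennreal_Ex_less_of_nat by blast
      define N where "N = max n (nat \<lceil>\<bar>x\<bar>\<rceil>)"
      have "(of_nat n :: ennreal) \<le> of_nat N" unfolding N_def by (intro of_nat_mono) simp
      with n have "y < of_nat N" by (rule less_le_trans)
      moreover have "\<bar>x\<bar> \<le> real N" unfolding N_def by linarith
      ultimately have "y < T u N x"
        using y by (auto simp: T_def indicator_def abs_le_iff)
      then show "y \<le> (SUP N. T u N x)" by (meson SUP_upper2 UNIV_I less_imp_le)
    qed
  qed (auto intro: SUP_least Tle)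
  have nn: "(\<integral>\<^sup>+x. u x \<partial>lborel) = (SUP N. \<integral>\<^sup>+x. T u N x \<partial>lborel)" if [measurable]: "u \<in> borel_measurable borel" for u
    using nn_integral_monotone_convergence_SUP[of "T u" lborel, OF inc] by (simp add: sup)
  have TT: "(\<integral>\<^sup>+x. T f N x \<partial>lborel) * (\<integral>\<^sup>+x. T g N x \<partial>lborel) \<le> (\<integral>\<^sup>+x. h x \<partial>lborel)\<^sup>2" for N
  proof (rule prekopa_leindler_bounded)
    show "T f N s * T g N t \<le> (h ((s + t) / 2))\<^sup>2" for s t
      by (rule order_trans[OF mult_mono le]) (auto intro: Tle)
    have "(SUP x. T u N x) \<le> of_nat N" for u by (intro SUP_least TN)
    then show "(SUP x. T f N x) < top" "(SUP x. T g N x) < top"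
      by (meson le_less_trans of_nat_less_top)+
    have "{x. T u N x \<noteq> 0} \<subseteq> {- real N..real N}" for u
      by (auto simp: T_def indicator_def split: if_splits)
    then show "bounded {x. T f N x \<noteq> 0}" "bounded {x. T g N x \<noteq> 0}"
      using bounded_closed_interval bounded_subset by blast+
  qed auto
  \<comment> \<open>The two suprema run over independent indices. Both truncations grow with the
    index, so the larger index serves for both.\<close>
  have "(\<integral>\<^sup>+x. T f N x \<partial>lborel) * (\<integral>\<^sup>+x. T g M x \<partial>lborel) \<le> (\<integral>\<^sup>+x. h x \<partial>lborel)\<^sup>2" for N M
    by (rule order_trans[OF _ TT[of "max N M"]])
       (intro mult_mono nn_integral_mono le_funD[OF incseqD[OF inc]]; simp)
  then show ?thesis
    unfolding nn[OF assms(1)] nn[OF assms(2)] SUP_mult_left_ennreal SUP_mult_right_ennreal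
    by (intro SUP_least)
qed

section \<open>Lebesgue and Gaussian measure on sequences\<close>

lemma mem_Rn: "x \<in> Rn n \<longleftrightarrow> (\<forall>i\<ge>n. x i = 0)"
  by (simp add: topspace_Euclidean_space)

lemma norm_Rn_sqrt: "norm_Rn n x = sqrt (\<Sum>i<n. (x i)\<^sup>2)"
  by (simp add: norm_Rn_def L2_set_def)

lemma norm_Rn_power2: "(norm_Rn n x)\<^sup>2 = (\<Sum>i<n. (x i)\<^sup>2)"
  by (simp add: norm_Rn_sqrt sum_nonneg)

lemma norm_Rn_nonneg [simp]: "0 \<le> norm_Rn n x"
  by (simp add: norm_Rn_def)

lemma measurable_vecI:
  fixes f :: "'a \<Rightarrow> nat \<Rightarrow> 'b::second_countable_topology"
  shows "(\<And>i. (\<lambda>x. f x i) \<in> borel_measurable M) \<Longrightarrow> f \<in> borel_measurable M"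
  by (rule measurable_coordinatewise_then_product)

lemma measurable_norm_Rn [measurable]: "norm_Rn n \<in> borel_measurable borel"
  unfolding norm_Rn_sqrt[abs_def] by measurable

lemma measurable_fun_upd_vec [measurable]:
  fixes f :: "'a \<Rightarrow> nat \<Rightarrow> 'b::second_countable_topology"
  assumes [measurable]: "f \<in> borel_measurable M" "g \<in> borel_measurable M"
  shows "(\<lambda>x. (f x)(n := g x)) \<in> borel_measurable M"
proof (rule measurable_vecI)
  fix i
  have [measurable]: "(\<lambda>x. f x i) \<in> borel_measurable M"
    using measurable_compose[OF assms(1) measurable_product_coordinates] .
  show "(\<lambda>x. ((f x)(n := g x)) i) \<in> borel_measurable M"
    by (cases "i = n") auto
qed

lemma sets_Rn [measurable]: "Rn n \<in> sets (borel :: (nat \<Rightarrow> real) measure)"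
proof -
  have "Rn n = {x \<in> space borel. \<forall>i\<in>{n..}. x i = 0}" by (auto simp: mem_Rn)
  also have "\<dots> \<in> sets borel" by measurable
  finally show ?thesis .
qed

text \<open>Lebesgue measure on the first \<open>n\<close> coordinates, the others being 0. As a
  measure on all sequences it has the same type for every \<open>n\<close>, and adding a coordinate
  is a product with \<open>lborel\<close>, so inductions on \<open>n\<close> need one-dimensional
  facts only.\<close>

definition leb :: "nat \<Rightarrow> (nat \<Rightarrow> real) measure" where
  "leb = rec_nat (return borel 0) (\<lambda>n M. distr (M \<Otimes>\<^sub>M lborel) borel (\<lambda>p. (fst p)(n := snd p)))"

lemma leb_0: "leb 0 = return borel 0"
  by (simp add: leb_def)

lemma leb_Suc: "leb (Suc n) = distr (leb n \<Otimes>\<^sub>M lborel) borel (\<lambda>p. (fst p)(n := snd p))"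
  by (simp add: leb_def)

lemma sets_leb [simp, measurable_cong]: "sets (leb n) = sets borel"
  by (cases n) (simp_all add: leb_0 leb_Suc)

lemma space_leb [simp]: "space (leb n) = UNIV"
  by (cases n) (simp_all add: leb_0 leb_Suc)

lemma nn_integral_leb_Suc:
  assumes [measurable]: "f \<in> borel_measurable borel"
  shows "(\<integral>\<^sup>+x. f x \<partial>leb (Suc n)) = (\<integral>\<^sup>+x. \<integral>\<^sup>+t. f (x(n := t)) \<partial>lborel \<partial>leb n)"
proof -
  have "(\<integral>\<^sup>+x. f x \<partial>leb (Suc n)) = (\<integral>\<^sup>+p. f ((fst p)(n := snd p)) \<partial>(leb n \<Otimes>\<^sub>M lborel))"
    by (simp add: leb_Suc nn_integral_distr)
  also have "\<dots> = (\<integral>\<^sup>+x. \<integral>\<^sup>+t. f (x(n := t)) \<partial>lborel \<partial>leb n)"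
    by (subst lborel.nn_integral_fst[symmetric]) auto
  finally show ?thesis .
qed

lemma nn_integral_leb_0:
  "f \<in> borel_measurable borel \<Longrightarrow> (\<integral>\<^sup>+x. f x \<partial>leb 0) = f 0"
  by (simp add: leb_0 nn_integral_return)

lemma AE_leb_Rn: "AE x in leb n. x \<in> Rn n"
proof (induction n)
  case 0
  have "Measurable.pred borel (\<lambda>x. x \<in> Rn 0)" by measurable
  then show ?case unfolding leb_0 by (subst AE_return) (simp_all add: mem_Rn[of 0])
next
  case (Suc n)
  have "(\<integral>\<^sup>+x. indicator (- Rn (Suc n)) x \<partial>leb (Suc n))
    = (\<integral>\<^sup>+x. \<integral>\<^sup>+t. indicator (- Rn (Suc n)) (x(n := t)) \<partial>lborel \<partial>leb n)"
    by (rule nn_integral_leb_Suc) auto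
  also have "\<dots> = (\<integral>\<^sup>+x. 0 \<partial>leb n)"
  proof (rule nn_integral_cong_AE, use Suc in eventually_elim)
    fix x :: "nat \<Rightarrow> real" assume "x \<in> Rn n"
    then have "x(n := t) \<in> Rn (Suc n)" for t by (auto simp: mem_Rn)
    then show "(\<integral>\<^sup>+t. indicator (- Rn (Suc n)) (x(n := t)) \<partial>lborel) = 0" by simp
  qed
  finally have "emeasure (leb (Suc n)) (- Rn (Suc n)) = 0" by simp
  then show ?case by (intro AE_I[where N="- Rn (Suc n)"]) auto
qed

lemma leb_Suc_upd_Rn: "x \<in> Rn n \<Longrightarrow> x(n := t) \<in> Rn (Suc n)"
  by (auto simp: mem_Rn)

text \<open>Tensorisation: the one-dimensional inequality in the last coordinate, with the other
  coordinates fixed, is exactly what the induction hypothesis requires of the functions obtained by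
  integrating out that coordinate.\<close>

lemma prekopa_leindler_leb:
  fixes f g h :: "(nat \<Rightarrow> real) \<Rightarrow> ennreal"
  assumes "f \<in> borel_measurable borel" "g \<in> borel_measurable borel" "h \<in> borel_measurable borel"
    and "\<And>x y. x \<in> Rn n \<Longrightarrow> y \<in> Rn n \<Longrightarrow> f x * g y \<le> (h (\<lambda>i. (x i + y i) / 2))\<^sup>2"
  shows "(\<integral>\<^sup>+x. f x \<partial>leb n) * (\<integral>\<^sup>+x. g x \<partial>leb n) \<le> (\<integral>\<^sup>+x. h x \<partial>leb n)\<^sup>2"
  using assms
proof (induction n arbitrary: f g h)
  case 0
  then show ?case
    using "0.prems"(4)[of 0 0] by (simp add: nn_integral_leb_0 mem_Rn zero_fun_def nn_integral_return leb_0)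
next
  case (Suc n)
  note [measurable] = Suc.prems(1-3)
  show ?case unfolding nn_integral_leb_Suc[OF Suc.prems(1)] nn_integral_leb_Suc[OF Suc.prems(2)] nn_integral_leb_Suc[OF Suc.prems(3)]
  proof (rule Suc.IH)
    fix x y assume xy: "x \<in> Rn n" "y \<in> Rn n"
    show "(\<integral>\<^sup>+t. f (x(n := t)) \<partial>lborel) * (\<integral>\<^sup>+t. g (y(n := t)) \<partial>lborel) \<le> (\<integral>\<^sup>+t. h ((\<lambda>i. (x i + y i) / 2)(n := t)) \<partial>lborel)\<^sup>2"
    proof (rule prekopa_leindler_real)
      fix s t
      have "(\<lambda>i. ((x(n := s)) i + (y(n := t)) i) / 2) = (\<lambda>i. (x i + y i) / 2)(n := (s + t) / 2)"
        by auto
      with Suc.prems(4)[OF leb_Suc_upd_Rn[OF xy(1), of s] leb_Suc_upd_Rn[OF xy(2), of t]]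
      show "f (x(n := s)) * g (y(n := t)) \<le> (h ((\<lambda>i. (x i + y i) / 2)(n := (s + t) / 2)))\<^sup>2"
        by (simp only:)
    qed auto
  qed measurable
qed

lemma nn_integral_leb_translate:
  fixes f :: "(nat \<Rightarrow> real) \<Rightarrow> ennreal"
  assumes "f \<in> borel_measurable borel" "a \<in> Rn n"
  shows "(\<integral>\<^sup>+x. f (x + a) \<partial>leb n) = (\<integral>\<^sup>+x. f x \<partial>leb n)"
  using assms
proof (induction n arbitrary: f a)
  case 0
  then have "a = 0" by (auto simp: mem_Rn)
  then show ?case by simp
next
  case (Suc n)
  note [measurable] = Suc.prems(1)
  have [measurable]: "(\<lambda>x. x + b) \<in> borel_measurable borel" for b :: "nat \<Rightarrow> real"
    by (rule measurable_vecI) simp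
  let ?a = "a(n := 0)"
  have a: "?a \<in> Rn n" using Suc.prems(2) by (auto simp: mem_Rn)
  have "(\<integral>\<^sup>+x. f (x + a) \<partial>leb (Suc n)) = (\<integral>\<^sup>+x. \<integral>\<^sup>+t. f (x(n := t) + a) \<partial>lborel \<partial>leb n)"
    by (rule nn_integral_leb_Suc) measurable
  also have "\<dots> = (\<integral>\<^sup>+x. \<integral>\<^sup>+t. f ((x + ?a)(n := t)) \<partial>lborel \<partial>leb n)"
  proof (rule nn_integral_cong)
    fix x :: "nat \<Rightarrow> real"
    have "(\<integral>\<^sup>+t. f (x(n := t) + a) \<partial>lborel) = (\<integral>\<^sup>+t. f ((x + ?a)(n := a n + 1 * t)) \<partial>lborel)"
      by (intro nn_integral_cong arg_cong[where f=f]) (auto simp: fun_eq_iff)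
    also have "\<dots> = (\<integral>\<^sup>+t. f ((x + ?a)(n := t)) \<partial>lborel)"
      using nn_integral_real_affine[of "\<lambda>t. f ((x + ?a)(n := t))" 1 "a n"] by simp
    finally show "(\<integral>\<^sup>+t. f (x(n := t) + a) \<partial>lborel) = (\<integral>\<^sup>+t. f ((x + ?a)(n := t)) \<partial>lborel)" .
  qed
  also have "\<dots> = (\<integral>\<^sup>+x. \<integral>\<^sup>+t. f (x(n := t)) \<partial>lborel \<partial>leb n)"
    by (rule Suc.IH[OF _ a, of "\<lambda>x. \<integral>\<^sup>+t. f (x(n := t)) \<partial>lborel"]) measurable
  also have "\<dots> = (\<integral>\<^sup>+x. f x \<partial>leb (Suc n))"
    by (rule nn_integral_leb_Suc[symmetric]) measurable
  finally show ?case .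
qed

lemma nn_integral_leb_uminus:
  fixes f :: "(nat \<Rightarrow> real) \<Rightarrow> ennreal"
  assumes "f \<in> borel_measurable borel"
  shows "(\<integral>\<^sup>+x. f (- x) \<partial>leb n) = (\<integral>\<^sup>+x. f x \<partial>leb n)"
  using assms
proof (induction n arbitrary: f)
  case 0
  then have [measurable]: "f \<in> borel_measurable borel" by simp
  have [measurable]: "(\<lambda>x. - x) \<in> borel_measurable (borel :: (nat \<Rightarrow> real) measure)"
    by (rule measurable_vecI) simp
  show ?case by (subst (1 2) nn_integral_leb_0) auto
next
  case (Suc n)
  note [measurable] = Suc.prems(1)
  have [measurable]: "(\<lambda>x. - x) \<in> borel_measurable (borel :: (nat \<Rightarrow> real) measure)"
    by (rule measurable_vecI) simp
  have "(\<integral>\<^sup>+x. f (- x) \<partial>leb (Suc n)) = (\<integral>\<^sup>+x. \<integral>\<^sup>+t. f (- (x(n := t))) \<partial>lborel \<partial>leb n)"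
    by (rule nn_integral_leb_Suc) measurable
  also have "\<dots> = (\<integral>\<^sup>+x. \<integral>\<^sup>+t. f ((- x)(n := t)) \<partial>lborel \<partial>leb n)"
  proof (rule nn_integral_cong)
    fix x :: "nat \<Rightarrow> real"
    have "(\<integral>\<^sup>+t. f (- (x(n := t))) \<partial>lborel) = (\<integral>\<^sup>+t. f ((- x)(n := 0 + (- 1) * t)) \<partial>lborel)"
      by (intro nn_integral_cong arg_cong[where f=f]) (auto simp: fun_eq_iff)
    also have "\<dots> = (\<integral>\<^sup>+t. f ((- x)(n := t)) \<partial>lborel)"
      using nn_integral_real_affine[of "\<lambda>t. f ((- x)(n := t))" "-1" 0] by simp
    finally show "(\<integral>\<^sup>+t. f (- (x(n := t))) \<partial>lborel) = (\<integral>\<^sup>+t. f ((- x)(n := t)) \<partial>lborel)" .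
  qed
  also have "\<dots> = (\<integral>\<^sup>+x. \<integral>\<^sup>+t. f (x(n := t)) \<partial>lborel \<partial>leb n)"
    by (rule Suc.IH[of "\<lambda>x. \<integral>\<^sup>+t. f (x(n := t)) \<partial>lborel"]) measurable
  also have "\<dots> = (\<integral>\<^sup>+x. f x \<partial>leb (Suc n))"
    by (rule nn_integral_leb_Suc[symmetric]) measurable
  finally show ?case .
qed

lemma nn_integral_exp_square:
  assumes "0 < s"
  shows "(\<integral>\<^sup>+t. ennreal (exp (- (s * t\<^sup>2))) \<partial>lborel) = ennreal (sqrt (pi / s))"
proof -
  define sd where "sd = 1 / sqrt (2 * s)"
  have sd: "0 < sd" "sd\<^sup>2 = 1 / (2 * s)" using assms by (auto simp: sd_def power_divide)
  have eq: "exp (- (s * t\<^sup>2)) = sqrt (pi / s) * normal_density 0 sd t" for t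
  proof -
    have "2 * pi * sd\<^sup>2 = pi / s" "t\<^sup>2 / (2 * sd\<^sup>2) = s * t\<^sup>2"
      using assms by (auto simp: sd(2) field_simps)
    then show ?thesis using assms by (simp add: normal_density_def real_sqrt_divide)
  qed
  have "(\<integral>\<^sup>+t. ennreal (normal_density 0 sd t) \<partial>lborel) = 1"
    using prob_space.emeasure_space_1[OF prob_space_normal_density[OF sd(1), of 0]]
    by (simp add: emeasure_density)
  then show ?thesis
    using assms sd unfolding eq by (simp add: ennreal_mult nn_integral_cmult)
qed

lemma nn_integral_leb_gauss:
  assumes "0 < s"
  shows "(\<integral>\<^sup>+x. ennreal (exp (- (s * (\<Sum>i<n. (x i)\<^sup>2)))) \<partial>leb n) = ennreal (sqrt (pi / s) ^ n)"
proof (induction n)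
  case 0
  show ?case by (subst nn_integral_leb_0) auto
next
  case (Suc n)
  have "(\<integral>\<^sup>+x. ennreal (exp (- (s * (\<Sum>i<Suc n. (x i)\<^sup>2)))) \<partial>leb (Suc n))
    = (\<integral>\<^sup>+x. \<integral>\<^sup>+t. ennreal (exp (- (s * (\<Sum>i<Suc n. ((x(n := t)) i)\<^sup>2)))) \<partial>lborel \<partial>leb n)"
    by (rule nn_integral_leb_Suc) measurable
  also have "\<dots> = (\<integral>\<^sup>+x. \<integral>\<^sup>+t. ennreal (exp (- (s * (\<Sum>i<n. (x i)\<^sup>2)))) * ennreal (exp (- (s * t\<^sup>2))) \<partial>lborel \<partial>leb n)"
    by (intro nn_integral_cong) (simp add: ennreal_mult[symmetric] exp_add[symmetric] algebra_simps)
  also have "\<dots> = ennreal (sqrt (pi / s) ^ n) * ennreal (sqrt (pi / s))"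
    using assms by (simp add: nn_integral_cmult nn_integral_multc nn_integral_exp_square Suc.IH)
  also have "\<dots> = ennreal (sqrt (pi / s) ^ Suc n)"
    using assms by (simp add: ennreal_mult[symmetric] mult.commute)
  finally show ?case .
qed

text \<open>Balls have finite measure: on \<open>A m\<close> the function exp (m - |x|^2) is at
  least 1, and its integral is a Gaussian one. The exchange of integrals in
  \<open>emeasure_leb_rotation\<close> depends on this.\<close>

lemma sigma_finite_leb: "sigma_finite_measure (leb n)"
proof
  define A where "A m = {x :: nat \<Rightarrow> real. (\<Sum>i<n. (x i)\<^sup>2) \<le> real m}" for m :: nat
  have [measurable]: "A m \<in> sets borel" for m
    unfolding A_def by measurable
  have "emeasure (leb n) (A m) < \<infinity>" for m
  proof -
    have "emeasure (leb n) (A m) = (\<integral>\<^sup>+x. indicator (A m) x \<partial>leb n)" by simp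
    also have "\<dots> \<le> (\<integral>\<^sup>+x. ennreal (exp m) * ennreal (exp (- (1 * (\<Sum>i<n. (x i)\<^sup>2)))) \<partial>leb n)"
      by (intro nn_integral_mono)
         (auto simp: A_def indicator_def ennreal_mult[symmetric] exp_add[symmetric])
    also have "\<dots> = ennreal (exp m) * ennreal (sqrt (pi / 1) ^ n)"
      by (subst nn_integral_cmult) (simp_all only: nn_integral_leb_gauss[OF zero_less_one], measurable)
    also have "\<dots> < \<infinity>" by (simp add: ennreal_mult_less_top)
    finally show ?thesis .
  qed
  moreover have "(\<Union>m. A m) = UNIV"
    by (auto simp: A_def real_arch_simple)
  ultimately show "\<exists>A. countable A \<and> A \<subseteq> sets (leb n) \<and> \<Union>A = space (leb n) \<and> (\<forall>a\<in>A. emeasure (leb n) a \<noteq> \<infinity>)"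
    by (intro exI[of _ "range A"]) (auto simp: less_top)
qed

section \<open>The standard Gaussian measure: total mass, integrability and exponential
  moments\<close>

definition gauss :: "nat \<Rightarrow> (nat \<Rightarrow> real) measure" where
  "gauss n = density (leb n) (\<lambda>x. ennreal ((1 / sqrt (2 * pi)) ^ n * exp (- (1/2 * (\<Sum>i<n. (x i)\<^sup>2)))))"

lemma sets_gauss [simp, measurable_cong]: "sets (gauss n) = sets borel"
  by (simp add: gauss_def)

lemma space_gauss [simp]: "space (gauss n) = UNIV"
  by (simp add: gauss_def)

lemma nn_integral_gauss:
  assumes [measurable]: "f \<in> borel_measurable borel"
  shows "(\<integral>\<^sup>+x. f x \<partial>gauss n) =
    (\<integral>\<^sup>+x. ennreal ((1 / sqrt (2 * pi)) ^ n * exp (- (1/2 * (\<Sum>i<n. (x i)\<^sup>2)))) * f x \<partial>leb n)"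
  unfolding gauss_def by (rule nn_integral_density) measurable

lemma AE_gauss_Rn: "AE x in gauss n. x \<in> Rn n"
  unfolding gauss_def by (subst AE_density) (use AE_leb_Rn in \<open>auto elim: eventually_mono\<close>)

text \<open>The factor exp (s |x|^2) only changes the variance of the Gaussian density. The value s
  = 0 gives total mass 1, s = 1/4 integrability of the norm, and s = -3/2 the lower bound on the
  norm in \<open>gauss_norm_lower\<close>.\<close>

lemma nn_integral_gauss_exp_square:
  assumes "s < 1/2"
  shows "(\<integral>\<^sup>+x. ennreal (exp (s * (norm_Rn n x)\<^sup>2)) \<partial>gauss n) = ennreal ((1 / sqrt (1 - 2 * s)) ^ n)"
proof -
  have "(\<integral>\<^sup>+x. ennreal (exp (s * (norm_Rn n x)\<^sup>2)) \<partial>gauss n)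
     = (\<integral>\<^sup>+x. ennreal ((1 / sqrt (2 * pi)) ^ n) * ennreal (exp (- ((1/2 - s) * (\<Sum>i<n. (x i)\<^sup>2)))) \<partial>leb n)"
    by (subst nn_integral_gauss, measurable)
       (intro nn_integral_cong, simp add: norm_Rn_power2 ennreal_mult[symmetric] exp_add[symmetric] algebra_simps)
  also have "\<dots> = ennreal ((1 / sqrt (2 * pi)) ^ n) * ennreal (sqrt (pi / (1/2 - s)) ^ n)"
    using assms by (subst nn_integral_cmult, measurable) (subst nn_integral_leb_gauss; simp)
  also have "\<dots> = ennreal ((1 / sqrt (2 * pi) * sqrt (pi / (1/2 - s))) ^ n)"
    by (simp only: power_mult_distrib, subst ennreal_mult) (use assms in auto)
  also have "1 / sqrt (2 * pi) * sqrt (pi / (1/2 - s)) = 1 / sqrt (1 - 2 * s)"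
  proof -
    have "pi / (1/2 - s) = 2 * pi / (1 - 2 * s)" using assms by (simp add: field_simps)
    then show ?thesis by (simp add: real_sqrt_divide)
  qed
  finally show ?thesis .
qed

lemma prob_space_gauss: "prob_space (gauss n)"
proof
  have "emeasure (gauss n) (space (gauss n)) = (\<integral>\<^sup>+x. 1 \<partial>gauss n)" by simp
  also have "\<dots> = 1" using nn_integral_gauss_exp_square[of 0 n] by simp
  finally show "emeasure (gauss n) (space (gauss n)) = 1" .
qed

lemma integrable_gauss_norm: "integrable (gauss n) (norm_Rn n)"
proof (rule integrableI_bounded)
  have "ennreal (norm (norm_Rn n x)) \<le> ennreal (4 * exp (1/4 * (norm_Rn n x)\<^sup>2))" for x
  proof (rule ennreal_leI)
    have "norm_Rn n x \<le> 1 + 1/4 * (norm_Rn n x)\<^sup>2"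
      using zero_le_power2[of "norm_Rn n x / 2 - 1"] by (simp add: power2_eq_square algebra_simps)
    also have "\<dots> \<le> exp (1/4 * (norm_Rn n x)\<^sup>2)" by (rule exp_ge_add_one_self)
    also have "\<dots> \<le> 4 * exp (1/4 * (norm_Rn n x)\<^sup>2)" by simp
    finally show "norm (norm_Rn n x) \<le> 4 * exp (1/4 * (norm_Rn n x)\<^sup>2)" by simp
  qed
  then have "(\<integral>\<^sup>+x. ennreal (norm (norm_Rn n x)) \<partial>gauss n) \<le> (\<integral>\<^sup>+x. 4 * ennreal (exp (1/4 * (norm_Rn n x)\<^sup>2)) \<partial>gauss n)"
    by (intro nn_integral_mono) (simp add: ennreal_mult)
  also have "\<dots> = 4 * (\<integral>\<^sup>+x. ennreal (exp (1/4 * (norm_Rn n x)\<^sup>2)) \<partial>gauss n)"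
    by (rule nn_integral_cmult) measurable
  also have "\<dots> < \<infinity>"
    by (subst nn_integral_gauss_exp_square) (auto simp: ennreal_mult_less_top)
  finally show "(\<integral>\<^sup>+x. ennreal (norm (norm_Rn n x)) \<partial>gauss n) < \<infinity>" .
qed measurable

text \<open>Prekopa--Leindler for the weights \<open>exp (l F) \<phi>\<close>, \<open>exp (- l F) \<phi>\<close> and \<open>exp (l\<^sup>2 L\<^sup>2 / 2) \<phi>\<close>, where \<open>\<phi>\<close> is
  the Gaussian density, bounds the product of the two exponential moments; the second one is at
  least 1 by Jensen's inequality.\<close>

lemma gauss_exponential_moment:
  fixes F :: "(nat \<Rightarrow> real) \<Rightarrow> real"
  assumes [measurable]: "F \<in> borel_measurable borel"
    and lip: "\<And>x y. x \<in> Rn n \<Longrightarrow> y \<in> Rn n \<Longrightarrow> F x - F y \<le> L * norm_Rn n (x - y)"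
    and int: "integrable (gauss n) F" "(\<integral>x. F x \<partial>gauss n) = 0" and l: "0 \<le> l"
  shows "(\<integral>\<^sup>+x. ennreal (exp (l * F x)) \<partial>gauss n) \<le> ennreal (exp (l\<^sup>2 * L\<^sup>2))"
proof -
  interpret prob_space "gauss n" by (rule prob_space_gauss)
  let ?c = "(1 / sqrt (2 * pi)) ^ n" and ?q = "\<lambda>x :: nat \<Rightarrow> real. \<Sum>i<n. (x i)\<^sup>2"
  have c: "0 < ?c" by simp
  have "(\<integral>\<^sup>+x. ennreal (?c * exp (- (1/2 * ?q x))) * ennreal (exp (l * F x)) \<partial>leb n)
     * (\<integral>\<^sup>+x. ennreal (?c * exp (- (1/2 * ?q x))) * ennreal (exp (- l * F x)) \<partial>leb n)
     \<le> (\<integral>\<^sup>+x. ennreal (?c * exp (- (1/2 * ?q x))) * ennreal (exp (l\<^sup>2 * L\<^sup>2 / 2)) \<partial>leb n)\<^sup>2"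
  proof (rule prekopa_leindler_leb)
    fix x y assume xy: "x \<in> Rn n" "y \<in> Rn n"
    let ?m = "\<lambda>i. (x i + y i) / 2"
    define d where "d = norm_Rn n (x - y)"
    \<comment> \<open>Parallelogram identity. The surplus d^2 / 4 absorbs the Lipschitz term l L d
      after completing the square, at the price l^2 L^2.\<close>
    have "?q x / 2 + ?q y / 2 = ?q ?m + d\<^sup>2 / 4"
      unfolding d_def norm_Rn_power2 sum_divide_distrib sum.distrib[symmetric]
      by (intro sum.cong refl) (simp add: power2_eq_square field_simps)
    moreover have "l * (F x - F y) \<le> l * (L * d)"
      using lip[OF xy] l unfolding d_def by (rule mult_left_mono)
    moreover have "l * L * d \<le> l\<^sup>2 * L\<^sup>2 + d\<^sup>2 / 4"
      using zero_le_power2[of "l * L - d / 2"] by (simp add: power2_eq_square algebra_simps)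
    ultimately have "- (1/2 * ?q x) + l * F x + (- (1/2 * ?q y) + - l * F y) \<le> 2 * (- (1/2 * ?q ?m)) + l\<^sup>2 * L\<^sup>2"
      by (simp add: algebra_simps)
    then have "exp (- (1/2 * ?q x) + l * F x + (- (1/2 * ?q y) + - l * F y)) \<le> exp (2 * (- (1/2 * ?q ?m)) + 2 * (l\<^sup>2 * L\<^sup>2 / 2))"
      by simp
    then have "?c\<^sup>2 * exp (- (1/2 * ?q x) + l * F x + (- (1/2 * ?q y) + - l * F y)) \<le> ?c\<^sup>2 * exp (2 * (- (1/2 * ?q ?m)) + 2 * (l\<^sup>2 * L\<^sup>2 / 2))"
      by (rule mult_left_mono) simp
    then have "?c * exp (- (1/2 * ?q x)) * exp (l * F x) * (?c * exp (- (1/2 * ?q y)) * exp (- l * F y))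
      \<le> (?c * exp (- (1/2 * ?q ?m)) * exp (l\<^sup>2 * L\<^sup>2 / 2))\<^sup>2"
      unfolding exp_add exp_double power_mult_distrib by (simp only: power2_eq_square mult_ac)
    then show "ennreal (?c * exp (- (1/2 * ?q x))) * ennreal (exp (l * F x)) * (ennreal (?c * exp (- (1/2 * ?q y))) * ennreal (exp (- l * F y)))
      \<le> (ennreal (?c * exp (- (1/2 * ?q ?m))) * ennreal (exp (l\<^sup>2 * L\<^sup>2 / 2)))\<^sup>2"
      using c by (simp only: ennreal_mult[symmetric] ennreal_power zero_le_mult_iff less_imp_le exp_ge_zero simp_thms power2_eq_square)
        (intro ennreal_leI)
  qed measurable
  then have prod: "(\<integral>\<^sup>+x. ennreal (exp (l * F x)) \<partial>gauss n) * (\<integral>\<^sup>+x. ennreal (exp (- l * F x)) \<partial>gauss n)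
      \<le> (\<integral>\<^sup>+x. ennreal (exp (l\<^sup>2 * L\<^sup>2 / 2)) \<partial>gauss n)\<^sup>2"
    by (subst (1 2 3) nn_integral_gauss; (measurable)?)
  \<comment> \<open>Jensen's inequality in the form exp y \<ge> 1 + y; the integral of 1 - l F is 1
    because \<open>F\<close> has mean 0. The maximum with 0 makes the integrand nonnegative, as the
    extended integral requires.\<close>
  have int': "integrable (gauss n) (\<lambda>x. max 0 (1 + (- l * F x)))"
    using int by auto
  have "1 = ennreal (\<integral>x. 1 + (- l * F x) \<partial>gauss n)"
    using int prob_space by simp
  also have "\<dots> \<le> ennreal (\<integral>x. max 0 (1 + (- l * F x)) \<partial>gauss n)"
    using int int' by (intro ennreal_leI integral_mono) auto
  also have "\<dots> = (\<integral>\<^sup>+x. ennreal (max 0 (1 + (- l * F x))) \<partial>gauss n)"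
    by (rule nn_integral_eq_integral[symmetric, OF int']) simp
  also have "\<dots> \<le> (\<integral>\<^sup>+x. ennreal (exp (- l * F x)) \<partial>gauss n)"
    by (intro nn_integral_mono ennreal_leI) (simp only: max.bounded_iff exp_ge_zero exp_ge_add_one_self simp_thms)
  finally have "(\<integral>\<^sup>+x. ennreal (exp (l * F x)) \<partial>gauss n) * 1
     \<le> (\<integral>\<^sup>+x. ennreal (exp (l * F x)) \<partial>gauss n) * (\<integral>\<^sup>+x. ennreal (exp (- l * F x)) \<partial>gauss n)"
    by (rule mult_left_mono) simp
  also note prod
  also have "(\<integral>\<^sup>+x. ennreal (exp (l\<^sup>2 * L\<^sup>2 / 2)) \<partial>gauss n)\<^sup>2 = ennreal (exp (l\<^sup>2 * L\<^sup>2))"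
    using emeasure_space_1 by (simp add: ennreal_power exp_double[symmetric])
  finally show ?thesis by simp
qed

section \<open>Euclidean geometry of the sequence spaces\<close>

lemma scaleR_fun_apply [simp]: "(r *\<^sub>R f) i = r *\<^sub>R (f i :: 'b::real_vector)"
  by (simp add: scaleR_fun_def)

lemma inner_Rn_add_left: "inner_Rn n (x + y) z = inner_Rn n x z + inner_Rn n y z"
  and inner_Rn_add_right: "inner_Rn n z (x + y) = inner_Rn n z x + inner_Rn n z y"
  and inner_Rn_diff_left: "inner_Rn n (x - y) z = inner_Rn n x z - inner_Rn n y z"
  and inner_Rn_diff_right: "inner_Rn n z (x - y) = inner_Rn n z x - inner_Rn n z y"
  by (simp_all add: inner_Rn_def sum.distrib sum_subtractf algebra_simps)

lemma inner_Rn_scaleR_left: "inner_Rn n (r *\<^sub>R x) z = r * inner_Rn n x z"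
  and inner_Rn_scaleR_right: "inner_Rn n z (r *\<^sub>R x) = r * inner_Rn n z x"
  by (simp_all add: inner_Rn_def sum_distrib_left algebra_simps)

lemma inner_Rn_commute: "inner_Rn n x y = inner_Rn n y x"
  by (simp add: inner_Rn_def mult.commute)

lemma inner_Rn_0 [simp]: "inner_Rn n 0 x = 0" "inner_Rn n x 0 = 0"
  by (simp_all add: inner_Rn_def)

lemmas inner_Rn_simps = inner_Rn_add_left inner_Rn_add_right inner_Rn_diff_left inner_Rn_diff_right
  inner_Rn_scaleR_left inner_Rn_scaleR_right

lemma inner_Rn_self: "inner_Rn n x x = (norm_Rn n x)\<^sup>2"
  unfolding norm_Rn_power2 by (simp add: inner_Rn_def power2_eq_square)

lemma norm_Rn_eq_sqrt_inner: "norm_Rn n x = sqrt (inner_Rn n x x)"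
  by (simp add: inner_Rn_self)

lemma norm_Rn_triangle: "norm_Rn n (x + y) \<le> norm_Rn n x + norm_Rn n y"
  unfolding norm_Rn_def plus_fun_def by (rule L2_set_triangle_ineq)

lemma norm_Rn_scaleR [simp]: "norm_Rn n (r *\<^sub>R x) = \<bar>r\<bar> * norm_Rn n x"
  by (simp add: norm_Rn_eq_sqrt_inner inner_Rn_simps real_sqrt_mult mult.assoc[symmetric])

lemma norm_Rn_minus [simp]: "norm_Rn n (- x) = norm_Rn n x"
  by (simp add: norm_Rn_sqrt)

lemma norm_Rn_minus_commute: "norm_Rn n (x - y) = norm_Rn n (y - x)"
  using norm_Rn_minus[of n "x - y"] by simp

lemma norm_Rn_triangle_diff: "norm_Rn n (x - z) \<le> norm_Rn n (x - y) + norm_Rn n (y - z)"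
  using norm_Rn_triangle[of n "x - y" "y - z"] by simp

lemma norm_Rn_triangle_sub: "norm_Rn n x \<le> norm_Rn n y + norm_Rn n (x - y)"
  using norm_Rn_triangle[of n y "x - y"] by simp

lemma norm_Rn_0 [simp]: "norm_Rn n 0 = 0"
  by (simp add: norm_Rn_sqrt)

lemma norm_Rn_eq_0: "x \<in> Rn n \<Longrightarrow> norm_Rn n x = 0 \<longleftrightarrow> x = 0"
  by (auto simp: norm_Rn_sqrt sum_nonneg_eq_0_iff mem_Rn fun_eq_iff not_less[symmetric])

lemma inner_Rn_Cauchy_Schwarz: "\<bar>inner_Rn n x y\<bar> \<le> norm_Rn n x * norm_Rn n y"
proof -
  have "\<bar>inner_Rn n x y\<bar> \<le> (\<Sum>i<n. \<bar>x i\<bar> * \<bar>y i\<bar>)"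
    unfolding inner_Rn_def by (rule order_trans[OF sum_abs]) (simp add: abs_mult)
  also have "\<dots> \<le> norm_Rn n x * norm_Rn n y"
    unfolding norm_Rn_def by (rule L2_set_mult_ineq)
  finally show ?thesis .
qed

lemma abs_coord_le_norm_Rn: "i < n \<Longrightarrow> \<bar>x i\<bar> \<le> norm_Rn n x"
  using member_le_L2_set[of "{..<n}" i "\<lambda>i. \<bar>x i\<bar>"] by (simp add: norm_Rn_def L2_set_def)

lemma Rn_0 [simp]: "0 \<in> Rn n"
  and Rn_add: "x \<in> Rn n \<Longrightarrow> y \<in> Rn n \<Longrightarrow> x + y \<in> Rn n"
  and Rn_diff: "x \<in> Rn n \<Longrightarrow> y \<in> Rn n \<Longrightarrow> x - y \<in> Rn n"
  and Rn_scaleR: "x \<in> Rn n \<Longrightarrow> r *\<^sub>R x \<in> Rn n"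
  and Rn_uminus: "x \<in> Rn n \<Longrightarrow> - x \<in> Rn n"
  by (simp_all add: mem_Rn)

lemma subspace_Rn: "subspace (Rn n)"
  by (simp add: subspace_def Rn_add Rn_scaleR)

subsection \<open>Orthonormal families\<close>

text \<open>Only the first \<open>k\<close> values of \<open>v\<close> count, so that families of
  every length share one type and one Borel structure.\<close>

definition orthonormal :: "nat \<Rightarrow> nat \<Rightarrow> (nat \<Rightarrow> nat \<Rightarrow> real) \<Rightarrow> bool" where
  "orthonormal n k v \<longleftrightarrow> (\<forall>i<k. v i \<in> Rn n \<and> (\<forall>j<k. inner_Rn n (v i) (v j) = (if i = j then 1 else 0)))"

text \<open>Serves in two ways: as the linear combination with coefficients \<open>a\<close>, and,
  for \<open>orthonormal n n w\<close>, as the rotation \<open>comb n w\<close> that sends the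
  coordinate vectors to the \<open>w i\<close> and ignores all coordinates from \<open>n\<close>
  on.\<close>

definition comb :: "nat \<Rightarrow> (nat \<Rightarrow> nat \<Rightarrow> real) \<Rightarrow> (nat \<Rightarrow> real) \<Rightarrow> nat \<Rightarrow> real" where
  "comb k v a = (\<lambda>j. \<Sum>i<k. a i * v i j)"

lemma comb_eq_sum: "comb k v a = (\<Sum>i<k. a i *\<^sub>R v i)"
  by (induction k) (auto simp: comb_def fun_eq_iff)

lemma comb_Suc: "comb (Suc k) v a = comb k v a + a k *\<^sub>R v k"
  by (simp add: comb_eq_sum)

lemma comb_cong: "(\<And>i. i < k \<Longrightarrow> v i = w i) \<Longrightarrow> (\<And>i. i < k \<Longrightarrow> a i = b i) \<Longrightarrow> comb k v a = comb k w b"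
  by (simp add: comb_eq_sum)

lemma comb_add: "comb k v (a + b) = comb k v a + comb k v b"
  and comb_diff: "comb k v (a - b) = comb k v a - comb k v b"
  and comb_scaleR: "comb k v (r *\<^sub>R a) = r *\<^sub>R comb k v a"
  and comb_diff_frame: "comb k (\<lambda>i. v i - w i) a = comb k v a - comb k w a"
  by (auto simp: comb_def fun_eq_iff sum.distrib sum_subtractf sum_distrib_left algebra_simps)

lemma comb_in_Rn: "(\<And>i. i < k \<Longrightarrow> v i \<in> Rn n) \<Longrightarrow> comb k v a \<in> Rn n"
  by (auto simp: comb_def mem_Rn)

lemma inner_comb_left: "inner_Rn n (comb k v a) x = (\<Sum>i<k. a i * inner_Rn n (v i) x)"
  unfolding inner_Rn_def comb_def sum_distrib_left sum_distrib_right
  by (subst sum.swap) (simp add: mult.assoc)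

lemma inner_comb_right: "inner_Rn n x (comb k v a) = (\<Sum>i<k. a i * inner_Rn n x (v i))"
  by (simp add: inner_Rn_commute[of n x] inner_comb_left)

lemma linear_comb: "linear T \<Longrightarrow> T (comb k v a) = comb k (\<lambda>i. T (v i)) a"
  by (simp add: comb_eq_sum linear_sum linear_scale)

lemma orthonormalD:
  assumes "orthonormal n k v" "i < k"
  shows "v i \<in> Rn n" "norm_Rn n (v i) = 1" "j < k \<Longrightarrow> inner_Rn n (v i) (v j) = (if i = j then 1 else 0)"
  using assms by (auto simp: orthonormal_def norm_Rn_eq_sqrt_inner)

lemma orthonormal_less: "orthonormal n k v \<Longrightarrow> j \<le> k \<Longrightarrow> orthonormal n j v"
  by (auto simp: orthonormal_def)

lemma orthonormal_cong: "(\<And>i. i < k \<Longrightarrow> v i = w i) \<Longrightarrow> orthonormal n k v \<longleftrightarrow> orthonormal n k w"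
  by (auto simp: orthonormal_def)

lemma inner_comb_orthonormal:
  assumes "orthonormal n k v"
  shows "j < k \<Longrightarrow> inner_Rn n (comb k v a) (v j) = a j"
    and "inner_Rn n (comb k v a) (comb k v b) = inner_Rn k a b"
proof -
  show 1: "inner_Rn n (comb k v a) (v j) = a j" if "j < k" for j a
  proof -
    have "inner_Rn n (comb k v a) (v j) = (\<Sum>i<k. if i = j then a i else 0)"
      unfolding inner_comb_left using orthonormalD(3)[OF assms] that by (intro sum.cong) auto
    then show ?thesis using that by simp
  qed
  show "inner_Rn n (comb k v a) (comb k v b) = inner_Rn k a b"
    unfolding inner_comb_right inner_Rn_def[of k] by (intro sum.cong refl) (simp add: 1)
qed

lemma norm_comb_orthonormal: "orthonormal n k v \<Longrightarrow> norm_Rn n (comb k v a) = norm_Rn k a"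
  by (simp add: norm_Rn_eq_sqrt_inner inner_comb_orthonormal)

lemma comb_in_span: "comb k v a \<in> span (v ` {..<k})"
  unfolding comb_eq_sum by (intro span_sum span_scale span_base) auto

text \<open>The sequences equal to their own expansion form a subspace that contains every
  \<open>v i\<close>.\<close>

lemma span_orthonormal_comb:
  assumes "orthonormal n k v" "x \<in> span (v ` {..<k})"
  shows "x = comb k v (\<lambda>i. inner_Rn n x (v i))"
proof -
  let ?S = "{x. x = comb k v (\<lambda>i. inner_Rn n x (v i))}"
  have add: "(\<lambda>i. inner_Rn n (x + y) (v i)) = (\<lambda>i. inner_Rn n x (v i)) + (\<lambda>i. inner_Rn n y (v i))" for x y
    by (auto simp: inner_Rn_simps)
  have scale: "(\<lambda>i. inner_Rn n (c *\<^sub>R x) (v i)) = c *\<^sub>R (\<lambda>i. inner_Rn n x (v i))" for c x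
    by (auto simp: inner_Rn_simps)
  have "subspace ?S"
    unfolding subspace_def mem_Collect_eq add scale comb_add comb_scaleR
    by (auto simp: comb_def fun_eq_iff)
  moreover have "v ` {..<k} \<subseteq> ?S"
  proof safe
    fix j assume "j < k"
    have "(\<Sum>i<k. inner_Rn n (v j) (v i) * v i l) = (\<Sum>i<k. if i = j then v j l else 0)" for l
      using orthonormalD(3)[OF assms(1) \<open>j < k\<close>] by (intro sum.cong) auto
    then show "v j = comb k v (\<lambda>i. inner_Rn n (v j) (v i))"
      using \<open>j < k\<close> by (simp add: comb_def)
  qed
  ultimately show ?thesis
    using span_minimal[of "v ` {..<k}" ?S] assms(2) by blast
qed

text \<open>The Gram--Schmidt remainder: for an orthonormal family, \<open>x\<close> minus its
  orthogonal projection onto the span.\<close>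

definition resid :: "nat \<Rightarrow> nat \<Rightarrow> (nat \<Rightarrow> nat \<Rightarrow> real) \<Rightarrow> (nat \<Rightarrow> real) \<Rightarrow> nat \<Rightarrow> real" where
  "resid n k v x = x - comb k v (\<lambda>i. inner_Rn n x (v i))"

lemma inner_resid: "orthonormal n k v \<Longrightarrow> j < k \<Longrightarrow> inner_Rn n (resid n k v x) (v j) = 0"
  by (simp add: resid_def inner_Rn_simps inner_comb_orthonormal)

lemma resid_in_Rn: "orthonormal n k v \<Longrightarrow> x \<in> Rn n \<Longrightarrow> resid n k v x \<in> Rn n"
  unfolding resid_def by (intro Rn_diff comb_in_Rn) (auto dest: orthonormalD)

lemma resid_eq_0_span: "resid n k v x = 0 \<Longrightarrow> x \<in> span (v ` {..<k})"
  unfolding resid_def by (metis comb_in_span eq_iff_diff_eq_0)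

definition normalize_Rn :: "nat \<Rightarrow> (nat \<Rightarrow> real) \<Rightarrow> nat \<Rightarrow> real" where
  "normalize_Rn n x = (1 / norm_Rn n x) *\<^sub>R x"

lemma norm_normalize_Rn: "norm_Rn n x \<noteq> 0 \<Longrightarrow> norm_Rn n (normalize_Rn n x) = 1"
  by (simp add: normalize_Rn_def)

lemma orthonormal_extend:
  assumes "orthonormal n k v" "x \<in> Rn n" "resid n k v x \<noteq> 0"
  shows "orthonormal n (Suc k) (v(k := normalize_Rn n (resid n k v x)))"
proof -
  let ?r = "resid n k v x"
  have r: "?r \<in> Rn n" by (rule resid_in_Rn[OF assms(1,2)])
  then have n: "norm_Rn n ?r \<noteq> 0" using assms(3) by (simp add: norm_Rn_eq_0)
  have "inner_Rn n (normalize_Rn n ?r) (normalize_Rn n ?r) = 1"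
    using norm_normalize_Rn[OF n] by (simp add: inner_Rn_self)
  moreover have "inner_Rn n (normalize_Rn n ?r) (v j) = 0" "inner_Rn n (v j) (normalize_Rn n ?r) = 0" if "j < k" for j
    using inner_resid[OF assms(1) that, of x]
    by (simp_all add: normalize_Rn_def inner_Rn_simps inner_Rn_commute[of n "v j"])
  moreover have "normalize_Rn n ?r \<in> Rn n" using r by (simp add: normalize_Rn_def Rn_scaleR)
  ultimately show ?thesis
    using assms(1) by (auto simp: orthonormal_def less_Suc_eq)
qed

lemma orthonormal_notin_span:
  assumes "orthonormal n (Suc k) v"
  shows "v k \<notin> span (v ` {..<k})"
proof
  assume a: "v k \<in> span (v ` {..<k})"
  have on: "orthonormal n k v" by (rule orthonormal_less[OF assms]) simp
  have "v k = comb k v (\<lambda>i. inner_Rn n (v k) (v i))"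
    by (rule span_orthonormal_comb[OF on a])
  moreover have "comb k v (\<lambda>i. inner_Rn n (v k) (v i)) = comb k v (\<lambda>i. 0)"
  proof (rule comb_cong)
    fix i assume "i < k"
    then show "inner_Rn n (v k) (v i) = 0" using orthonormalD(3)[OF assms, of k i] by simp
  qed (rule refl)
  moreover have "comb k v (\<lambda>i. 0) = 0" by (simp add: comb_def fun_eq_iff)
  ultimately have "norm_Rn n (v k) = 0" by (metis norm_Rn_0)
  then show False using orthonormalD(2)[OF assms lessI] by simp
qed

lemma orthonormal_inj: "orthonormal n k v \<Longrightarrow> inj_on v {..<k}"
  by (rule inj_onI) (metis lessThan_iff orthonormalD(3) zero_neq_one)

lemma orthonormal_independent: "orthonormal n k v \<Longrightarrow> independent (v ` {..<k})"
proof (induction k)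
  case (Suc k)
  have "independent (insert (v k) (v ` {..<k}))"
    by (rule independent_insertI[OF orthonormal_notin_span[OF Suc.prems]])
       (rule Suc.IH[OF orthonormal_less[OF Suc.prems]], simp)
  then show ?case by (simp add: lessThan_Suc)
qed (simp add: independent_empty)

lemma dim_orthonormal: "orthonormal n k v \<Longrightarrow> dim (v ` {..<k}) = k"
  using dim_eq_card_independent[OF orthonormal_independent] orthonormal_inj
  by (metis card_image card_lessThan)

lemma span_orthonormal_subset_Rn: "orthonormal n k v \<Longrightarrow> span (v ` {..<k}) \<subseteq> Rn n"
  by (intro span_minimal subspace_Rn) (auto dest: orthonormalD)

lemma orthonormal_in_span_bound:
  assumes "orthonormal n k v" "finite B" "v ` {..<k} \<subseteq> span B"
  shows "k \<le> card B"
  using independent_span_bound[OF assms(2) orthonormal_independent[OF assms(1)] assms(3)]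
    orthonormal_inj[OF assms(1)] by (simp add: card_image)

text \<open>Gram--Schmidt inside \<open>F\<close>: as long as j < k, the exchange lemma supplies a
  vector of the basis \<open>B\<close> outside the span of the j vectors found so far, and its
  remainder stays in \<open>F\<close>.\<close>

lemma orthonormal_basis_upto:
  assumes "subspace F" "F \<subseteq> Rn n" "independent B" "B \<subseteq> F" "card B = k" "finite B" "j \<le> k"
  shows "\<exists>v. orthonormal n j v \<and> v ` {..<j} \<subseteq> F"
  using \<open>j \<le> k\<close>
proof (induction j)
  case 0
  show ?case by (auto simp: orthonormal_def)
next
  case (Suc j)
  then obtain v where v: "orthonormal n j v" "v ` {..<j} \<subseteq> F" by auto
  have "\<not> B \<subseteq> span (v ` {..<j})"
  proof
    assume "B \<subseteq> span (v ` {..<j})"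
    then have "card B \<le> card (v ` {..<j})"
      using independent_span_bound[OF _ assms(3)] by auto
    also have "\<dots> \<le> j" using card_image_le[of "{..<j}" v] by simp
    finally show False using Suc.prems assms(5) by simp
  qed
  then obtain x where x: "x \<in> B" "x \<notin> span (v ` {..<j})" by auto
  then have r: "resid n j v x \<noteq> 0" using resid_eq_0_span by blast
  have xF: "x \<in> F" "x \<in> Rn n" using x assms by auto
  have "span (v ` {..<j}) \<subseteq> F" using v assms(1) by (intro span_minimal)
  then have "resid n j v x \<in> F"
    unfolding resid_def using xF comb_in_span by (intro subspace_diff[OF assms(1)]) auto
  then have "normalize_Rn n (resid n j v x) \<in> F"
    unfolding normalize_Rn_def by (rule subspace_scale[OF assms(1)])
  then have "(v(j := normalize_Rn n (resid n j v x))) ` {..<Suc j} \<subseteq> F"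
    using v(2) by (auto simp: less_Suc_eq image_subset_iff)
  with orthonormal_extend[OF v(1) xF(2) r] show ?case by blast
qed

lemma orthonormal_basis_exists:
  assumes "F \<in> Grassmannian n k" "k \<ge> 1"
  shows "\<exists>v. orthonormal n k v \<and> F = span (v ` {..<k})"
proof -
  have F: "subspace F" "F \<subseteq> Rn n" "dim F = k" using assms by (auto simp: Grassmannian_def)
  obtain B where B: "B \<subseteq> F" "independent B" "F \<subseteq> span B" "card B = dim F"
    using basis_exists[of F] by metis
  \<comment> \<open>An infinite basis would have \<open>card\<close> equal to 0, so finiteness comes
    from \<open>1 \<le> k\<close>.\<close>
  have fin: "finite B" using B(4) F(3) assms(2) by (intro card_ge_0_finite) simp
  obtain v where v: "orthonormal n k v" "v ` {..<k} \<subseteq> F"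
    using orthonormal_basis_upto[OF F(1,2) B(2,1) _ fin, of k k] B(4) F(3) by auto
  \<comment> \<open>A vector of \<open>F\<close> outside the span would yield k + 1 orthonormal
    vectors in the span of the k-element set \<open>B\<close>.\<close>
  have "F \<subseteq> span (v ` {..<k})"
  proof
    fix x assume x: "x \<in> F"
    show "x \<in> span (v ` {..<k})"
    proof (rule ccontr)
      assume "x \<notin> span (v ` {..<k})"
      then have r: "resid n k v x \<noteq> 0" using resid_eq_0_span by blast
      have "span (v ` {..<k}) \<subseteq> F" using v F(1) by (intro span_minimal)
      then have "resid n k v x \<in> F"
        unfolding resid_def using x comb_in_span by (intro subspace_diff[OF F(1)]) auto
      then have "normalize_Rn n (resid n k v x) \<in> F"
        unfolding normalize_Rn_def by (rule subspace_scale[OF F(1)])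
      then have "(v(k := normalize_Rn n (resid n k v x))) ` {..<Suc k} \<subseteq> span B"
        using v(2) B(3) by (auto simp: less_Suc_eq image_subset_iff)
      moreover have "orthonormal n (Suc k) (v(k := normalize_Rn n (resid n k v x)))"
        using x F(2) by (intro orthonormal_extend v(1) r) auto
      ultimately have "Suc k \<le> card B" using fin by (intro orthonormal_in_span_bound)
      then show False using B(4) F(3) by simp
    qed
  qed
  moreover have "span (v ` {..<k}) \<subseteq> F" using v F(1) by (intro span_minimal)
  ultimately show ?thesis using v(1) by blast
qed

lemma span_orthonormal_Grassmannian: "orthonormal n k v \<Longrightarrow> span (v ` {..<k}) \<in> Grassmannian n k"
  by (simp add: Grassmannian_def dim_orthonormal span_orthonormal_subset_Rn)

definition unit_vec :: "nat \<Rightarrow> nat \<Rightarrow> real" where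
  "unit_vec i = (\<lambda>j. if j = i then 1 else 0)"

lemma inner_unit_vec: "i < n \<Longrightarrow> inner_Rn n x (unit_vec i) = x i" "i < n \<Longrightarrow> inner_Rn n (unit_vec i) x = x i"
  by (simp_all add: inner_Rn_def unit_vec_def if_distrib if_distribR cong: if_cong)

lemma orthonormal_unit_vec: "k \<le> n \<Longrightarrow> orthonormal n k unit_vec"
  by (auto simp: orthonormal_def inner_unit_vec mem_Rn) (auto simp: unit_vec_def)

lemma comb_unit_vec: "x \<in> Rn n \<Longrightarrow> comb n unit_vec x = x"
  by (auto simp: comb_def unit_vec_def fun_eq_iff mem_Rn not_less if_distrib cong: if_cong)

lemma Rn_subset_span: "Rn n \<subseteq> span (unit_vec ` {..<n})"
  using comb_in_span comb_unit_vec by (metis subsetI)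

lemma orthonormal_le: "orthonormal n k v \<Longrightarrow> k \<le> n"
proof -
  assume v: "orthonormal n k v"
  have "k \<le> card (unit_vec ` {..<n})"
    using v Rn_subset_span by (intro orthonormal_in_span_bound[OF v]) (auto dest: orthonormalD)
  then show ?thesis using card_image_le[of "{..<n}" unit_vec] by simp
qed

text \<open>Some coordinate vector leaves the span, since otherwise n independent vectors would lie
  in the span of k < n vectors; its normalised remainder is the vector sought.\<close>

lemma orthonormal_complement:
  assumes "orthonormal n k v" "k < n"
  shows "\<exists>z. z \<in> Rn n \<and> norm_Rn n z = 1 \<and> (\<forall>i<k. inner_Rn n z (v i) = 0)"
proof -
  have "\<exists>i<n. resid n k v (unit_vec i) \<noteq> 0"
  proof (rule ccontr)
    assume "\<not> ?thesis"
    then have "unit_vec ` {..<n} \<subseteq> span (v ` {..<k})" using resid_eq_0_span by blast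
    then have "n \<le> card (v ` {..<k})"
      by (intro orthonormal_in_span_bound[OF orthonormal_unit_vec]) auto
    then show False using assms(2) card_image_le[of "{..<k}" v] by simp
  qed
  then obtain i where i: "i < n" "resid n k v (unit_vec i) \<noteq> 0" by auto
  have "orthonormal n (Suc k) (v(k := normalize_Rn n (resid n k v (unit_vec i))))"
    using orthonormal_unit_vec[of n n] i by (intro orthonormal_extend assms) (auto dest: orthonormalD)
  note D = orthonormalD[OF this lessI]
  have "inner_Rn n (normalize_Rn n (resid n k v (unit_vec i))) (v j) = 0" if "j < k" for j
    using D(3)[of j] that by simp
  with D(1,2) show ?thesis by auto
qed

text \<open>A nonzero remainder would extend \<open>v\<close> to n + 1 orthonormal vectors in
  \<open>Rn n\<close>.\<close>

lemma orthonormal_complete: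
  assumes "orthonormal n n v" "x \<in> Rn n"
  shows "x = comb n v (\<lambda>i. inner_Rn n x (v i))"
proof -
  have "resid n n v x = 0"
    using orthonormal_extend[OF assms] orthonormal_le[of n "Suc n"] by fastforce
  then show ?thesis by (simp add: resid_def)
qed

subsection \<open>Orthogonal maps\<close>

lemma orthogonal_mapsD:
  assumes "T \<in> orthogonal_maps n"
  shows "linear T" "x \<in> Rn n \<Longrightarrow> T x \<in> Rn n"
    "x \<in> Rn n \<Longrightarrow> y \<in> Rn n \<Longrightarrow> inner_Rn n (T x) (T y) = inner_Rn n x y"
    "x \<in> Rn n \<Longrightarrow> norm_Rn n (T x) = norm_Rn n x"
    "x \<in> Rn n \<Longrightarrow> y \<in> Rn n \<Longrightarrow> norm_Rn n (T x - T y) = norm_Rn n (x - y)"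
proof -
  show lin: "linear T" and "x \<in> Rn n \<Longrightarrow> T x \<in> Rn n"
    and inn: "x \<in> Rn n \<Longrightarrow> y \<in> Rn n \<Longrightarrow> inner_Rn n (T x) (T y) = inner_Rn n x y" for x y
    using assms by (auto simp: orthogonal_maps_def)
  show nrm: "x \<in> Rn n \<Longrightarrow> norm_Rn n (T x) = norm_Rn n x" for x
    by (simp add: norm_Rn_eq_sqrt_inner inn)
  show "x \<in> Rn n \<Longrightarrow> y \<in> Rn n \<Longrightarrow> norm_Rn n (T x - T y) = norm_Rn n (x - y)"
    using nrm[of "x - y"] lin by (simp add: linear_diff Rn_diff)
qed

lemma orthogonal_maps_orthonormal:
  "T \<in> orthogonal_maps n \<Longrightarrow> orthonormal n k v \<Longrightarrow> orthonormal n k (\<lambda>i. T (v i))"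
  by (auto simp: orthonormal_def orthogonal_mapsD)

lemma orthogonal_maps_comp:
  "S \<in> orthogonal_maps n \<Longrightarrow> T \<in> orthogonal_maps n \<Longrightarrow> S \<circ> T \<in> orthogonal_maps n"
  by (auto simp: orthogonal_maps_def image_subset_iff linear_compose)

lemma orthogonal_maps_id: "id \<in> orthogonal_maps n"
  by (simp add: orthogonal_maps_def linear_id)

text \<open>For a unit vector \<open>w\<close>, the reflection in the hyperplane orthogonal to
  \<open>w\<close>. Products of such reflections suffice for transitivity.\<close>

definition householder :: "nat \<Rightarrow> (nat \<Rightarrow> real) \<Rightarrow> (nat \<Rightarrow> real) \<Rightarrow> nat \<Rightarrow> real" where
  "householder n w x = x - (2 * inner_Rn n x w) *\<^sub>R w"

lemma householder_orthogonal:
  assumes "w \<in> Rn n" "norm_Rn n w = 1"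
  shows "householder n w \<in> orthogonal_maps n"
proof -
  have "linear (householder n w)"
    by (rule linearI) (auto simp: householder_def inner_Rn_simps fun_eq_iff algebra_simps)
  moreover have "householder n w ` Rn n \<subseteq> Rn n"
    using assms by (auto simp: householder_def intro!: Rn_diff Rn_scaleR)
  moreover have "inner_Rn n (householder n w x) (householder n w y) = inner_Rn n x y" for x y
  proof -
    have "inner_Rn n w w = 1" using assms(2) by (simp add: inner_Rn_self)
    moreover have "inner_Rn n w y = inner_Rn n y w" by (rule inner_Rn_commute)
    ultimately show ?thesis
      unfolding householder_def inner_Rn_simps by (simp add: algebra_simps)
  qed
  ultimately show ?thesis by (simp add: orthogonal_maps_def)
qed

text \<open>Equal lengths give that the inner product of u with u - v is |u - v|^2 / 2, so the
  reflection subtracts exactly u - v from u.\<close>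

lemma householder_swap:
  assumes "u \<in> Rn n" "v \<in> Rn n" "norm_Rn n u = 1" "norm_Rn n v = 1" "u \<noteq> v"
  shows "householder n (normalize_Rn n (u - v)) u = v"
proof -
  define d where "d = norm_Rn n (u - v)"
  have d: "d \<noteq> 0" using assms by (simp add: d_def norm_Rn_eq_0 Rn_diff)
  have "inner_Rn n u u = 1" "inner_Rn n v v = 1" using assms by (simp_all add: inner_Rn_self)
  then have "d\<^sup>2 = 2 * inner_Rn n u (u - v)"
    unfolding d_def inner_Rn_self[symmetric] inner_Rn_diff_left inner_Rn_diff_right
    by (simp add: inner_Rn_commute[of n v u])
  then have "inner_Rn n u (u - v) = d\<^sup>2 / 2" by simp
  then have "2 * ((1 / d) * inner_Rn n u (u - v)) * (1 / d) = 1"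
    using d by (simp add: power2_eq_square)
  then have "(2 * inner_Rn n u (normalize_Rn n (u - v)) * (1 / d)) *\<^sub>R (u - v) = u - v"
    unfolding normalize_Rn_def inner_Rn_scaleR_right d_def[symmetric] by (simp only: scaleR_one)
  then have "householder n (normalize_Rn n (u - v)) u = u - (u - v)"
    unfolding householder_def by (simp only: d_def normalize_Rn_def scaleR_scaleR)
  then show ?thesis by simp
qed

text \<open>Families are matched one vector at a time: reflecting \<open>T (u k)\<close> onto \<open>v k\<close> fixes \<open>v 0, \<dots>, v (k - 1)\<close>.\<close>

lemma orthogonal_maps_transitive:
  assumes "orthonormal n k u" "orthonormal n k v"
  shows "\<exists>T\<in>orthogonal_maps n. \<forall>i<k. T (u i) = v i"
  using assms
proof (induction k)
  case 0
  show ?case using orthogonal_maps_id by auto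
next
  case (Suc k)
  have "orthonormal n k u" "orthonormal n k v"
    using Suc.prems by (auto elim: orthonormal_less)
  then obtain T where T: "T \<in> orthogonal_maps n" "\<forall>i<k. T (u i) = v i"
    using Suc.IH by blast
  show ?case
  proof (cases "T (u k) = v k")
    case True
    then show ?thesis using T by (auto simp: less_Suc_eq)
  next
    case False
    note u = orthonormalD[OF Suc.prems(1)] and v = orthonormalD[OF Suc.prems(2)]
    let ?w = "normalize_Rn n (T (u k) - v k)"
    have Tu: "T (u k) \<in> Rn n" "norm_Rn n (T (u k)) = 1"
      using orthogonal_mapsD[OF T(1)] u[of k] by auto
    have w: "?w \<in> Rn n" using Tu v[of k] by (simp add: normalize_Rn_def Rn_scaleR Rn_diff)
    have nw: "norm_Rn n ?w = 1"
      using Tu v[of k] False by (intro norm_normalize_Rn) (simp add: norm_Rn_eq_0 Rn_diff)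
    let ?H = "householder n ?w"
    have "?H (T (u k)) = v k" using Tu v[of k] False by (intro householder_swap) auto
    moreover have "?H (T (u i)) = v i" if "i < k" for i
    proof -
      have "inner_Rn n (v i) (T (u k)) = inner_Rn n (u i) (u k)"
        using T that orthogonal_mapsD(3)[OF T(1) u(1) u(1), of i k] by auto
      also have "\<dots> = 0" using u(3)[of i k] that by simp
      finally have "inner_Rn n (v i) ?w = 0"
        using v(3)[of i k] that by (simp add: normalize_Rn_def inner_Rn_simps)
      then show ?thesis using T that by (simp add: householder_def)
    qed
    ultimately show ?thesis
      using orthogonal_maps_comp[OF householder_orthogonal[OF w nw] T(1)]
      by (intro bexI[of _ "?H \<circ> T"]) (auto simp: less_Suc_eq)
  qed
qed

lemma orthogonal_maps_transitive_sphere: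
  assumes "u \<in> unit_sphere n" "v \<in> unit_sphere n"
  shows "\<exists>T\<in>orthogonal_maps n. T u = v"
  using orthogonal_maps_transitive[of n 1 "\<lambda>_. u" "\<lambda>_. v"] assms
  by (auto simp: orthonormal_def unit_sphere_def inner_Rn_self)

section \<open>Uniqueness of invariant measures\<close>

lemma space_borel_of [simp]: "space (borel_of X) = topspace X"
  by (auto simp: borel_of_def dest!: openin_subset intro!: space_measure_of)

lemma sets_borel_of: "sets (borel_of X) = sigma_sets (topspace X) {U. openin X U}"
  unfolding borel_of_def by (rule sets_measure_of) (auto dest: openin_subset)

lemma openin_sets_borel_of: "openin X U \<Longrightarrow> U \<in> sets (borel_of X)"
  by (simp add: sets_borel_of sigma_sets.Basic)

lemma measurable_borel_ofI:
  assumes "\<And>x. x \<in> space M \<Longrightarrow> f x \<in> topspace X"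
    and "\<And>U. openin X U \<Longrightarrow> f -` U \<inter> space M \<in> sets M"
  shows "f \<in> measurable M (borel_of X)"
  unfolding borel_of_def
  by (rule measurable_measure_of) (use assms in \<open>auto dest: openin_subset\<close>)

lemma measure_eq_borel_ofI:
  assumes "prob_space \<mu>" "sets \<mu> = sets (borel_of X)" "sets \<nu> = sets (borel_of X)"
    and "\<And>U. openin X U \<Longrightarrow> emeasure \<mu> U = emeasure \<nu> U"
  shows "\<mu> = \<nu>"
proof (rule measure_eqI_generator_eq[where E="{U. openin X U}" and \<Omega>="topspace X" and A="\<lambda>_. topspace X"])
  show "Int_stable {U. openin X U}" by (auto simp: Int_stable_def)
  show "emeasure \<mu> (topspace X) \<noteq> \<infinity>" for i :: nat
    using prob_space.axioms(1)[OF assms(1)] by (simp add: finite_measure.emeasure_finite)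
qed (use assms in \<open>auto simp: sets_borel_of dest!: openin_subset\<close>)

context Metric_space
begin

definition countably_dense :: "'a set \<Rightarrow> bool" where
  "countably_dense S \<longleftrightarrow> countable S \<and> S \<subseteq> M \<and> (\<forall>x\<in>M. \<forall>e>0. \<exists>q\<in>S. d x q < e)"

text \<open>Fubini's theorem needs this set in the product of the two Borel sigma-algebras, to which
  open sets of the product space need not belong in general. Separability writes it as a union of
  products of balls, indexed by a countable dense set and the rationals.\<close>

lemma sets_dist_less:
  assumes "countably_dense S"
  shows "{p \<in> M \<times> M. d (fst p) (snd p) < r} \<in> sets (borel_of mtopology \<Otimes>\<^sub>M borel_of mtopology)"
proof -
  have "{p \<in> M \<times> M. d (fst p) (snd p) < r} = (\<Union>(q, s)\<in>S \<times> \<rat>. mball q s \<times> mball q (r - s))" (is "?L = ?R")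
  proof (intro set_eqI iffI)
    fix p assume "p \<in> ?L"
    then obtain x y where p: "p = (x, y)" "x \<in> M" "y \<in> M" "d x y < r" by auto
    define e where "e = r - d x y"
    have e: "0 < e" using p by (simp add: e_def)
    then obtain q where q: "q \<in> S" "d x q < e/2" "q \<in> M"
      using assms p unfolding countably_dense_def by (meson half_gt_zero subsetD)
    obtain s where s: "s \<in> \<rat>" "d x q < s" "s < e/2"
      using Rats_dense_in_real[OF q(2)] by auto
    have "d q y \<le> d q x + d x y" using triangle q p by blast
    then have "d q y < r - s" using s q(2) commute[of q x] by (simp add: e_def)
    then show "p \<in> ?R" using p q s commute[of q x] by (intro UN_I[of "(q, s)"]) auto
  next
    fix p assume "p \<in> ?R"
    then obtain q s where qs: "fst p \<in> mball q s" "snd p \<in> mball q (r - s)" by auto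
    have "d (fst p) (snd p) \<le> d (fst p) q + d q (snd p)" using triangle qs by auto
    then show "p \<in> ?L" using qs commute[of "fst p" q] by (auto simp: mem_Times_iff)
  qed
  also have "\<dots> \<in> sets (borel_of mtopology \<Otimes>\<^sub>M borel_of mtopology)"
    using assms unfolding countably_dense_def
    by (intro sets.countable_UN'') (auto intro!: pair_measureI openin_sets_borel_of countable_rat)
  finally show ?thesis .
qed

text \<open>Countably many balls of radius \<open>r\<close> cover the space; if all of them were
  null, the whole space would be null.\<close>

lemma uniform_ball_pos:
  assumes "countably_dense S" "prob_space \<mu>" "sets \<mu> = sets (borel_of mtopology)"
    and "\<And>x. x \<in> M \<Longrightarrow> measure \<mu> (mball x r) = m" and "0 < r"
  shows "0 < m"
proof (rule ccontr)
  interpret prob_space \<mu> by fact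
  assume "\<not> 0 < m"
  moreover have sp: "space \<mu> = M" using sets_eq_imp_space_eq[OF assms(3)] by simp
  moreover obtain x0 where "x0 \<in> M" using not_empty sp by auto
  ultimately have m: "m = 0" using assms(4) by (metis measure_nonneg less_le)
  have "M = (\<Union>q\<in>S. mball q r)"
    using assms(1,5) commute unfolding countably_dense_def by (auto simp: subset_iff)
  moreover have "(\<Union>q\<in>S. mball q r) \<in> null_sets \<mu>"
    using assms(1) m assms(4) unfolding countably_dense_def
    by (intro null_sets_UN') (auto simp: null_sets_def emeasure_eq_measure assms(3) openin_sets_borel_of subset_iff)
  ultimately have "emeasure \<mu> (space \<mu>) = 0" using sp by auto
  then show False using emeasure_space_1 by simp
qed

text \<open>On an open set \<open>U\<close> the quotients \<open>\<nu> (U \<inter> mball x r) / \<nu> (mball x r)\<close> tend to 1 as \<open>r\<close> tends to 0, and by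
  Fubini their integral with respect to \<open>\<mu>\<close> is \<open>\<nu> U\<close> times the ratio of the ball measures.\<close>

lemma uniform_measures_le:
  assumes S: "countably_dense S"
    and mu: "prob_space \<mu>" "sets \<mu> = sets (borel_of mtopology)"
    and nu: "prob_space \<nu>" "sets \<nu> = sets (borel_of mtopology)"
    and m: "\<And>x k. x \<in> M \<Longrightarrow> measure \<mu> (mball x (1 / real (Suc k))) = m k"
    and n: "\<And>x k. x \<in> M \<Longrightarrow> measure \<nu> (mball x (1 / real (Suc k))) = n k"
    and freq: "\<exists>\<^sub>F k in sequentially. m k \<le> c * n k" and c: "0 \<le> c"
    and U: "openin mtopology U"
  shows "measure \<mu> U \<le> c * measure \<nu> U"
proof -
  interpret mu: prob_space \<mu> by fact
  interpret nu: prob_space \<nu> by fact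
  interpret pair: pair_sigma_finite \<mu> \<nu> ..
  note [measurable_cong] = mu(2) nu(2)
  have sp: "space \<mu> = M" "space \<nu> = M"
    using sets_eq_imp_space_eq[OF mu(2)] sets_eq_imp_space_eq[OF nu(2)] by auto
  have Us: "U \<subseteq> M" "U \<in> sets \<nu>" "U \<in> sets \<mu>"
    using U openin_subset[OF U] by (auto simp: mu nu openin_sets_borel_of)
  have n0: "0 < n k" for k by (rule uniform_ball_pos[OF S nu n]) auto
  define D where "D k = {p \<in> M \<times> M. d (fst p) (snd p) < 1 / real (Suc k)}" for k
  have D: "D k \<in> sets (borel_of mtopology \<Otimes>\<^sub>M borel_of mtopology)" for k
    unfolding D_def by (rule sets_dist_less[OF S])
  have [measurable]: "U \<in> sets (borel_of mtopology)" using U by (rule openin_sets_borel_of)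
  note [measurable] = D
  define f where "f k x = ennreal (1 / n k) * (\<integral>\<^sup>+y. indicator (D k) (x, y) * indicator U y \<partial>\<nu>)" for k x
  have [measurable]: "f k \<in> borel_measurable \<mu>" for k
    unfolding f_def by measurable
  have lim: "indicator U x \<le> liminf (\<lambda>k. f k x)" if "x \<in> M" for x
  proof (cases "x \<in> U")
    case True
    then obtain r where r: "0 < r" "mball x r \<subseteq> U" using U unfolding openin_mtopology by auto
    \<comment> \<open>For small radii the ball lies inside \<open>U\<close>, so the quotient is not
      merely close to 1 but equal to it.\<close>
    have "\<forall>\<^sub>F k in sequentially. 1 / real (Suc k) < r"
      using order_tendstoD(2)[OF LIMSEQ_inverse_real_of_nat r(1)] by (simp add: inverse_eq_divide)
    then have "\<forall>\<^sub>F k in sequentially. 1 \<le> f k x"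
    proof eventually_elim
      case (elim k)
      then have "mball x (1 / real (Suc k)) \<subseteq> U"
        using r mball_subset_concentric[of "1 / real (Suc k)" r x] by auto
      then have "(\<integral>\<^sup>+y. indicator (D k) (x, y) * indicator U y \<partial>\<nu>) = (\<integral>\<^sup>+y. indicator (mball x (1 / real (Suc k))) y \<partial>\<nu>)"
        using that by (intro nn_integral_cong) (auto simp: indicator_def D_def sp)
      also have "\<dots> = ennreal (n k)"
        using n[OF that, of k] by (simp add: nu.emeasure_eq_measure nu(2) openin_sets_borel_of)
      finally show "1 \<le> f k x"
        unfolding f_def using n0[of k] by (simp add: ennreal_mult[symmetric])
    qed
    then show ?thesis using True by (simp add: Liminf_bounded)
  qed simp
  have int: "(\<integral>\<^sup>+x. f k x \<partial>\<mu>) = ennreal (m k / n k * measure \<nu> U)" for k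
  proof -
    have "(\<integral>\<^sup>+x. f k x \<partial>\<mu>) = ennreal (1 / n k) * (\<integral>\<^sup>+x. \<integral>\<^sup>+y. indicator (D k) (x, y) * indicator U y \<partial>\<nu> \<partial>\<mu>)"
      unfolding f_def by (rule nn_integral_cmult) measurable
    also have "(\<integral>\<^sup>+x. \<integral>\<^sup>+y. indicator (D k) (x, y) * indicator U y \<partial>\<nu> \<partial>\<mu>) = (\<integral>\<^sup>+y. \<integral>\<^sup>+x. indicator (D k) (x, y) * indicator U y \<partial>\<mu> \<partial>\<nu>)"
      by (rule pair.Fubini'[symmetric]) measurable
    also have "\<dots> = (\<integral>\<^sup>+y. ennreal (m k) * indicator U y \<partial>\<nu>)"
    proof (rule nn_integral_cong)
      fix y assume y: "y \<in> space \<nu>"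
      have "(\<integral>\<^sup>+x. indicator (D k) (x, y) * indicator U y \<partial>\<mu>) = (\<integral>\<^sup>+x. indicator (mball y (1 / real (Suc k))) x * indicator U y \<partial>\<mu>)"
        using y by (intro nn_integral_cong) (auto simp: indicator_def D_def sp commute)
      also have "\<dots> = ennreal (m k) * indicator U y"
        using m[of y k] y by (subst nn_integral_multc) (auto simp: mu.emeasure_eq_measure mu(2) openin_sets_borel_of sp intro!: borel_measurable_indicator)
      finally show "(\<integral>\<^sup>+x. indicator (D k) (x, y) * indicator U y \<partial>\<mu>) = ennreal (m k) * indicator U y" .
    qed
    also have "\<dots> = ennreal (m k) * ennreal (measure \<nu> U)"
      using Us by (simp add: nn_integral_cmult nu.emeasure_eq_measure)
    also have "ennreal (1 / n k) * \<dots> = ennreal (m k / n k * measure \<nu> U)"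
    proof -
      obtain x where "x \<in> M" using mu.not_empty sp by auto
      then have "0 \<le> m k" using m[of x k] measure_nonneg by metis
      then show ?thesis using n0[of k] by (simp add: ennreal_mult[symmetric])
    qed
    finally show ?thesis .
  qed
  have "ennreal (measure \<mu> U) = (\<integral>\<^sup>+x. indicator U x \<partial>\<mu>)"
    using Us by (simp add: mu.emeasure_eq_measure)
  also have "\<dots> \<le> (\<integral>\<^sup>+x. liminf (\<lambda>k. f k x) \<partial>\<mu>)"
    using lim by (intro nn_integral_mono) (auto simp: sp)
  also have "\<dots> \<le> liminf (\<lambda>k. \<integral>\<^sup>+x. f k x \<partial>\<mu>)"
    by (rule nn_integral_liminf) measurable
  \<comment> \<open>The bound \<open>m k \<le> c * n k\<close> is known only for infinitely many k.
    This suffices: a larger lower limit would push all late terms above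
    \<open>c * measure \<nu> U\<close>, against one such late k.\<close>
  also have "\<dots> \<le> ennreal (c * measure \<nu> U)"
  proof (rule ccontr)
    assume "\<not> ?thesis"
    then have "\<forall>\<^sub>F k in sequentially. ennreal (c * measure \<nu> U) < ennreal (m k / n k * measure \<nu> U)"
      using less_LiminfD[of "ennreal (c * measure \<nu> U)"] by (simp add: int not_le)
    from frequently_eventually_conj[OF freq this] obtain k where
      k: "ennreal (c * measure \<nu> U) < ennreal (m k / n k * measure \<nu> U)" "m k \<le> c * n k"
      by (auto dest: frequently_ex simp: conj_commute)
    have "m k / n k \<le> c" using k(2) n0[of k] by (simp add: field_simps)
    then have "m k / n k * measure \<nu> U \<le> c * measure \<nu> U" by (intro mult_right_mono) auto
    then show False using k(1) by (meson ennreal_leI leD)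
  qed
  finally show ?thesis using c by (simp add: ennreal_le_iff)
qed

text \<open>The comparison of ball masses holds infinitely often in one direction, say m \<le> n,
  which gives \<rho> \<le> \<sigma> on open sets. For the converse let 0 < z < 1: if m \<le> z n
  held infinitely often, the whole space would give 1 \<le> z. Hence n \<le> m / z infinitely often,
  so z \<sigma> \<le> \<rho>, and z tends to 1.\<close>

lemma uniform_measures_eq:
  assumes S: "countably_dense S"
    and mu: "prob_space \<mu>" "sets \<mu> = sets (borel_of mtopology)"
    and nu: "prob_space \<nu>" "sets \<nu> = sets (borel_of mtopology)"
    and um: "\<And>x y r. x \<in> M \<Longrightarrow> y \<in> M \<Longrightarrow> measure \<mu> (mball x r) = measure \<mu> (mball y r)"
    and un: "\<And>x y r. x \<in> M \<Longrightarrow> y \<in> M \<Longrightarrow> measure \<nu> (mball x r) = measure \<nu> (mball y r)"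
  shows "\<mu> = \<nu>"
proof -
  have sp: "space \<mu> = M" "space \<nu> = M"
    using sets_eq_imp_space_eq[OF mu(2)] sets_eq_imp_space_eq[OF nu(2)] by auto
  obtain x0 where x0: "x0 \<in> M" using prob_space.not_empty[OF mu(1)] sp by auto
  have key: "measure \<rho> U = measure \<sigma> U"
    if r: "prob_space \<rho>" "sets \<rho> = sets (borel_of mtopology)" and s: "prob_space \<sigma>" "sets \<sigma> = sets (borel_of mtopology)"
      and rb: "\<And>x k. x \<in> M \<Longrightarrow> measure \<rho> (mball x (1 / real (Suc k))) = m k"
      and sb: "\<And>x k. x \<in> M \<Longrightarrow> measure \<sigma> (mball x (1 / real (Suc k))) = n k"
      and freq: "\<exists>\<^sub>F k in sequentially. m k \<le> n k" and U: "openin mtopology U" for \<rho> \<sigma> m n U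
  proof (rule antisym)
    show "measure \<rho> U \<le> measure \<sigma> U"
      using uniform_measures_le[OF S r s rb sb, where c=1] freq U by simp
    show "measure \<sigma> U \<le> measure \<rho> U"
    proof (rule field_le_mult_one_interval)
      fix z :: real assume z: "0 < z" "z < 1"
      have "\<exists>\<^sub>F k in sequentially. n k \<le> (1 / z) * m k"
      proof (rule ccontr)
        assume "\<not> ?thesis"
        then have "\<forall>\<^sub>F k in sequentially. m k \<le> z * n k"
          using z by (auto simp: not_frequently field_simps not_le elim: eventually_mono)
        then have "\<exists>\<^sub>F k in sequentially. m k \<le> z * n k" by (intro eventually_frequently) auto
        from uniform_measures_le[OF S r s rb sb this _ openin_topspace]
        have "measure \<rho> M \<le> z * measure \<sigma> M" using z by simp
        moreover have "space \<rho> = M" "space \<sigma> = M"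
          using sets_eq_imp_space_eq[OF r(2)] sets_eq_imp_space_eq[OF s(2)] by auto
        ultimately show False using prob_space.prob_space[OF r(1)] prob_space.prob_space[OF s(1)] z by simp
      qed
      from uniform_measures_le[OF S s r sb rb this _ U]
      show "z * measure \<sigma> U \<le> measure \<rho> U" using z by (simp add: field_simps)
    qed
  qed
  let ?m = "\<lambda>k. measure \<mu> (mball x0 (1 / real (Suc k)))" and ?n = "\<lambda>k. measure \<nu> (mball x0 (1 / real (Suc k)))"
  have bm: "x \<in> M \<Longrightarrow> measure \<mu> (mball x (1 / real (Suc k))) = ?m k"
    and bn: "x \<in> M \<Longrightarrow> measure \<nu> (mball x (1 / real (Suc k))) = ?n k" for x k
    using um[OF _ x0] un[OF _ x0] by auto
  have "(\<exists>\<^sub>F k in sequentially. ?m k \<le> ?n k) \<or> (\<exists>\<^sub>F k in sequentially. ?n k \<le> ?m k)"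
    by (simp add: linorder_linear flip: frequently_disj_iff)
  then have "measure \<mu> U = measure \<nu> U" if "openin mtopology U" for U
    using key[OF mu nu bm bn _ that] key[OF nu mu bn bm _ that] by auto
  then show ?thesis
    using mu nu by (intro measure_eq_borel_ofI[OF mu nu(2)])
      (simp add: finite_measure.emeasure_eq_measure prob_space.finite_measure)
qed

lemma measurable_isometry:
  assumes G: "\<And>x. x \<in> M \<Longrightarrow> g x \<in> M" "\<And>x y. x \<in> M \<Longrightarrow> y \<in> M \<Longrightarrow> d (g x) (g y) = d x y"
  shows "g \<in> measurable (borel_of mtopology) (borel_of mtopology)"
proof (rule measurable_borel_ofI)
  fix U assume U: "openin mtopology U"
  have "openin mtopology (g -` U \<inter> M)"
    unfolding openin_mtopology
  proof safe
    fix z assume z: "g z \<in> U" "z \<in> M"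
    then obtain e where e: "0 < e" "mball (g z) e \<subseteq> U" using U unfolding openin_mtopology by blast
    have "mball z e \<subseteq> g -` U \<inter> M"
    proof
      fix w assume "w \<in> mball z e"
      then have "g w \<in> mball (g z) e" "w \<in> M" using G by auto
      then show "w \<in> g -` U \<inter> M" using e by auto
    qed
    then show "\<exists>r>0. mball z r \<subseteq> g -` U \<inter> M" using e(1) by auto
  qed
  then show "g -` U \<inter> space (borel_of mtopology) \<in> sets (borel_of mtopology)" by (simp add: openin_sets_borel_of)
qed (use G in auto)

text \<open>Resolves the definite description: transitivity by isometries makes every invariant
  measure give equal mass to balls of equal radius, so uniqueness applies, and the candidate
  \<open>\<mu>\<close> supplies existence.\<close>

lemma haar_prob_eqI:
  assumes S: "countably_dense S"
    and G: "\<And>g x. g \<in> G \<Longrightarrow> x \<in> M \<Longrightarrow> g x \<in> M"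
      "\<And>g x y. g \<in> G \<Longrightarrow> x \<in> M \<Longrightarrow> y \<in> M \<Longrightarrow> d (g x) (g y) = d x y"
    and trans: "\<And>x y. x \<in> M \<Longrightarrow> y \<in> M \<Longrightarrow> \<exists>g\<in>G. g x = y"
    and mu: "prob_space \<mu>" "sets \<mu> = sets (borel_of mtopology)" "\<And>g. g \<in> G \<Longrightarrow> distr \<mu> \<mu> g = \<mu>"
  shows "haar_prob mtopology G = \<mu>"
proof -
  have ball: "measure \<rho> (mball x r) = measure \<rho> (mball y r)"
    if r: "sets \<rho> = sets (borel_of mtopology)" "\<And>g. g \<in> G \<Longrightarrow> distr \<rho> \<rho> g = \<rho>"
      and xy: "x \<in> M" "y \<in> M" for \<rho> x y r
  proof -
    have sp: "space \<rho> = M" using sets_eq_imp_space_eq[OF r(1)] by simp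
    obtain g where g: "g \<in> G" "g x = y" using trans xy by blast
    have "g \<in> measurable (borel_of mtopology) (borel_of mtopology)"
      using G g(1) by (intro measurable_isometry) auto
    then have meas: "g \<in> measurable \<rho> \<rho>" by (simp add: r(1) cong: measurable_cong_sets)
    have "measure \<rho> (mball y r) = measure (distr \<rho> \<rho> g) (mball y r)" by (simp add: r(2)[OF g(1)])
    also have "\<dots> = measure \<rho> (g -` mball y r \<inter> space \<rho>)"
      using meas by (rule measure_distr) (simp add: r(1) openin_sets_borel_of)
    also have "g -` mball y r \<inter> space \<rho> = mball x r"
      using G[OF g(1)] xy g(2) by (auto simp: sp)
    finally show ?thesis ..
  qed
  show ?thesis unfolding haar_prob_def
  proof (rule the_equality)
    show "prob_space \<mu> \<and> sets \<mu> = sets (borel_of mtopology) \<and> (\<forall>g\<in>G. distr \<mu> \<mu> g = \<mu>)"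
      using mu by auto
    fix \<rho> assume "prob_space \<rho> \<and> sets \<rho> = sets (borel_of mtopology) \<and> (\<forall>g\<in>G. distr \<rho> \<rho> g = \<rho>)"
    then show "\<rho> = \<mu>"
      using ball[of \<rho>] ball[of \<mu>] mu by (intro uniform_measures_eq[OF S]) blast+
  qed
qed

end

subsection \<open>The norm topology\<close>

lemma Euclidean_space_top_of_set: "Euclidean_space n = top_of_set (Rn n)"
  unfolding Euclidean_space_def euclidean_product_topology topspace_subtopology by simp

lemma continuous_inner_Rn [continuous_intros]:
  "continuous_on S f \<Longrightarrow> continuous_on S g \<Longrightarrow> continuous_on S (\<lambda>x. inner_Rn n (f x) (g x))"
  unfolding inner_Rn_def
  by (intro continuous_on_sum continuous_on_mult) (erule continuous_on_product_then_coordinatewise)+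

lemma continuous_norm_Rn [continuous_intros]:
  "continuous_on S f \<Longrightarrow> continuous_on S (\<lambda>x. norm_Rn n (f x))"
  unfolding norm_Rn_eq_sqrt_inner by (intro continuous_on_real_sqrt continuous_inner_Rn)

lemma continuous_vecI:
  fixes f :: "'a::topological_space \<Rightarrow> nat \<Rightarrow> 'b::topological_space"
  shows "(\<And>i. continuous_on S (\<lambda>x. f x i)) \<Longrightarrow> continuous_on S f"
  by (rule continuous_on_coordinatewise_then_product)

lemma continuous_vec_diff [continuous_intros]:
  "continuous_on S f \<Longrightarrow> continuous_on S g \<Longrightarrow> continuous_on S (\<lambda>x. f x - g x :: nat \<Rightarrow> real)"
  by (rule continuous_vecI, unfold minus_apply, intro continuous_on_diff)
    (erule continuous_on_product_then_coordinatewise)+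

lemma open_norm_ball: "open {y. norm_Rn n (x - y) < r}"
  by (intro open_Collect_less continuous_norm_Rn continuous_vec_diff continuous_on_const continuous_on_id)

lemma Metric_space_Rn: "S \<subseteq> Rn n \<Longrightarrow> Metric_space S (\<lambda>x y. norm_Rn n (x - y))"
proof
  fix x y assume "S \<subseteq> Rn n" "x \<in> S" "y \<in> S"
  then have "x - y \<in> Rn n" by (intro Rn_diff) auto
  then show "norm_Rn n (x - y) = 0 \<longleftrightarrow> x = y" by (simp only: norm_Rn_eq_0 right_minus_eq)
qed (auto simp: norm_Rn_minus_commute norm_Rn_triangle_diff)

text \<open>The definitions use the product topology, the uniqueness argument a metric. They agree
  on subsets of \<open>Rn n\<close> because coordinates with index below \<open>n\<close> are
  controlled by the norm and the others are constantly 0.\<close>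

lemma mtopology_Rn:
  assumes S: "S \<subseteq> Rn n"
  shows "Metric_space.mtopology S (\<lambda>x y. norm_Rn n (x - y)) = top_of_set S"
proof (rule topology_eq[THEN iffD2], rule allI)
  interpret Metric_space S "\<lambda>x y. norm_Rn n (x - y)" by (rule Metric_space_Rn[OF S])
  fix U
  show "openin mtopology U = openin (top_of_set S) U"
  proof
    assume U: "openin mtopology U"
    show "openin (top_of_set S) U"
    proof (subst openin_subopen, safe)
      fix x assume "x \<in> U"
      then obtain r where r: "0 < r" "mball x r \<subseteq> U" "x \<in> S" using U unfolding openin_mtopology by blast
      have "openin (top_of_set S) (S \<inter> {y. norm_Rn n (x - y) < r})"
        by (rule openin_open_Int[OF open_norm_ball])
      moreover have "S \<inter> {y. norm_Rn n (x - y) < r} = mball x r" using r by auto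
      ultimately show "\<exists>T. openin (top_of_set S) T \<and> x \<in> T \<and> T \<subseteq> U" using r by force
    qed
  next
    have coord: "continuous_map mtopology euclideanreal (\<lambda>x. x i)" for i
      unfolding continuous_map_def openin_mtopology
    proof (intro conjI allI impI)
      fix V :: "real set" and x assume V: "openin euclidean V" and x: "x \<in> {x \<in> topspace mtopology. x i \<in> V}"
      then obtain e where e: "0 < e" "\<And>y. \<bar>y - x i\<bar> < e \<Longrightarrow> y \<in> V"
        unfolding open_openin[symmetric] open_dist dist_real_def by auto
      have "\<bar>y i - x i\<bar> \<le> norm_Rn n (x - y)" if "y \<in> S" for y
      proof (cases "i < n")
        case True
        then show ?thesis using abs_coord_le_norm_Rn[OF True, of "x - y"] by (simp add: abs_minus_commute)
      next
        case False
        then have "y i = 0" "x i = 0" using S that x by (auto simp: mem_Rn subset_iff)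
        then show ?thesis by simp
      qed
      then have "mball x e \<subseteq> {x \<in> topspace mtopology. x i \<in> V}"
        using e(2) by force
      then show "\<exists>r>0. mball x r \<subseteq> {x \<in> topspace mtopology. x i \<in> V}" using e(1) by blast
    qed auto
    have "continuous_map mtopology (euclidean :: (nat \<Rightarrow> real) topology) (\<lambda>x. x)"
      unfolding euclidean_product_topology[symmetric] continuous_map_componentwise_UNIV using coord by simp
    moreover assume "openin (top_of_set S) U"
    then obtain T where T: "open T" "U = S \<inter> T" unfolding openin_open by blast
    ultimately have "openin mtopology {x \<in> topspace mtopology. x \<in> T}"
      by (intro openin_continuous_map_preimage) auto
    then show "openin mtopology U" using T by (simp add: Collect_conj_eq)
  qed
qed

lemma countable_dense_subset:
  fixes S :: "'a::second_countable_topology set"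
  obtains T where "countable T" "T \<subseteq> S" "\<And>U. open U \<Longrightarrow> U \<inter> S \<noteq> {} \<Longrightarrow> U \<inter> T \<noteq> {}"
proof -
  obtain B :: "'a set set" where B: "countable B" "topological_basis B" using ex_countable_basis by auto
  define T where "T = (\<lambda>b. SOME x. x \<in> b \<inter> S) ` {b \<in> B. b \<inter> S \<noteq> {}}"
  have T: "(SOME x. x \<in> b \<inter> S) \<in> b \<inter> S" if "b \<inter> S \<noteq> {}" for b
    using that by (metis ex_in_conv someI_ex)
  show ?thesis
  proof
    show "countable T" unfolding T_def using B by auto
    show "T \<subseteq> S" unfolding T_def using T by blast
    fix U :: "'a set" assume U: "open U" "U \<inter> S \<noteq> {}"
    then obtain x where x: "x \<in> U" "x \<in> S" by blast
    then obtain b where b: "b \<in> B" "x \<in> b" "b \<subseteq> U" using topological_basisE[OF B(2) U(1)] by metis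
    then have ne: "b \<inter> S \<noteq> {}" using x by blast
    then have "(SOME x. x \<in> b \<inter> S) \<in> U \<inter> T" using T[OF ne] b unfolding T_def by blast
    then show "U \<inter> T \<noteq> {}" by blast
  qed
qed

lemma sets_borel_of_top_of_set:
  "S \<in> sets borel \<Longrightarrow> sets (borel_of (top_of_set S)) = sets (restrict_space borel S)"
proof -
  assume "S \<in> sets borel"
  then have S: "S \<in> sigma_sets UNIV {U. open U}" by (simp add: borel_def)
  have "{U. openin (top_of_set S) U} = (\<inter>) S ` {U. open U}" by (auto simp: openin_open)
  moreover have "sigma_sets S ((\<inter>) S ` {U. open U}) = (\<inter>) S ` sigma_sets UNIV {U. open U}"
    by (rule sigma_sets_Int[OF S, symmetric]) simp
  ultimately show ?thesis by (simp add: sets_borel_of sets_restrict_space borel_def)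
qed

lemma sets_unit_sphere [measurable]: "unit_sphere n \<in> sets borel"
proof -
  have "unit_sphere n = Rn n \<inter> {x \<in> space borel. norm_Rn n x = 1}" by (auto simp: unit_sphere_def)
  also have "\<dots> \<in> sets borel" by measurable
  finally show ?thesis .
qed

lemma unit_sphere_subset_Rn: "unit_sphere n \<subseteq> Rn n"
  by (auto simp: unit_sphere_def)

lemma measurable_comb_right [measurable]: "comb k v \<in> borel_measurable borel"
proof (rule measurable_vecI)
  fix i
  show "(\<lambda>x. comb k v x i) \<in> borel_measurable borel" unfolding comb_def by measurable
qed

text \<open>An element of \<open>orthogonal_maps\<close> carries no measurability on the space of
  all sequences; the combination of the images of the coordinate vectors is a measurable
  substitute.\<close>

lemma orthogonal_map_eq_comb:
  assumes "T \<in> orthogonal_maps n" "x \<in> Rn n"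
  shows "T x = comb n (\<lambda>i. T (unit_vec i)) x"
  using linear_comb[OF orthogonal_mapsD(1)[OF assms(1)], of n unit_vec x] by (simp add: comb_unit_vec[OF assms(2)])

text \<open>The candidate may be a Borel measure on all sequences, with invariance tested on the
  maps \<open>comb n w\<close> only; restricting it to the sphere loses no mass.\<close>

lemma sphere_measure_eqI:
  assumes nu: "prob_space \<nu>" "sets \<nu> = sets borel" "AE x in \<nu>. x \<in> unit_sphere n"
    and inv: "\<And>w. orthonormal n n w \<Longrightarrow> distr \<nu> borel (comb n w) = \<nu>"
  shows "sphere_measure n = restrict_space \<nu> (unit_sphere n)"
proof -
  let ?S = "unit_sphere n" and ?\<mu> = "restrict_space \<nu> (unit_sphere n)"
  interpret nu: prob_space \<nu> by fact
  interpret Metric_space ?S "\<lambda>x y. norm_Rn n (x - y)" by (rule Metric_space_Rn[OF unit_sphere_subset_Rn])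
  have top: "mtopology = subtopology (Euclidean_space n) ?S"
    unfolding mtopology_Rn[OF unit_sphere_subset_Rn]
    by (subst Euclidean_space_top_of_set) (simp only: subtopology_subtopology Int_absorb1[OF unit_sphere_subset_Rn])
  have sp: "space \<nu> = UNIV" using sets_eq_imp_space_eq[OF nu(2)] by simp
  obtain T where T: "countable T" "T \<subseteq> ?S" "\<And>U. open U \<Longrightarrow> U \<inter> ?S \<noteq> {} \<Longrightarrow> U \<inter> T \<noteq> {}"
    using countable_dense_subset[of ?S] by blast
  have dense: "countably_dense T"
    unfolding countably_dense_def
  proof (intro conjI ballI allI impI T)
    fix x and e :: real assume xe: "x \<in> ?S" "0 < e"
    have "x \<in> {y. norm_Rn n (x - y) < e} \<inter> ?S" using xe by simp
    then have "{y. norm_Rn n (x - y) < e} \<inter> T \<noteq> {}"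
      using T(3)[OF open_norm_ball] by blast
    then show "\<exists>q\<in>T. norm_Rn n (x - q) < e" by blast
  qed
  have sets_mu: "sets ?\<mu> = sets (borel_of mtopology)"
    unfolding mtopology_Rn[OF unit_sphere_subset_Rn] sets_borel_of_top_of_set[OF sets_unit_sphere]
    by (simp add: sets_restrict_space nu(2))
  have Sn: "?S \<in> sets \<nu>" by (simp add: nu(2))
  have "haar_prob mtopology (orthogonal_maps n) = ?\<mu>"
  proof (rule haar_prob_eqI[OF dense])
    show "prob_space ?\<mu>"
    proof (rule prob_space_restrict_space)
      show "emeasure \<nu> ?S = 1" using nu(3) Sn by (simp add: nu.emeasure_eq_1_AE)
    qed (rule Sn)
    fix T assume T: "T \<in> orthogonal_maps n"
    let ?w = "\<lambda>i. T (unit_vec i)"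
    have on: "orthonormal n n ?w" by (rule orthogonal_maps_orthonormal[OF T orthonormal_unit_vec]) simp
    have TS: "T x \<in> ?S" if "x \<in> ?S" for x
      using that orthogonal_mapsD[OF T] by (auto simp: unit_sphere_def)
    have Teq: "T x = comb n ?w x" if "x \<in> ?S" for x
      using orthogonal_map_eq_comb[OF T] that unit_sphere_subset_Rn by blast
    have sps: "space ?\<mu> = ?S" by (simp add: space_restrict_space sp)
    have mT: "T \<in> measurable ?\<mu> ?\<mu>"
    proof -
      have "comb n ?w \<in> measurable ?\<mu> ?\<mu>"
      proof (rule measurable_restrict_space3)
        show "comb n ?w \<in> measurable \<nu> \<nu>" by (simp add: nu(2) cong: measurable_cong_sets)
        show "comb n ?w \<in> ?S \<rightarrow> ?S" using TS Teq by auto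
      qed
      then show ?thesis by (rule measurable_cong[THEN iffD2, rotated]) (simp add: sps Teq)
    qed
    show "distr ?\<mu> ?\<mu> T = ?\<mu>"
    proof (rule measure_eqI)
      fix A assume "A \<in> sets (distr ?\<mu> ?\<mu> T)"
      then have A: "A \<in> sets ?\<mu>" by simp
      then have A': "A \<subseteq> ?S" "A \<in> sets \<nu>" using Sn by (auto simp: sets_restrict_space_iff)
      have "emeasure (distr ?\<mu> ?\<mu> T) A = emeasure ?\<mu> (T -` A \<inter> ?S)"
        using emeasure_distr[OF mT A] by (simp add: sps)
      also have "\<dots> = emeasure \<nu> (T -` A \<inter> ?S)" using Sn by (intro emeasure_restrict_space) auto
      also have "T -` A \<inter> ?S = comb n ?w -` A \<inter> ?S" using Teq by auto
      also have "emeasure \<nu> (comb n ?w -` A \<inter> ?S) = emeasure \<nu> (comb n ?w -` A)"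
      proof (rule emeasure_eq_AE)
        show "AE x in \<nu>. (x \<in> comb n ?w -` A \<inter> ?S) = (x \<in> comb n ?w -` A)" using nu(3) by auto
        have "comb n ?w -` A \<inter> space borel \<in> sets borel"
          using measurable_sets[OF measurable_comb_right] A'(2) nu(2) by blast
        then show "comb n ?w -` A \<in> sets \<nu>" by (simp add: nu(2))
        then show "comb n ?w -` A \<inter> ?S \<in> sets \<nu>" using Sn by auto
      qed
      also have "\<dots> = emeasure (distr \<nu> borel (comb n ?w)) A"
        using A' by (subst emeasure_distr) (auto simp: nu(2) sp cong: measurable_cong_sets)
      also have "\<dots> = emeasure \<nu> A" by (simp add: inv[OF on])
      also have "\<dots> = emeasure ?\<mu> A" using Sn A' by (simp add: emeasure_restrict_space)
      finally show "emeasure (distr ?\<mu> ?\<mu> T) A = emeasure ?\<mu> A" .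
    qed simp
  next
    fix x y assume "x \<in> ?S" "y \<in> ?S"
    then show "\<exists>g\<in>orthogonal_maps n. g x = y" by (rule orthogonal_maps_transitive_sphere)
  next
    fix T x y assume T: "T \<in> orthogonal_maps n" and "x \<in> ?S"
    then show "T x \<in> ?S" using orthogonal_mapsD[OF T] by (auto simp: unit_sphere_def)
    assume "y \<in> ?S"
    then show "norm_Rn n (T x - T y) = norm_Rn n (x - y)"
      using \<open>x \<in> ?S\<close> orthogonal_mapsD(5)[OF T] unit_sphere_subset_Rn by blast
  qed (rule sets_mu)
  then show ?thesis by (simp add: sphere_measure_def top)
qed

section \<open>Rotation invariance and random orthonormal families\<close>

lemma measurable_vec_coord:
  fixes f :: "'a \<Rightarrow> nat \<Rightarrow> 'b::second_countable_topology"
  shows "f \<in> borel_measurable M \<Longrightarrow> (\<lambda>x. f x i) \<in> borel_measurable M"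
  using measurable_compose[OF _ measurable_product_coordinates] .

lemma measurable_vec_add [measurable]:
  fixes f g :: "'a \<Rightarrow> nat \<Rightarrow> real"
  assumes "f \<in> borel_measurable M" "g \<in> borel_measurable M"
  shows "(\<lambda>x. f x + g x) \<in> borel_measurable M"
proof (rule measurable_vecI)
  fix i show "(\<lambda>x. (f x + g x) i) \<in> borel_measurable M"
    unfolding plus_fun_apply by (intro borel_measurable_add assms[THEN measurable_vec_coord])
qed

lemma measurable_vec_diff [measurable]:
  fixes f g :: "'a \<Rightarrow> nat \<Rightarrow> real"
  assumes "f \<in> borel_measurable M" "g \<in> borel_measurable M"
  shows "(\<lambda>x. f x - g x) \<in> borel_measurable M"
proof (rule measurable_vecI)
  fix i show "(\<lambda>x. (f x - g x) i) \<in> borel_measurable M"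
    unfolding minus_apply by (intro borel_measurable_diff assms[THEN measurable_vec_coord])
qed

lemma measurable_vec_scaleR [measurable]:
  fixes f :: "'a \<Rightarrow> real" and g :: "'a \<Rightarrow> nat \<Rightarrow> real"
  assumes "f \<in> borel_measurable M" "g \<in> borel_measurable M"
  shows "(\<lambda>x. f x *\<^sub>R g x) \<in> borel_measurable M"
proof (rule measurable_vecI)
  fix i show "(\<lambda>x. (f x *\<^sub>R g x) i) \<in> borel_measurable M"
    unfolding scaleR_fun_apply by (intro borel_measurable_scaleR assms(1) assms(2)[THEN measurable_vec_coord])
qed

lemma measurable_inner_Rn [measurable]:
  assumes "f \<in> borel_measurable M" "g \<in> borel_measurable M"
  shows "(\<lambda>x. inner_Rn n (f x) (g x)) \<in> borel_measurable M"
  unfolding inner_Rn_def by (intro borel_measurable_sum borel_measurable_times assms[THEN measurable_vec_coord])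

lemma measurable_comb [measurable]:
  assumes f: "f \<in> borel_measurable M" and g: "\<And>i. (\<lambda>x. g x i) \<in> borel_measurable M"
  shows "(\<lambda>x. comb k (f x) (g x)) \<in> borel_measurable M"
proof (rule measurable_vecI)
  fix j show "(\<lambda>x. comb k (f x) (g x) j) \<in> borel_measurable M"
    unfolding comb_def
    by (intro borel_measurable_sum borel_measurable_times g measurable_vec_coord[OF measurable_vec_coord[OF f]])
qed

lemma measurable_comb_map [measurable]: "(\<lambda>v i. comb n w (v i)) \<in> borel_measurable (borel :: (nat \<Rightarrow> nat \<Rightarrow> real) measure)"
  by (rule measurable_vecI) (rule measurable_compose[OF measurable_product_coordinates measurable_comb_right])

lemma comb_Rn: "orthonormal n k w \<Longrightarrow> comb k w x \<in> Rn n"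
  by (rule comb_in_Rn) (auto dest: orthonormalD)

subsection \<open>Gaussian measure\<close>

text \<open>The uniqueness argument for Haar measure: the double integral of \<open>1\<^sub>A (C x) b (C x + y)\<close> is evaluated in
  both orders, with \<open>b\<close> a rotation invariant function of finite positive integral.\<close>

lemma emeasure_leb_rotation:
  assumes w: "orthonormal n n w" and [measurable]: "A \<in> sets borel"
  shows "(\<integral>\<^sup>+x. indicator A (comb n w x) \<partial>leb n) = (\<integral>\<^sup>+x. indicator A x \<partial>leb n)"
proof -
  interpret S: sigma_finite_measure "leb n" by (rule sigma_finite_leb)
  interpret P: pair_sigma_finite "leb n" "leb n" ..
  let ?C = "comb n w"
  define b where "b x = ennreal (exp (- (1 * (\<Sum>i<n. (x i)\<^sup>2))))" for x :: "nat \<Rightarrow> real"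
  have [measurable]: "b \<in> borel_measurable borel" unfolding b_def by measurable
  have bC: "b (?C x) = b x" for x
    using norm_comb_orthonormal[OF w, of x] unfolding b_def norm_Rn_power2[symmetric] by simp
  have beta: "(\<integral>\<^sup>+x. b x \<partial>leb n) = ennreal (sqrt (pi / 1) ^ n)"
    unfolding b_def by (rule nn_integral_leb_gauss) simp
  have "(\<integral>\<^sup>+x. indicator A (?C x) \<partial>leb n) * (\<integral>\<^sup>+x. b x \<partial>leb n)
      = (\<integral>\<^sup>+x. indicator A (?C x) * (\<integral>\<^sup>+y. b y \<partial>leb n) \<partial>leb n)"
    by (rule nn_integral_multc[symmetric]) measurable
  also have "\<dots> = (\<integral>\<^sup>+x. \<integral>\<^sup>+y. indicator A (?C x) * b (y + ?C x) \<partial>leb n \<partial>leb n)"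
  proof (rule nn_integral_cong)
    fix x
    have "(\<integral>\<^sup>+y. indicator A (?C x) * b (y + ?C x) \<partial>leb n) = indicator A (?C x) * (\<integral>\<^sup>+y. b (y + ?C x) \<partial>leb n)"
      by (rule nn_integral_cmult) measurable
    then show "indicator A (?C x) * (\<integral>\<^sup>+y. b y \<partial>leb n) = (\<integral>\<^sup>+y. indicator A (?C x) * b (y + ?C x) \<partial>leb n)"
      using nn_integral_leb_translate[of b "?C x" n] comb_Rn[OF w] by simp
  qed
  also have "\<dots> = (\<integral>\<^sup>+y. \<integral>\<^sup>+x. indicator A (?C x) * b (y + ?C x) \<partial>leb n \<partial>leb n)"
    by (rule P.Fubini'[symmetric]) measurable
  \<comment> \<open>For fixed y, translating x by the preimage of y under the rotation moves y from
    the argument of b into that of \<open>A\<close>. The translation acts on the variable before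
    rotation, where invariance of \<open>leb\<close> is known.\<close>
  also have "\<dots> = (\<integral>\<^sup>+y. \<integral>\<^sup>+x. indicator A (?C x - y) * b (?C x) \<partial>leb n \<partial>leb n)"
  proof (rule nn_integral_cong_AE, use AE_leb_Rn in eventually_elim)
    fix y assume y: "y \<in> Rn n"
    define y' where "y' = (\<lambda>i. if i < n then inner_Rn n y (w i) else 0)"
    have "y' \<in> Rn n" by (simp add: y'_def mem_Rn)
    then have y'_Rn: "- y' \<in> Rn n" by (rule Rn_uminus)
    have "?C y' = ?C (\<lambda>i. inner_Rn n y (w i))" by (rule comb_cong) (simp_all add: y'_def)
    also have "\<dots> = y" by (rule orthonormal_complete[OF w y, symmetric])
    finally have Cy': "?C y' = y" .
    have C: "?C (x + - y') = ?C x - y" for x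
      using comb_diff[of n w x y'] Cy' by simp
    have "(\<integral>\<^sup>+x. indicator A (?C x) * b (y + ?C x) \<partial>leb n) = (\<integral>\<^sup>+x. indicator A (?C (x + - y')) * b (y + ?C (x + - y')) \<partial>leb n)"
      by (rule nn_integral_leb_translate[OF _ y'_Rn, symmetric]) measurable
    then show "(\<integral>\<^sup>+x. indicator A (?C x) * b (y + ?C x) \<partial>leb n) = (\<integral>\<^sup>+x. indicator A (?C x - y) * b (?C x) \<partial>leb n)"
      unfolding C by simp
  qed
  also have "\<dots> = (\<integral>\<^sup>+x. \<integral>\<^sup>+y. indicator A (?C x - y) * b (?C x) \<partial>leb n \<partial>leb n)"
    by (rule P.Fubini') measurable
  also have "\<dots> = (\<integral>\<^sup>+x. (\<integral>\<^sup>+y. indicator A y \<partial>leb n) * b x \<partial>leb n)"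
  proof (rule nn_integral_cong)
    fix x
    have "(\<integral>\<^sup>+y. indicator A (?C x - y) * b (?C x) \<partial>leb n) = (\<integral>\<^sup>+y. indicator A (?C x - y) \<partial>leb n) * b (?C x)"
      by (rule nn_integral_multc) measurable
    \<comment> \<open>Reflection and then translation in y erase the dependence on
      \<open>?C x\<close> and leave the measure of \<open>A\<close> itself.\<close>
    also have "(\<integral>\<^sup>+y. indicator A (?C x - y) \<partial>leb n) = (\<integral>\<^sup>+y. indicator A (?C x - (- y)) \<partial>leb n)"
      by (rule nn_integral_leb_uminus[symmetric]) measurable
    also have "\<dots> = (\<integral>\<^sup>+y. indicator A (y + ?C x) \<partial>leb n)"
      by (simp add: add.commute)
    also have "\<dots> = (\<integral>\<^sup>+y. indicator A y \<partial>leb n)"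
      by (rule nn_integral_leb_translate[OF _ comb_Rn[OF w]]) measurable
    finally show "(\<integral>\<^sup>+y. indicator A (?C x - y) * b (?C x) \<partial>leb n) = (\<integral>\<^sup>+y. indicator A y \<partial>leb n) * b x"
      by (simp only: bC)
  qed
  also have "\<dots> = (\<integral>\<^sup>+y. indicator A y \<partial>leb n) * (\<integral>\<^sup>+x. b x \<partial>leb n)"
    by (rule nn_integral_cmult) measurable
  finally have "(\<integral>\<^sup>+x. indicator A (?C x) \<partial>leb n) * ennreal (sqrt (pi / 1) ^ n) = (\<integral>\<^sup>+x. indicator A x \<partial>leb n) * ennreal (sqrt (pi / 1) ^ n)"
    unfolding beta .
  then have "(\<integral>\<^sup>+x. indicator A (?C x) \<partial>leb n) * ennreal (sqrt (pi / 1) ^ n) * ennreal (1 / sqrt (pi / 1) ^ n)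
    = (\<integral>\<^sup>+x. indicator A x \<partial>leb n) * ennreal (sqrt (pi / 1) ^ n) * ennreal (1 / sqrt (pi / 1) ^ n)"
    by (simp only:)
  moreover have "ennreal (sqrt (pi / 1) ^ n) * ennreal (1 / sqrt (pi / 1) ^ n) = 1"
    by (subst ennreal_mult[symmetric]) auto
  ultimately show ?thesis by (simp only: mult.assoc mult_1_right)
qed

lemma nn_integral_leb_rotation:
  assumes w: "orthonormal n n w" and [measurable]: "f \<in> borel_measurable borel"
  shows "(\<integral>\<^sup>+x. f (comb n w x) \<partial>leb n) = (\<integral>\<^sup>+x. f x \<partial>leb n)"
proof -
  have "distr (leb n) borel (comb n w) = leb n"
  proof (rule measure_eqI)
    fix A assume "A \<in> sets (distr (leb n) borel (comb n w))"
    then have [measurable]: "A \<in> sets borel" by simp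
    have "emeasure (distr (leb n) borel (comb n w)) A = (\<integral>\<^sup>+x. indicator A x \<partial>distr (leb n) borel (comb n w))"
      by simp
    also have "\<dots> = (\<integral>\<^sup>+x. indicator A (comb n w x) \<partial>leb n)" by (rule nn_integral_distr) measurable
    finally show "emeasure (distr (leb n) borel (comb n w)) A = emeasure (leb n) A"
      by (simp add: emeasure_leb_rotation[OF w])
  qed simp
  then have "(\<integral>\<^sup>+x. f x \<partial>leb n) = (\<integral>\<^sup>+x. f x \<partial>distr (leb n) borel (comb n w))" by simp
  also have "\<dots> = (\<integral>\<^sup>+x. f (comb n w x) \<partial>leb n)" by (rule nn_integral_distr) measurable
  finally show ?thesis ..
qed

lemma nn_integral_gauss_rotation:
  assumes w: "orthonormal n n w" and [measurable]: "f \<in> borel_measurable borel"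
  shows "(\<integral>\<^sup>+x. f (comb n w x) \<partial>gauss n) = (\<integral>\<^sup>+x. f x \<partial>gauss n)"
proof -
  let ?g = "\<lambda>x :: nat \<Rightarrow> real. ennreal ((1 / sqrt (2 * pi)) ^ n * exp (- (1/2 * (\<Sum>i<n. (x i)\<^sup>2))))"
  have g: "?g (comb n w x) = ?g x" for x
    using norm_comb_orthonormal[OF w, of x] unfolding norm_Rn_power2[symmetric] by simp
  have "(\<integral>\<^sup>+x. f (comb n w x) \<partial>gauss n) = (\<integral>\<^sup>+x. ?g (comb n w x) * f (comb n w x) \<partial>leb n)"
    unfolding g by (rule nn_integral_gauss) measurable
  also have "\<dots> = (\<integral>\<^sup>+x. ?g x * f x \<partial>leb n)"
    by (rule nn_integral_leb_rotation[OF w]) measurable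
  also have "\<dots> = (\<integral>\<^sup>+x. f x \<partial>gauss n)"
    by (rule nn_integral_gauss[symmetric]) measurable
  finally show ?thesis .
qed

text \<open>Rotate \<open>z\<close> to the last coordinate vector, the one that the recursion for
  \<open>leb\<close> splits off; there the hyperplane meets each line in that direction in a single
  point.\<close>

lemma AE_gauss_inner_nonzero:
  assumes z: "z \<in> unit_sphere n"
  shows "AE x in gauss n. inner_Rn n x z \<noteq> 0"
proof -
  have z': "z \<in> Rn n" "norm_Rn n z = 1" using z by (auto simp: unit_sphere_def)
  then have "n \<noteq> 0" by (cases n) (auto simp: norm_Rn_sqrt)
  then obtain m where n: "n = Suc m" by (cases n) auto
  have e: "unit_vec m \<in> unit_sphere n"
    using orthonormalD[OF orthonormal_unit_vec[of n n], of m] by (auto simp: unit_sphere_def n)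
  obtain T where T: "T \<in> orthogonal_maps n" "T (unit_vec m) = z"
    using orthogonal_maps_transitive_sphere[OF e z] by auto
  let ?w = "\<lambda>i. T (unit_vec i)"
  have w: "orthonormal n n ?w" by (rule orthogonal_maps_orthonormal[OF T(1) orthonormal_unit_vec]) simp
  have "inner_Rn n (comb n ?w x) z = x m" for x
    using inner_comb_orthonormal(1)[OF w, of m x] by (simp add: T(2) n)
  then have eq: "(\<integral>\<^sup>+x. indicator {x. inner_Rn n x z = 0} (comb n ?w x) \<partial>gauss n) = (\<integral>\<^sup>+x. indicator {x. x m = 0} x \<partial>gauss n)"
    by (intro nn_integral_cong) (auto simp: indicator_def)
  have "Measurable.pred borel (\<lambda>x. inner_Rn n x z = 0)" by measurable
  then have [measurable]: "{x. inner_Rn n x z = 0} \<in> sets borel" by simp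
  have "Measurable.pred borel (\<lambda>x :: nat \<Rightarrow> real. x m = 0)" by measurable
  then have [measurable]: "{x :: nat \<Rightarrow> real. x m = 0} \<in> sets borel" by simp
  have "(\<integral>\<^sup>+x. indicator {x. x m = 0} x \<partial>leb n) = (\<integral>\<^sup>+x. \<integral>\<^sup>+t. indicator {x. x m = 0} (x(m := t)) \<partial>lborel \<partial>leb m)"
    unfolding n by (rule nn_integral_leb_Suc) measurable
  also have "\<dots> = (\<integral>\<^sup>+x. \<integral>\<^sup>+t. indicator {0::real} t \<partial>lborel \<partial>leb m)"
    by (intro nn_integral_cong) (auto simp: indicator_def)
  finally have "emeasure (leb n) {x. x m = 0} = 0" by simp
  then have "AE x in leb n. x m \<noteq> 0"
    by (intro AE_I[where N="{x. x m = 0}"]) auto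
  then have "AE x in gauss n. x m \<noteq> 0"
    unfolding gauss_def by (subst AE_density) (auto elim: eventually_mono)
  then have "(\<integral>\<^sup>+x. indicator {x. x m = 0} x \<partial>gauss n) = 0"
    by (subst nn_integral_0_iff_AE) (auto simp: indicator_def elim: eventually_mono)
  then have "(\<integral>\<^sup>+x. indicator {x. inner_Rn n x z = 0} x \<partial>gauss n) = 0"
    using nn_integral_gauss_rotation[OF w, of "indicator {x. inner_Rn n x z = 0}"] eq by simp
  then show ?thesis
    by (subst (asm) nn_integral_0_iff_AE) (auto simp: indicator_def elim: eventually_mono)
qed

text \<open>A unit vector z orthogonal to the family has the same inner product with x as with its
  remainder, and this is almost surely nonzero. So Gram--Schmidt almost never degenerates.\<close>

lemma AE_gauss_resid_nonzero:
  assumes "orthonormal n k v" "k < n"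
  shows "AE x in gauss n. resid n k v x \<noteq> 0"
proof -
  obtain z where z: "z \<in> Rn n" "norm_Rn n z = 1" "\<And>i. i < k \<Longrightarrow> inner_Rn n z (v i) = 0"
    using orthonormal_complement[OF assms] by blast
  have "inner_Rn n (resid n k v x) z = inner_Rn n x z" for x
  proof -
    have "inner_Rn n (comb k v a) z = 0" for a
      unfolding inner_comb_left using z(3) by (intro sum.neutral) (simp add: inner_Rn_commute[of n _ z])
    then show ?thesis by (simp add: resid_def inner_Rn_simps)
  qed
  moreover have "AE x in gauss n. inner_Rn n x z \<noteq> 0"
    using z by (intro AE_gauss_inner_nonzero) (simp add: unit_sphere_def)
  ultimately show ?thesis by (auto elim!: eventually_mono) (metis inner_Rn_0(1))
qed

lemma AE_gauss_nonzero: "1 \<le> n \<Longrightarrow> AE x in gauss n. x \<in> Rn n \<and> norm_Rn n x \<noteq> 0"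
  using AE_gauss_resid_nonzero[of n 0 "\<lambda>_. 0"] AE_gauss_Rn[of n]
  by (auto simp: orthonormal_def resid_def comb_eq_sum norm_Rn_eq_0 elim: AE_mp)

subsection \<open>Random orthonormal families\<close>

text \<open>Gram--Schmidt applied to independent Gaussian vectors.\<close>

definition gs_step :: "nat \<Rightarrow> nat \<Rightarrow> (nat \<Rightarrow> nat \<Rightarrow> real) \<Rightarrow> (nat \<Rightarrow> real) \<Rightarrow> nat \<Rightarrow> nat \<Rightarrow> real" where
  "gs_step n k v g = v(k := normalize_Rn n (resid n k v g))"

text \<open>The point mass at 0 is only the start of the recursion; each step fills one more place.
  For k \<le> n the result is the uniform law on orthonormal k-frames, and its span is the random
  subspace.\<close>

definition frames :: "nat \<Rightarrow> nat \<Rightarrow> (nat \<Rightarrow> nat \<Rightarrow> real) measure" where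
  "frames n = rec_nat (return borel 0) (\<lambda>k M. distr (M \<Otimes>\<^sub>M gauss n) borel (\<lambda>p. gs_step n k (fst p) (snd p)))"

lemma frames_0: "frames n 0 = return borel 0"
  by (simp add: frames_def)

lemma frames_Suc: "frames n (Suc k) = distr (frames n k \<Otimes>\<^sub>M gauss n) borel (\<lambda>p. gs_step n k (fst p) (snd p))"
  by (simp add: frames_def)

lemma sets_frames [simp, measurable_cong]: "sets (frames n k) = sets borel"
  by (cases k) (simp_all add: frames_0 frames_Suc)

lemma space_frames [simp]: "space (frames n k) = UNIV"
  by (cases k) (simp_all add: frames_0 frames_Suc)

lemma measurable_gs_step [measurable]:
  assumes f: "f \<in> borel_measurable M" and g: "g \<in> borel_measurable M"
  shows "(\<lambda>x. gs_step n k (f x) (g x)) \<in> borel_measurable M"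
proof -
  note [measurable] = f g
  have [measurable]: "(\<lambda>x. f x i) \<in> borel_measurable M" for i
    by (rule measurable_vec_coord[OF f])
  have [measurable]: "(\<lambda>x. resid n k (f x) (g x)) \<in> borel_measurable M"
    unfolding resid_def by (intro measurable_vec_diff measurable_comb measurable_inner_Rn) measurable
  have "(\<lambda>x. normalize_Rn n (resid n k (f x) (g x))) \<in> borel_measurable M"
    unfolding normalize_Rn_def
    by (intro measurable_vec_scaleR borel_measurable_divide measurable_compose[OF _ measurable_norm_Rn]) measurable
  then show ?thesis unfolding gs_step_def by (intro measurable_fun_upd_vec f)
qed

lemma prob_space_frames: "prob_space (frames n k)"
proof (induction k)
  case 0
  show ?case unfolding frames_0 by (rule prob_space_return) simp
next
  case (Suc k)
  interpret A: prob_space "frames n k" by fact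
  interpret B: prob_space "gauss n" by (rule prob_space_gauss)
  interpret P: pair_prob_space "frames n k" "gauss n" ..
  show ?case unfolding frames_Suc by (rule P.prob_space_distr) measurable
qed

lemma nn_integral_frames_Suc:
  assumes [measurable]: "f \<in> borel_measurable borel"
  shows "(\<integral>\<^sup>+v. f v \<partial>frames n (Suc k)) = (\<integral>\<^sup>+v. \<integral>\<^sup>+g. f (gs_step n k v g) \<partial>gauss n \<partial>frames n k)"
proof -
  interpret B: prob_space "gauss n" by (rule prob_space_gauss)
  have "(\<integral>\<^sup>+v. f v \<partial>frames n (Suc k)) = (\<integral>\<^sup>+p. f (gs_step n k (fst p) (snd p)) \<partial>(frames n k \<Otimes>\<^sub>M gauss n))"
    unfolding frames_Suc by (rule nn_integral_distr) measurable
  also have "\<dots> = (\<integral>\<^sup>+v. \<integral>\<^sup>+g. f (gs_step n k v g) \<partial>gauss n \<partial>frames n k)"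
    by (subst B.nn_integral_fst[symmetric]) simp_all
  finally show ?thesis .
qed

lemma sets_orthonormal [measurable]: "{v. orthonormal n k v} \<in> sets borel"
proof -
  have [measurable]: "(\<lambda>v :: nat \<Rightarrow> nat \<Rightarrow> real. v i) \<in> borel_measurable borel" for i
    by (rule measurable_product_coordinates)
  have "Measurable.pred borel (\<lambda>v. orthonormal n k v)"
    unfolding orthonormal_def by measurable
  then show ?thesis by simp
qed

lemma AE_frames_orthonormal: "k \<le> n \<Longrightarrow> AE v in frames n k. orthonormal n k v"
proof (induction k)
  case 0
  show ?case by (simp add: orthonormal_def)
next
  case (Suc k)
  interpret A: prob_space "frames n k" by (rule prob_space_frames)
  interpret B: prob_space "gauss n" by (rule prob_space_gauss)
  have IH: "AE v in frames n k. orthonormal n k v" using Suc by simp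
  have "(\<integral>\<^sup>+v. indicator (- {v. orthonormal n (Suc k) v}) v \<partial>frames n (Suc k))
    = (\<integral>\<^sup>+v. \<integral>\<^sup>+g. indicator (- {v. orthonormal n (Suc k) v}) (gs_step n k v g) \<partial>gauss n \<partial>frames n k)"
    by (rule nn_integral_frames_Suc) (auto intro!: borel_measurable_indicator sets_orthonormal)
  also have "\<dots> = (\<integral>\<^sup>+v. 0 \<partial>frames n k)"
  proof (rule nn_integral_cong_AE, use IH in eventually_elim)
    fix v assume v: "orthonormal n k v"
    have "AE g in gauss n. indicator (- {v. orthonormal n (Suc k) v}) (gs_step n k v g) = (0 :: ennreal)"
      using AE_gauss_resid_nonzero[OF v Suc_le_lessD[OF Suc.prems]] AE_gauss_Rn[of n]
    proof eventually_elim
      case (elim g)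
      then have "orthonormal n (Suc k) (gs_step n k v g)"
        unfolding gs_step_def by (intro orthonormal_extend[OF v])
      then show ?case by simp
    qed
    then show "(\<integral>\<^sup>+g. indicator (- {v. orthonormal n (Suc k) v}) (gs_step n k v g) \<partial>gauss n) = 0"
      by (simp cong: nn_integral_cong_AE)
  qed
  finally have "emeasure (frames n (Suc k)) (- {v. orthonormal n (Suc k) v}) = 0"
    using sets_orthonormal[of n "Suc k"] by (subst (asm) nn_integral_indicator) (auto simp: Compl_in_sets_lebesgue)
  then show ?case
    by (intro AE_I[where N="- {v. orthonormal n (Suc k) v}"]) (use sets_orthonormal[of n "Suc k"] in auto)
qed

lemma gs_step_rotation:
  assumes w: "orthonormal n n w"
  shows "(\<lambda>i. comb n w (gs_step n k v g i)) = gs_step n k (\<lambda>i. comb n w (v i)) (comb n w g)"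
proof -
  have C: "comb n w (comb k v a) = comb k (\<lambda>i. comb n w (v i)) a" for a
    by (induction k) (simp_all only: comb_Suc comb_add comb_scaleR, simp add: comb_def fun_eq_iff)
  have r: "comb n w (resid n k v g) = resid n k (\<lambda>i. comb n w (v i)) (comb n w g)"
    unfolding resid_def comb_diff C inner_comb_orthonormal(2)[OF w] ..
  have "comb n w (normalize_Rn n (resid n k v g)) = normalize_Rn n (resid n k (\<lambda>i. comb n w (v i)) (comb n w g))"
    unfolding normalize_Rn_def comb_scaleR r[symmetric] norm_comb_orthonormal[OF w] ..
  then show ?thesis by (auto simp: gs_step_def fun_eq_iff)
qed

text \<open>Gram--Schmidt commutes with rotations, so the invariance of each Gaussian factor passes
  through the recursion.\<close>

lemma nn_integral_frames_rotation:
  assumes w: "orthonormal n n w" and "f \<in> borel_measurable borel"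
  shows "(\<integral>\<^sup>+v. f (\<lambda>i. comb n w (v i)) \<partial>frames n k) = (\<integral>\<^sup>+v. f v \<partial>frames n k)"
  using assms(2)
proof (induction k arbitrary: f)
  case 0
  note [measurable] = 0
  have "(\<lambda>i. comb n w ((0 :: nat \<Rightarrow> nat \<Rightarrow> real) i)) = 0" by (simp add: comb_def fun_eq_iff)
  then show ?case unfolding frames_0 by (subst (1 2) nn_integral_return) auto
next
  case (Suc k)
  note [measurable] = Suc.prems
  interpret B: prob_space "gauss n" by (rule prob_space_gauss)
  let ?R = "\<lambda>v i. comb n w (v i)"
  have "(\<integral>\<^sup>+v. f (?R v) \<partial>frames n (Suc k)) = (\<integral>\<^sup>+v. \<integral>\<^sup>+g. f (?R (gs_step n k v g)) \<partial>gauss n \<partial>frames n k)"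
    by (rule nn_integral_frames_Suc) measurable
  also have "\<dots> = (\<integral>\<^sup>+v. \<integral>\<^sup>+g. f (gs_step n k (?R v) (comb n w g)) \<partial>gauss n \<partial>frames n k)"
    unfolding gs_step_rotation[OF w] ..
  also have "\<dots> = (\<integral>\<^sup>+v. \<integral>\<^sup>+g. f (gs_step n k (?R v) g) \<partial>gauss n \<partial>frames n k)"
    by (intro nn_integral_cong nn_integral_gauss_rotation[OF w]) measurable
  also have "\<dots> = (\<integral>\<^sup>+v. \<integral>\<^sup>+g. f (gs_step n k v g) \<partial>gauss n \<partial>frames n k)"
    by (rule Suc.IH[of "\<lambda>v. \<integral>\<^sup>+g. f (gs_step n k v g) \<partial>gauss n"]) measurable
  also have "\<dots> = (\<integral>\<^sup>+v. f v \<partial>frames n (Suc k))"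
    by (rule nn_integral_frames_Suc[symmetric]) measurable
  finally show ?case .
qed

subsection \<open>The sphere\<close>

text \<open>Uniqueness restated by integrals of functions on all sequences, so that sphere integrals
  can be exchanged for integrals against any invariant candidate.\<close>

lemma sphere_measure_char:
  assumes nu: "prob_space \<nu>" "sets \<nu> = sets borel" "AE x in \<nu>. x \<in> unit_sphere n"
    and inv: "\<And>w A. orthonormal n n w \<Longrightarrow> (A :: (nat \<Rightarrow> real) set) \<in> sets borel \<Longrightarrow> emeasure \<nu> (comb n w -` A) = emeasure \<nu> A"
  shows "sets (sphere_measure n) = sets (restrict_space borel (unit_sphere n)) \<and>
    (\<forall>f\<in>borel_measurable borel. (\<integral>\<^sup>+x. f x \<partial>sphere_measure n) = (\<integral>\<^sup>+x. f x \<partial>\<nu>))"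
proof (intro conjI ballI)
  have sp: "space \<nu> = UNIV" using sets_eq_imp_space_eq[OF nu(2)] by simp
  have eq: "sphere_measure n = restrict_space \<nu> (unit_sphere n)"
  proof (rule sphere_measure_eqI[OF nu])
    fix w assume w: "orthonormal n n w"
    have m: "comb n w \<in> measurable \<nu> borel"
      using measurable_comb_right by (simp add: nu(2) cong: measurable_cong_sets)
    show "distr \<nu> borel (comb n w) = \<nu>"
    proof (rule measure_eqI)
      fix A assume "A \<in> sets (distr \<nu> borel (comb n w))"
      then show "emeasure (distr \<nu> borel (comb n w)) A = emeasure \<nu> A"
        using inv[OF w, of A] by (simp add: emeasure_distr[OF m] sp)
    qed (simp add: nu(2))
  qed
  show "sets (sphere_measure n) = sets (restrict_space borel (unit_sphere n))"
    by (simp add: eq sets_restrict_space nu(2))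
  fix f :: "(nat \<Rightarrow> real) \<Rightarrow> ennreal" assume f: "f \<in> borel_measurable borel"
  have "(\<integral>\<^sup>+x. f x \<partial>sphere_measure n) = (\<integral>\<^sup>+x. f x * indicator (unit_sphere n) x \<partial>\<nu>)"
    by (simp add: eq nn_integral_restrict_space nu(2) sp)
  also have "\<dots> = (\<integral>\<^sup>+x. f x \<partial>\<nu>)"
    by (rule nn_integral_cong_AE) (use nu(3) in \<open>auto elim: eventually_mono\<close>)
  finally show "(\<integral>\<^sup>+x. f x \<partial>sphere_measure n) = (\<integral>\<^sup>+x. f x \<partial>\<nu>)" .
qed

text \<open>For a fixed unit coefficient vector \<open>a\<close>, rotating the frame rotates the
  point \<open>comb k v a\<close>, whose law is therefore the invariant one. The case k = 1
  identifies the sphere measure; general \<open>k\<close> says that a fixed position in a random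
  subspace is uniform, as the union bound needs.\<close>

lemma sphere_measure_frames:
  assumes a: "norm_Rn k a = 1" and k: "k \<le> n"
  shows "sets (sphere_measure n) = sets (restrict_space borel (unit_sphere n)) \<and>
    (\<forall>f\<in>borel_measurable borel. (\<integral>\<^sup>+x. f x \<partial>sphere_measure n) = (\<integral>\<^sup>+v. f (comb k v a) \<partial>frames n k))"
proof -
  interpret prob_space "frames n k" by (rule prob_space_frames)
  have m [measurable]: "(\<lambda>v. comb k v a) \<in> borel_measurable (frames n k)"
    by (intro measurable_comb) measurable
  have "sets (sphere_measure n) = sets (restrict_space borel (unit_sphere n)) \<and>
    (\<forall>f\<in>borel_measurable borel. (\<integral>\<^sup>+x. f x \<partial>sphere_measure n) = (\<integral>\<^sup>+x. f x \<partial>distr (frames n k) borel (\<lambda>v. comb k v a)))"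
  proof (rule sphere_measure_char)
    show "prob_space (distr (frames n k) borel (\<lambda>v. comb k v a))" by (rule prob_space_distr[OF m])
    have "AE v in frames n k. comb k v a \<in> unit_sphere n"
      using AE_frames_orthonormal[OF k] a
      by (auto simp: unit_sphere_def norm_comb_orthonormal comb_Rn elim: eventually_mono)
    then show "AE x in distr (frames n k) borel (\<lambda>v. comb k v a). x \<in> unit_sphere n"
      by (subst AE_distr_iff[OF m]) auto
    fix w and A :: "(nat \<Rightarrow> real) set" assume w: "orthonormal n n w" and [measurable]: "A \<in> sets borel"
    have C: "comb n w (comb k v a) = comb k (\<lambda>i. comb n w (v i)) a" for v
      by (induction k) (simp_all only: comb_Suc comb_add comb_scaleR, simp add: comb_def fun_eq_iff)
    have "comb n w -` A \<inter> space borel \<in> sets borel" by measurable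
    then have [measurable]: "comb n w -` A \<in> sets borel" by simp
    have "emeasure (distr (frames n k) borel (\<lambda>v. comb k v a)) (comb n w -` A) = (\<integral>\<^sup>+v. indicator (comb n w -` A) (comb k v a) \<partial>frames n k)"
      by (subst nn_integral_indicator[symmetric], simp, subst nn_integral_distr) measurable
    also have "\<dots> = (\<integral>\<^sup>+v. indicator A (comb k (\<lambda>i. comb n w (v i)) a) \<partial>frames n k)"
      by (intro nn_integral_cong) (simp add: C[symmetric] indicator_def)
    also have "\<dots> = (\<integral>\<^sup>+v. indicator A (comb k v a) \<partial>frames n k)"
      using m by (intro nn_integral_frames_rotation[OF w, of "\<lambda>v. indicator A (comb k v a)"])
        (simp cong: measurable_cong_sets)
    also have "\<dots> = emeasure (distr (frames n k) borel (\<lambda>v. comb k v a)) A"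
      by (subst nn_integral_indicator[symmetric], simp, subst nn_integral_distr) measurable
    finally show "emeasure (distr (frames n k) borel (\<lambda>v. comb k v a)) (comb n w -` A) = emeasure (distr (frames n k) borel (\<lambda>v. comb k v a)) A" .
  qed simp_all
  moreover have "(\<integral>\<^sup>+x. f x \<partial>distr (frames n k) borel (\<lambda>v. comb k v a)) = (\<integral>\<^sup>+v. f (comb k v a) \<partial>frames n k)"
    if [measurable]: "f \<in> borel_measurable borel" for f :: "_ \<Rightarrow> ennreal"
    by (rule nn_integral_distr[OF m]) measurable
  ultimately show ?thesis by simp
qed

lemma nn_integral_sphere_frames:
  "norm_Rn k a = 1 \<Longrightarrow> k \<le> n \<Longrightarrow> f \<in> borel_measurable borel \<Longrightarrow>
    (\<integral>\<^sup>+x. f x \<partial>sphere_measure n) = (\<integral>\<^sup>+v. f (comb k v a) \<partial>frames n k)"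
  using sphere_measure_frames by blast

lemma norm_unit_vec [simp]: "i < n \<Longrightarrow> norm_Rn n (unit_vec i) = 1"
  by (rule orthonormalD(2)[OF orthonormal_unit_vec[OF order.refl]])

lemma sets_sphere_measure: "1 \<le> n \<Longrightarrow> sets (sphere_measure n) = sets (restrict_space borel (unit_sphere n))"
  using sphere_measure_frames[of 1 "unit_vec 0" n] by simp

lemma space_sphere_measure: "1 \<le> n \<Longrightarrow> space (sphere_measure n) = unit_sphere n"
  using sets_eq_imp_space_eq[OF sets_sphere_measure] by (simp add: space_restrict_space)

lemma prob_space_sphere_measure: "1 \<le> n \<Longrightarrow> prob_space (sphere_measure n)"
  using nn_integral_sphere_frames[of 1 "unit_vec 0" n "\<lambda>_. 1"] prob_space.emeasure_space_1[OF prob_space_frames[of n 1]]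
  by (intro prob_spaceI) simp

text \<open>The direction of a Gaussian vector is uniform on the sphere and independent of its length.\<close>

lemma nn_integral_gauss_polar:
  assumes n: "1 \<le> n" and [measurable]: "f \<in> borel_measurable borel" "h \<in> borel_measurable borel"
    and rad: "\<And>w x. orthonormal n n w \<Longrightarrow> h (comb n w x) = h x"
    and c: "(\<integral>\<^sup>+x. h x \<partial>gauss n) = ennreal c" "0 < c"
  shows "(\<integral>\<^sup>+x. h x * f (normalize_Rn n x) \<partial>gauss n) = ennreal c * (\<integral>\<^sup>+x. f x \<partial>sphere_measure n)"
proof -
  \<comment> \<open>The rotation invariant weight \<open>h\<close>, normalised to a density, leaves
    the law of the direction rotation invariant, so that law is Haar measure whatever
    \<open>h\<close> is. This gives the independence without polar coordinates.\<close>
  let ?d = "density (gauss n) (\<lambda>x. ennreal (1 / c) * h x)"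
  have m [measurable]: "normalize_Rn n \<in> borel_measurable borel"
    unfolding normalize_Rn_def[abs_def] by measurable
  have md: "normalize_Rn n \<in> borel_measurable ?d" by measurable
  have dint: "(\<integral>\<^sup>+x. u x \<partial>?d) = ennreal (1 / c) * (\<integral>\<^sup>+x. h x * u x \<partial>gauss n)"
    if [measurable]: "u \<in> borel_measurable borel" for u
  proof -
    have "(\<integral>\<^sup>+x. u x \<partial>?d) = (\<integral>\<^sup>+x. ennreal (1 / c) * h x * u x \<partial>gauss n)"
      by (rule nn_integral_density) measurable
    also have "\<dots> = ennreal (1 / c) * (\<integral>\<^sup>+x. h x * u x \<partial>gauss n)"
      unfolding mult.assoc by (rule nn_integral_cmult) measurable
    finally show ?thesis .
  qed
  have cc: "ennreal c * ennreal (1 / c) = 1" using c(2) by (simp add: ennreal_mult[symmetric])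
  interpret d: prob_space ?d
  proof
    have "emeasure ?d (space ?d) = (\<integral>\<^sup>+x. 1 \<partial>?d)" by simp
    also have "\<dots> = 1" using dint[of "\<lambda>_. 1"] c cc by (simp add: mult.commute)
    finally show "emeasure ?d (space ?d) = 1" .
  qed
  have "\<forall>f\<in>borel_measurable borel. (\<integral>\<^sup>+x. f x \<partial>sphere_measure n) = (\<integral>\<^sup>+x. f x \<partial>distr ?d borel (normalize_Rn n))"
  proof (rule sphere_measure_char[THEN conjunct2])
    show "prob_space (distr ?d borel (normalize_Rn n))" by (rule d.prob_space_distr[OF md])
    have "AE x in gauss n. normalize_Rn n x \<in> unit_sphere n"
      using AE_gauss_nonzero[OF n]
    proof eventually_elim
      case (elim x)
      then have "normalize_Rn n x \<in> Rn n" unfolding normalize_Rn_def by (intro Rn_scaleR) simp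
      then show ?case using elim by (simp add: unit_sphere_def norm_normalize_Rn)
    qed
    then have "AE x in ?d. normalize_Rn n x \<in> unit_sphere n"
      by (subst AE_density) (auto elim: eventually_mono)
    then show "AE x in distr ?d borel (normalize_Rn n). x \<in> unit_sphere n"
      by (subst AE_distr_iff[OF md]) auto
    fix w and A :: "(nat \<Rightarrow> real) set" assume w: "orthonormal n n w" and [measurable]: "A \<in> sets borel"
    have C: "comb n w (normalize_Rn n x) = normalize_Rn n (comb n w x)" for x
      unfolding normalize_Rn_def comb_scaleR norm_comb_orthonormal[OF w] ..
    have "comb n w -` A \<inter> space borel \<in> sets borel" by measurable
    then have [measurable]: "comb n w -` A \<in> sets borel" by simp
    have em: "emeasure (distr ?d borel (normalize_Rn n)) B = ennreal (1 / c) * (\<integral>\<^sup>+x. h x * indicator B (normalize_Rn n x) \<partial>gauss n)"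
      if [measurable]: "B \<in> sets borel" for B
    proof -
      have "emeasure (distr ?d borel (normalize_Rn n)) B = (\<integral>\<^sup>+x. indicator B x \<partial>distr ?d borel (normalize_Rn n))"
        using that by simp
      also have "\<dots> = (\<integral>\<^sup>+x. indicator B (normalize_Rn n x) \<partial>?d)"
        by (rule nn_integral_distr[OF md]) measurable
      also have "\<dots> = ennreal (1 / c) * (\<integral>\<^sup>+x. h x * indicator B (normalize_Rn n x) \<partial>gauss n)"
        by (rule dint) measurable
      finally show ?thesis .
    qed
    have "(\<integral>\<^sup>+x. h x * indicator (comb n w -` A) (normalize_Rn n x) \<partial>gauss n)
       = (\<integral>\<^sup>+x. h (comb n w x) * indicator A (normalize_Rn n (comb n w x)) \<partial>gauss n)"
      unfolding rad[OF w] C[symmetric] by (intro nn_integral_cong) (simp add: indicator_def)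
    also have "\<dots> = (\<integral>\<^sup>+x. h x * indicator A (normalize_Rn n x) \<partial>gauss n)"
      by (rule nn_integral_gauss_rotation[OF w]) measurable
    finally show "emeasure (distr ?d borel (normalize_Rn n)) (comb n w -` A) = emeasure (distr ?d borel (normalize_Rn n)) A"
      by (simp add: em)
  qed simp_all
  then have "(\<integral>\<^sup>+x. f x \<partial>sphere_measure n) = (\<integral>\<^sup>+x. f x \<partial>distr ?d borel (normalize_Rn n))" by simp
  also have "\<dots> = (\<integral>\<^sup>+x. f (normalize_Rn n x) \<partial>?d)"
    by (rule nn_integral_distr[OF md]) measurable
  also have "\<dots> = ennreal (1 / c) * (\<integral>\<^sup>+x. h x * f (normalize_Rn n x) \<partial>gauss n)"
    by (rule dint) measurable
  finally have "ennreal c * (\<integral>\<^sup>+x. f x \<partial>sphere_measure n)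
     = (ennreal c * ennreal (1 / c)) * (\<integral>\<^sup>+x. h x * f (normalize_Rn n x) \<partial>gauss n)"
    by (simp only: mult.assoc)
  then show ?thesis by (simp only: cc mult_1)
qed

section \<open>Concentration on the sphere\<close>

text \<open>With y = exp (1/8) one has y^8 = e \<le> 3, whereas y^3 > 8/5 would give (8/5)^8 < 3^3,
  which is false. The bound makes exp (3/8) / 2 at most 4/5.\<close>

lemma exp_three_eighths: "exp (3/8 :: real) \<le> 8/5"
proof (rule ccontr)
  define y where "y = exp (1/8 :: real)"
  have y: "0 \<le> y" "y ^ 8 \<le> 3" using exp_le by (simp_all add: y_def flip: exp_of_nat_mult)
  have "exp (3/8 :: real) = y ^ 3" by (simp add: y_def flip: exp_of_nat_mult)
  moreover assume "\<not> exp (3/8 :: real) \<le> 8/5"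
  ultimately have "8/5 < y ^ 3" by simp
  then have "(8/5) ^ 8 < (y ^ 3) ^ 8" by (intro power_strict_mono) auto
  also have "\<dots> = (y ^ 8) ^ 3" by (simp flip: power_mult)
  also have "\<dots> \<le> 3 ^ 3" using y by (intro power_mono) auto
  finally show False by (simp add: power_divide)
qed

text \<open>Chernoff bound for |x|^2 < n / 4 with exponent -3/2, chosen because 1 / sqrt (1 + 3) =
  1/2; each coordinate contributes a factor exp (3/8) / 2 \<le> 4/5. The value 1/5 is crude but
  independent of \<open>n\<close>.\<close>

lemma gauss_norm_lower:
  assumes "1 \<le> n"
  shows "1/5 \<le> measure (gauss n) {x. sqrt n / 2 \<le> norm_Rn n x}"
proof -
  interpret prob_space "gauss n" by (rule prob_space_gauss)
  let ?B = "{x. sqrt n / 2 \<le> norm_Rn n x}"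
  have "Measurable.pred borel (\<lambda>x. sqrt n / 2 \<le> norm_Rn n x)" by measurable
  then have B [measurable]: "?B \<in> sets borel" by simp
  have "indicator (- ?B) x \<le> ennreal (exp (3/8 * n)) * ennreal (exp (- 3/2 * (norm_Rn n x)\<^sup>2))" for x
  proof (cases "norm_Rn n x < sqrt n / 2")
    case True
    then have "(norm_Rn n x)\<^sup>2 \<le> (sqrt n / 2)\<^sup>2" by (intro power_mono) auto
    then have "(norm_Rn n x)\<^sup>2 \<le> n / 4" by (simp add: power_divide)
    then have "1 \<le> exp (3/8 * n) * exp (- 3/2 * (norm_Rn n x)\<^sup>2)"
      unfolding exp_add[symmetric] by simp
    then show ?thesis using True by (simp add: ennreal_mult[symmetric])
  qed (simp add: not_less)
  then have "(\<integral>\<^sup>+x. indicator (- ?B) x \<partial>gauss n) \<le> (\<integral>\<^sup>+x. ennreal (exp (3/8 * n)) * ennreal (exp (- 3/2 * (norm_Rn n x)\<^sup>2)) \<partial>gauss n)"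
    by (intro nn_integral_mono)
  also have "\<dots> = ennreal (exp (3/8 * n)) * (\<integral>\<^sup>+x. ennreal (exp (- 3/2 * (norm_Rn n x)\<^sup>2)) \<partial>gauss n)"
    by (rule nn_integral_cmult) measurable
  also have "(\<integral>\<^sup>+x. ennreal (exp (- 3/2 * (norm_Rn n x)\<^sup>2)) \<partial>gauss n) = ennreal ((1/2) ^ n)"
    using nn_integral_gauss_exp_square[of "- 3/2" n] by simp
  also have "ennreal (exp (3/8 * n)) * ennreal ((1/2) ^ n) = ennreal (exp (3/8 * n) * (1/2) ^ n)"
    by (rule ennreal_mult[symmetric]) auto
  also have "exp (3/8 * n) * (1/2) ^ n = (exp (3/8) / 2 :: real) ^ n"
    by (simp add: exp_of_nat_mult[symmetric] power_divide mult.commute)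
  also have "ennreal \<dots> \<le> ennreal (4/5)"
  proof (rule ennreal_leI)
    have "(exp (3/8) / 2 :: real) ^ n \<le> (4/5) ^ n" using exp_three_eighths by (intro power_mono) auto
    also have "\<dots> \<le> (4/5 :: real) ^ 1" using assms by (intro power_decreasing) auto
    finally show "(exp (3/8) / 2 :: real) ^ n \<le> 4/5" by simp
  qed
  finally have "emeasure (gauss n) (- ?B) \<le> ennreal (4/5)" using B by simp
  then have "prob (- ?B) \<le> 4/5" by (simp add: emeasure_eq_measure)
  moreover have "prob (- ?B) = 1 - prob ?B" using prob_compl[of ?B] by (simp add: Compl_eq_Diff_UNIV)
  ultimately show ?thesis by simp
qed

text \<open>By homogeneity, F \<ge> t at the direction of x together with |x| \<ge> r forces F x
  \<ge> r t, an event controlled by the exponential moment. Direction and length are independent and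
  the length condition has probability at least 1/5, hence the factor 5.\<close>

lemma sphere_upper_tail:
  fixes F :: "(nat \<Rightarrow> real) \<Rightarrow> real"
  assumes n: "1 \<le> n" and [measurable]: "F \<in> borel_measurable borel"
    and lip: "\<And>x y. x \<in> Rn n \<Longrightarrow> y \<in> Rn n \<Longrightarrow> F x - F y \<le> L * norm_Rn n (x - y)" and L: "0 < L"
    and hom: "\<And>x c. x \<in> Rn n \<Longrightarrow> 0 \<le> c \<Longrightarrow> F (c *\<^sub>R x) = c * F x"
    and mean: "(\<integral>x. F x \<partial>gauss n) = 0" and t: "0 \<le> t"
  shows "(\<integral>\<^sup>+x. indicator {x. t \<le> F x} x \<partial>sphere_measure n) \<le> ennreal (5 * exp (- (t\<^sup>2 * n / (16 * L\<^sup>2))))"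
proof -
  interpret prob_space "gauss n" by (rule prob_space_gauss)
  define r where "r = sqrt n / 2"
  define B where "B = {x. r \<le> norm_Rn n x}"
  \<comment> \<open>Minimises -l t r + l^2 L^2; the minimum is -(t r)^2 / (4 L^2).\<close>
  define l where "l = t * r / (2 * L\<^sup>2)"
  have l: "0 \<le> l" using t L by (simp add: l_def r_def)
  have "Measurable.pred borel (\<lambda>x. r \<le> norm_Rn n x)" by measurable
  then have B [measurable]: "B \<in> sets borel" by (simp add: B_def)
  have "Measurable.pred borel (\<lambda>x. t \<le> F x)" by measurable
  then have [measurable]: "{x. t \<le> F x} \<in> sets borel" by simp
  have F0: "F 0 = 0" using hom[of 0 0] by simp
  have abs: "\<bar>F x\<bar> \<le> L * norm_Rn n x" if "x \<in> Rn n" for x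
    using lip[of x 0] lip[of 0 x] that by (simp add: F0)
  have int: "integrable (gauss n) F"
  proof (rule Bochner_Integration.integrable_bound[of "gauss n" "\<lambda>x. L * norm_Rn n x"])
    show "integrable (gauss n) (\<lambda>x. L * norm_Rn n x)" using integrable_gauss_norm by simp
    show "AE x in gauss n. norm (F x) \<le> norm (L * norm_Rn n x)"
      using AE_gauss_Rn by eventually_elim (use abs L in simp)
  qed measurable
  define c where "c = measure (gauss n) B"
  have c: "1/5 \<le> c" using gauss_norm_lower[OF n] by (simp add: c_def B_def r_def)
  have polar: "(\<integral>\<^sup>+x. indicator B x * indicator {x. t \<le> F x} (normalize_Rn n x) \<partial>gauss n)
      = ennreal c * (\<integral>\<^sup>+x. indicator {x. t \<le> F x} x \<partial>sphere_measure n)"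
  proof (rule nn_integral_gauss_polar[OF n])
    fix w x assume "orthonormal n n w"
    then show "indicator B (comb n w x) = (indicator B x :: ennreal)"
      by (simp add: B_def indicator_def norm_comb_orthonormal)
  qed (use c B in \<open>auto simp: c_def emeasure_eq_measure\<close>)
  have "(\<integral>\<^sup>+x. indicator B x * indicator {x. t \<le> F x} (normalize_Rn n x) \<partial>gauss n)
     \<le> (\<integral>\<^sup>+x. ennreal (exp (- (l * t * r))) * ennreal (exp (l * F x)) \<partial>gauss n)"
  proof (rule nn_integral_mono_AE, use AE_gauss_nonzero[OF n] in eventually_elim)
    case (elim x)
    show ?case
    proof (cases "r \<le> norm_Rn n x \<and> t \<le> F (normalize_Rn n x)")
      case True
      have "norm_Rn n x *\<^sub>R normalize_Rn n x = x" using elim by (simp add: normalize_Rn_def)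
      moreover have "normalize_Rn n x \<in> Rn n" using elim by (simp add: normalize_Rn_def Rn_scaleR)
      ultimately have "F x = norm_Rn n x * F (normalize_Rn n x)"
        using hom[of "normalize_Rn n x" "norm_Rn n x"] by simp
      moreover have "r * t \<le> norm_Rn n x * F (normalize_Rn n x)"
        using True t by (intro mult_mono) (auto simp: r_def)
      ultimately have "l * (r * t) \<le> l * F x" using l by (intro mult_left_mono) auto
      then have "1 \<le> exp (- (l * t * r)) * exp (l * F x)"
        unfolding exp_add[symmetric] by (simp add: mult_ac)
      then show ?thesis using True by (simp add: B_def ennreal_mult[symmetric])
    qed (auto simp: B_def indicator_def)
  qed
  also have "\<dots> = ennreal (exp (- (l * t * r))) * (\<integral>\<^sup>+x. ennreal (exp (l * F x)) \<partial>gauss n)"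
    by (rule nn_integral_cmult) measurable
  also have "\<dots> \<le> ennreal (exp (- (l * t * r))) * ennreal (exp (l\<^sup>2 * L\<^sup>2))"
    by (intro mult_left_mono gauss_exponential_moment lip int mean l) auto
  also have "\<dots> = ennreal (exp (- (t\<^sup>2 * n / (16 * L\<^sup>2))))"
  proof -
    have "- (l * t * r) + l\<^sup>2 * L\<^sup>2 = - (t\<^sup>2 * r\<^sup>2 / (4 * L\<^sup>2))"
      using L by (simp add: l_def field_simps power2_eq_square)
    also have "r\<^sup>2 = n / 4" by (simp add: r_def power_divide)
    finally have "- (l * t * r) + l\<^sup>2 * L\<^sup>2 = - (t\<^sup>2 * n / (16 * L\<^sup>2))" by simp
    then show ?thesis by (simp add: ennreal_mult[symmetric] exp_add[symmetric])
  qed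
  finally have le: "ennreal c * (\<integral>\<^sup>+x. indicator {x. t \<le> F x} x \<partial>sphere_measure n) \<le> ennreal (exp (- (t\<^sup>2 * n / (16 * L\<^sup>2))))"
    unfolding polar .
  have "(\<integral>\<^sup>+x. indicator {x. t \<le> F x} x \<partial>sphere_measure n) \<le> ennreal (5 * c) * (\<integral>\<^sup>+x. indicator {x. t \<le> F x} x \<partial>sphere_measure n)"
    using c mult_right_mono[of 1 "ennreal (5 * c)"] by simp
  also have "\<dots> = ennreal 5 * (ennreal c * (\<integral>\<^sup>+x. indicator {x. t \<le> F x} x \<partial>sphere_measure n))"
    using c by (simp add: ennreal_mult mult.assoc)
  also have "\<dots> \<le> ennreal 5 * ennreal (exp (- (t\<^sup>2 * n / (16 * L\<^sup>2))))"
    by (rule mult_left_mono[OF le]) simp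
  also have "\<dots> = ennreal (5 * exp (- (t\<^sup>2 * n / (16 * L\<^sup>2))))" by (simp add: ennreal_mult)
  finally show ?thesis .
qed

section \<open>Moments of random projections\<close>

text \<open>If \<open>v\<close> is orthonormal, this is the squared length of the projection of
  \<open>x\<close> onto its span.\<close>

definition proj_sq :: "nat \<Rightarrow> nat \<Rightarrow> (nat \<Rightarrow> nat \<Rightarrow> real) \<Rightarrow> (nat \<Rightarrow> real) \<Rightarrow> real" where
  "proj_sq n k v x = (\<Sum>i<k. (inner_Rn n (v i) x)\<^sup>2)"

lemma measurable_vec_coord2 [measurable]: "(\<lambda>v. v i j) \<in> borel_measurable (borel :: (nat \<Rightarrow> nat \<Rightarrow> real) measure)"
  by (rule measurable_vec_coord[OF measurable_product_coordinates])

lemma measurable_proj_sq [measurable]: "(\<lambda>v. proj_sq n k v x) \<in> borel_measurable borel"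
  unfolding proj_sq_def inner_Rn_def by measurable

lemma frames_rotation: "orthonormal n n w \<Longrightarrow> distr (frames n k) borel (\<lambda>v i. comb n w (v i)) = frames n k"
proof (rule measure_eqI)
  assume w: "orthonormal n n w"
  fix A assume "A \<in> sets (distr (frames n k) borel (\<lambda>v i. comb n w (v i)))"
  then have [measurable]: "A \<in> sets borel" by simp
  have "emeasure (distr (frames n k) borel (\<lambda>v i. comb n w (v i))) A = (\<integral>\<^sup>+v. indicator A (\<lambda>i. comb n w (v i)) \<partial>frames n k)"
    by (subst nn_integral_indicator[symmetric], simp, subst nn_integral_distr) measurable
  also have "\<dots> = emeasure (frames n k) A"
    by (subst nn_integral_frames_rotation[OF w]) simp_all
  finally show "emeasure (distr (frames n k) borel (\<lambda>v i. comb n w (v i))) A = emeasure (frames n k) A" .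
qed simp

text \<open>Rotating \<open>x\<close> to \<open>y\<close> amounts to rotating the frame, whose law
  is invariant.\<close>

lemma integral_frames_proj_sq:
  assumes x: "x \<in> unit_sphere n" and y: "y \<in> unit_sphere n"
  shows "(\<integral>v. proj_sq n k v x ^ m \<partial>frames n k) = (\<integral>v. proj_sq n k v y ^ m \<partial>frames n k)"
proof -
  obtain T where T: "T \<in> orthogonal_maps n" "T x = y" using orthogonal_maps_transitive_sphere[OF x y] by auto
  let ?w = "\<lambda>i. T (unit_vec i)"
  have w: "orthonormal n n ?w" by (rule orthogonal_maps_orthonormal[OF T(1) orthonormal_unit_vec]) simp
  have y: "y = comb n ?w x" using orthogonal_map_eq_comb[OF T(1)] x T(2) by (auto simp: unit_sphere_def)
  have "(\<integral>v. proj_sq n k v y ^ m \<partial>frames n k) = (\<integral>v. proj_sq n k v y ^ m \<partial>distr (frames n k) borel (\<lambda>v i. comb n ?w (v i)))"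
    by (simp add: frames_rotation[OF w])
  also have "\<dots> = (\<integral>v. proj_sq n k (\<lambda>i. comb n ?w (v i)) y ^ m \<partial>frames n k)"
    by (rule integral_distr) measurable
  also have "\<dots> = (\<integral>v. proj_sq n k v x ^ m \<partial>frames n k)"
    by (simp add: proj_sq_def y inner_comb_orthonormal(2)[OF w])
  finally show ?thesis ..
qed

text \<open>Let P be the projection matrix, with entries \<open>p v j l\<close>. Its trace is k, so
  invariance gives the first moment. For the second, every unit vector has the same value a2;
  testing on e_j and on (e_j + e_l) / sqrt 2 and (e_j - e_l) / sqrt 2 determines E (P_jj P_ll + 2
  P_jl^2). Summing over j and l yields n (n + 2) a2 = E ((tr P)^2 + 2 |P|^2) = k^2 + 2 k, where
  |P|^2 = k is the sum of the squared entries.\<close>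

lemma proj_sq_moments:
  assumes n: "1 \<le> n" and k: "k \<le> n" and u: "u \<in> unit_sphere n"
  shows "(\<integral>v. proj_sq n k v u \<partial>frames n k) = k / n"
    and "(\<integral>v. (proj_sq n k v u)\<^sup>2 \<partial>frames n k) = real k * (real k + 2) / (real n * (real n + 2))"
proof -
  interpret prob_space "frames n k" by (rule prob_space_frames)
  define p where "p v j l = (\<Sum>i<k. v i j * v i l)" for v :: "nat \<Rightarrow> nat \<Rightarrow> real" and j l
  have [measurable]: "(\<lambda>v. p v j l) \<in> borel_measurable borel" for j l
    unfolding p_def by measurable
  have on: "AE v in frames n k. orthonormal n k v" by (rule AE_frames_orthonormal[OF k])
  have p1: "\<bar>p v j l\<bar> \<le> real k" if v: "orthonormal n k v" and "j < n" "l < n" for v j l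
  proof -
    have "\<bar>v i j * v i l\<bar> \<le> 1" if "i < k" for i
      using abs_coord_le_norm_Rn[of j n "v i"] abs_coord_le_norm_Rn[of l n "v i"] orthonormalD(2)[OF v that] \<open>j < n\<close> \<open>l < n\<close>
      by (simp add: abs_mult mult_le_one)
    then have "\<bar>p v j l\<bar> \<le> (\<Sum>i<k. 1)"
      unfolding p_def by (intro order_trans[OF sum_abs sum_mono]) auto
    then show ?thesis by simp
  qed
  have int: "integrable (frames n k) (\<lambda>v. p v j l)" if "j < n" "l < n" for j l
    by (rule integrable_const_bound[of _ "real k"])
       (use on p1[OF _ that] in \<open>auto elim: eventually_mono\<close>)
  have int2: "integrable (frames n k) (\<lambda>v. p v j l * p v i m)" if "j < n" "l < n" "i < n" "m < n" for j l i m
    by (rule integrable_const_bound[of _ "real k * real k"])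
       (use on p1[OF _ that(1,2)] p1[OF _ that(3,4)] in \<open>auto elim!: eventually_mono simp: abs_mult intro!: mult_mono\<close>)
  have pe: "proj_sq n k v (unit_vec j) = p v j j" if "j < n" for v j
    using that by (simp add: proj_sq_def p_def inner_unit_vec power2_eq_square)
  have e: "unit_vec j \<in> unit_sphere n" if "j < n" for j
    using orthonormalD[OF orthonormal_unit_vec[of n n] that] by (simp add: unit_sphere_def)
  define a1 where "a1 = (\<integral>v. proj_sq n k v u \<partial>frames n k)"
  define a2 where "a2 = (\<integral>v. (proj_sq n k v u)\<^sup>2 \<partial>frames n k)"
  have E1: "(\<integral>v. p v j j \<partial>frames n k) = a1" if "j < n" for j
    using integral_frames_proj_sq[OF e[OF that] u, where m=1 and k=k] by (simp add: pe[OF that] a1_def)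
  have E2: "(\<integral>v. p v j j * p v j j \<partial>frames n k) = a2" if "j < n" for j
    using integral_frames_proj_sq[OF e[OF that] u, where m=2 and k=k] by (simp add: pe[OF that] a2_def power2_eq_square)
  have tr: "(\<Sum>j<n. p v j j) = k" if v: "orthonormal n k v" for v
  proof -
    have "(\<Sum>j<n. p v j j) = (\<Sum>i<k. inner_Rn n (v i) (v i))"
      unfolding p_def inner_Rn_def by (rule sum.swap)
    also have "\<dots> = (\<Sum>i<k. 1)" using orthonormalD(3)[OF v] by (intro sum.cong) auto
    finally show ?thesis by simp
  qed
  have hs: "(\<Sum>j<n. \<Sum>l<n. p v j l * p v j l) = k" if v: "orthonormal n k v" for v
  proof -
    have "(\<Sum>j<n. \<Sum>l<n. p v j l * p v j l) = (\<Sum>j<n. \<Sum>l<n. \<Sum>i<k. \<Sum>m<k. (v i j * v m j) * (v i l * v m l))"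
      unfolding p_def sum_product by (simp add: mult_ac)
    also have "\<dots> = (\<Sum>i<k. \<Sum>m<k. \<Sum>j<n. \<Sum>l<n. (v i j * v m j) * (v i l * v m l))"
      by (simp only: sum.swap[of _ "{..<k}" "{..<n}"])
    also have "\<dots> = (\<Sum>i<k. \<Sum>m<k. inner_Rn n (v i) (v m) * inner_Rn n (v i) (v m))"
      unfolding inner_Rn_def sum_product ..
    also have "\<dots> = (\<Sum>i<k. \<Sum>m<k. if i = m then 1 else 0)"
      using orthonormalD(3)[OF v] by (intro sum.cong) auto
    also have "\<dots> = k" by simp
    finally show ?thesis .
  qed
  have "real n * a1 = (\<Sum>j<n. \<integral>v. p v j j \<partial>frames n k)" using E1 by simp
  also have "\<dots> = (\<integral>v. (\<Sum>j<n. p v j j) \<partial>frames n k)"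
    by (rule Bochner_Integration.integral_sum[symmetric]) (use int in auto)
  also have "\<dots> = (\<integral>v. real k \<partial>frames n k)"
    by (rule integral_cong_AE) (use on tr in \<open>auto elim: eventually_mono\<close>)
  also have "\<dots> = k" using prob_space by simp
  finally show "a1 = k / n" using n by (simp add: field_simps)
  \<comment> \<open>The diagonal value 3 comes from P_jj^2 + 2 P_jj^2; it makes every row sum equal
    to (n + 2) a2.\<close>
  have cross: "(\<integral>v. p v j j * p v l l + 2 * (p v j l * p v j l) \<partial>frames n k) = (if j = l then 3 else 1) * a2"
    if jl: "j < n" "l < n" for j l
  proof (cases "j = l")
    case True
    have "(\<integral>v. p v j j * p v j j + 2 * (p v j j * p v j j) \<partial>frames n k) = (\<integral>v. 3 * (p v j j * p v j j) \<partial>frames n k)"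
      by (intro Bochner_Integration.integral_cong) auto
    then show ?thesis using True E2[OF jl(1)] by simp
  next
    case False
    define x where "x s = unit_vec j + s *\<^sub>R unit_vec l" for s :: real
    have in_x: "inner_Rn n (v i) (x s) = v i j + s * v i l" for v :: "nat \<Rightarrow> nat \<Rightarrow> real" and i s
      using jl by (simp add: x_def inner_Rn_simps inner_unit_vec)
    have q: "proj_sq n k v (x s) = p v j j + 2 * s * p v j l + s\<^sup>2 * p v l l" for v s
      unfolding proj_sq_def in_x p_def sum_distrib_left sum.distrib[symmetric]
      by (intro sum.cong) (simp_all add: power2_eq_square algebra_simps)
    have Ex: "(\<integral>v. (proj_sq n k v (x s))\<^sup>2 \<partial>frames n k) = 4 * a2" if s: "s\<^sup>2 = 1" for s
    proof -
      let ?y = "(1 / sqrt 2) *\<^sub>R x s"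
      have xs: "x s \<in> Rn n" using e[OF jl(1)] e[OF jl(2)]
        unfolding x_def by (intro Rn_add Rn_scaleR) (auto simp: unit_sphere_def)
      have "inner_Rn n (unit_vec j) (x s) = 1" "inner_Rn n (unit_vec l) (x s) = s"
        using jl False unfolding x_def inner_Rn_simps by (auto simp: inner_unit_vec) (auto simp: unit_vec_def)
      then have "inner_Rn n (x s) (x s) = 1 + s\<^sup>2"
        by (subst (1) x_def) (simp add: inner_Rn_simps power2_eq_square)
      then have "norm_Rn n ?y = 1" using s by (simp add: norm_Rn_eq_sqrt_inner inner_Rn_simps)
      then have y: "?y \<in> unit_sphere n" using xs by (simp add: unit_sphere_def Rn_scaleR del: norm_Rn_scaleR)
      have "proj_sq n k v (x s) = 2 * proj_sq n k v ?y" for v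
        by (simp add: proj_sq_def inner_Rn_scaleR_right power_divide sum_divide_distrib[symmetric])
      then have "(\<integral>v. (proj_sq n k v (x s))\<^sup>2 \<partial>frames n k) = (\<integral>v. 4 * (proj_sq n k v ?y)\<^sup>2 \<partial>frames n k)"
        by (simp add: power_mult_distrib)
      also have "\<dots> = 4 * a2" using integral_frames_proj_sq[OF y u, where m=2 and k=k] by (simp add: a2_def)
      finally show ?thesis .
    qed
    have ints: "integrable (frames n k) (\<lambda>v. (proj_sq n k v (x s))\<^sup>2)" for s
    proof -
      have eq: "(proj_sq n k v (x s))\<^sup>2 = p v j j * p v j j + (4 * s\<^sup>2) * (p v j l * p v j l) + (s\<^sup>2)\<^sup>2 * (p v l l * p v l l)
        + (4 * s) * (p v j j * p v j l) + (2 * s\<^sup>2) * (p v j j * p v l l) + (4 * s ^ 3) * (p v j l * p v l l)" for v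
        unfolding q by (simp add: power2_eq_square power3_eq_cube algebra_simps)
      show ?thesis unfolding eq using jl
        by (intro Bochner_Integration.integrable_add integrable_mult_right int2)
    qed
    \<comment> \<open>Adding the cases s = 1 and s = -1 cancels the mixed terms P_jj P_jl and P_jl
      P_ll, whose means are not known.\<close>
    have "8 * a2 = (\<integral>v. (proj_sq n k v (x 1))\<^sup>2 \<partial>frames n k) + (\<integral>v. (proj_sq n k v (x (-1)))\<^sup>2 \<partial>frames n k)"
      by (simp add: Ex)
    also have "\<dots> = (\<integral>v. (proj_sq n k v (x 1))\<^sup>2 + (proj_sq n k v (x (-1)))\<^sup>2 \<partial>frames n k)"
      by (rule Bochner_Integration.integral_add[symmetric, OF ints ints])
    also have "\<dots> = (\<integral>v. 2 * (p v j j * p v j j) + 2 * (p v l l * p v l l) + 4 * (p v j j * p v l l + 2 * (p v j l * p v j l)) \<partial>frames n k)"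
      unfolding q by (intro Bochner_Integration.integral_cong) (auto simp: power2_eq_square algebra_simps)
    also have "\<dots> = 2 * a2 + 2 * a2 + 4 * (\<integral>v. p v j j * p v l l + 2 * (p v j l * p v j l) \<partial>frames n k)"
      using jl int2 by (simp add: E2)
    finally show ?thesis using False by simp
  qed
  have "real n * (real n + 2) * a2 = (\<Sum>j<n. \<Sum>l<n. (if j = l then 3 else 1) * a2)"
  proof -
    have "(\<Sum>l<n. (if j = l then 3 else 1) * a2) = (real n + 2) * a2" if "j < n" for j
    proof -
      have "(\<Sum>l<n. (if j = l then 3 else 1) * a2) = (\<Sum>l<n. a2 + (if j = l then 2 * a2 else 0))"
        by (intro sum.cong) auto
      then show ?thesis using that by (simp add: sum.distrib algebra_simps)
    qed
    then show ?thesis by simp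
  qed
  also have "\<dots> = (\<Sum>j<n. \<Sum>l<n. \<integral>v. p v j j * p v l l + 2 * (p v j l * p v j l) \<partial>frames n k)"
    by (intro sum.cong refl) (simp add: cross)
  also have "\<dots> = (\<integral>v. (\<Sum>j<n. \<Sum>l<n. p v j j * p v l l + 2 * (p v j l * p v j l)) \<partial>frames n k)"
  proof -
    have i: "integrable (frames n k) (\<lambda>v. p v j j * p v l l + 2 * (p v j l * p v j l))" if "j < n" "l < n" for j l
      using that by (intro Bochner_Integration.integrable_add integrable_mult_right int2)
    have "(\<Sum>j<n. \<Sum>l<n. \<integral>v. p v j j * p v l l + 2 * (p v j l * p v j l) \<partial>frames n k)
       = (\<Sum>j<n. \<integral>v. (\<Sum>l<n. p v j j * p v l l + 2 * (p v j l * p v j l)) \<partial>frames n k)"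
      using i by (intro sum.cong refl Bochner_Integration.integral_sum[symmetric]) auto
    also have "\<dots> = (\<integral>v. (\<Sum>j<n. \<Sum>l<n. p v j j * p v l l + 2 * (p v j l * p v j l)) \<partial>frames n k)"
      using i by (intro Bochner_Integration.integral_sum[symmetric] Bochner_Integration.integrable_sum) auto
    finally show ?thesis .
  qed
  also have "\<dots> = (\<integral>v. real k * (real k + 2) \<partial>frames n k)"
  proof (rule integral_cong_AE)
    show "AE v in frames n k. (\<Sum>j<n. \<Sum>l<n. p v j j * p v l l + 2 * (p v j l * p v j l)) = real k * (real k + 2)"
      using on
    proof eventually_elim
      case (elim v)
      have "(\<Sum>j<n. \<Sum>l<n. p v j j * p v l l + 2 * (p v j l * p v j l))
        = (\<Sum>j<n. p v j j) * (\<Sum>l<n. p v l l) + 2 * (\<Sum>j<n. \<Sum>l<n. p v j l * p v j l)"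
        unfolding sum_product sum_distrib_left[of "2::real"] sum.distrib ..
      then show ?case by (simp add: tr[OF elim] hs[OF elim] algebra_simps)
    qed
  qed measurable
  also have "\<dots> = real k * (real k + 2)" using prob_space by simp
  finally have "real n * (real n + 2) * a2 = real k * (real k + 2)" .
  moreover have "0 < real n * real n + real n * 2" using n by (intro add_pos_pos) auto
  ultimately show "a2 = real k * (real k + 2) / (real n * (real n + 2))"
    by (subst nonzero_eq_divide_eq) (simp_all add: algebra_simps)
qed

section \<open>The Grassmannian\<close>

lemma Grassmannian_0: "F \<in> Grassmannian n k \<Longrightarrow> 0 \<in> F"
  by (simp add: Grassmannian_def subspace_0)

lemma Grassmannian_Rn: "F \<in> Grassmannian n k \<Longrightarrow> x \<in> F \<Longrightarrow> x \<in> Rn n"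
  by (auto simp: Grassmannian_def)

lemma Grassmannian_scale: "F \<in> Grassmannian n k \<Longrightarrow> x \<in> F \<Longrightarrow> c *\<^sub>R x \<in> F"
  by (auto simp: Grassmannian_def subspace_scale)

lemma bdd_below_norm: "bdd_below ((\<lambda>y. norm_Rn n (x - y)) ` S)"
  by (rule bdd_belowI[of _ 0]) auto

lemma ball_excess_le:
  assumes E: "E \<in> Grassmannian n k"
    and le: "\<And>x. x \<in> E \<Longrightarrow> norm_Rn n x \<le> 1 \<Longrightarrow> \<exists>y\<in>F. norm_Rn n y \<le> 1 \<and> norm_Rn n (x - y) \<le> c"
  shows "ball_excess n E F \<le> c"
  unfolding ball_excess_def
proof (rule cSUP_least)
  show "{x \<in> E. norm_Rn n x \<le> 1} \<noteq> {}" using Grassmannian_0[OF E] by force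
  fix x assume "x \<in> {x \<in> E. norm_Rn n x \<le> 1}"
  then obtain y where "y \<in> {y \<in> F. norm_Rn n y \<le> 1}" "norm_Rn n (x - y) \<le> c" using le by auto
  then show "(INF y\<in>{y \<in> F. norm_Rn n y \<le> 1}. norm_Rn n (x - y)) \<le> c"
    by (rule cINF_lower2[OF bdd_below_norm])
qed

text \<open>The supremum and infimum in \<open>ball_excess\<close> are handled through this
  approximation: 0 lies in the unit ball of \<open>F\<close>, so each infimum is at most 1 and the
  supremum is taken over a bounded set.\<close>

lemma ball_excess_approx:
  assumes F: "F \<in> Grassmannian n k" and x: "x \<in> E" "norm_Rn n x \<le> 1" and e: "0 < e"
  shows "\<exists>y\<in>F. norm_Rn n y \<le> 1 \<and> norm_Rn n (x - y) < ball_excess n E F + e"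
proof -
  let ?B = "{y \<in> F. norm_Rn n y \<le> 1}"
  have ne: "0 \<in> ?B" using Grassmannian_0[OF F] by simp
  have "bdd_above ((\<lambda>x. INF y\<in>?B. norm_Rn n (x - y)) ` {x \<in> E. norm_Rn n x \<le> 1})"
  proof (rule bdd_aboveI2)
    fix z assume "z \<in> {x \<in> E. norm_Rn n x \<le> 1}"
    then show "(INF y\<in>?B. norm_Rn n (z - y)) \<le> 1"
      by (intro cINF_lower2[OF bdd_below_norm ne]) simp
  qed
  then have "(INF y\<in>?B. norm_Rn n (x - y)) \<le> ball_excess n E F"
    unfolding ball_excess_def using x by (intro cSUP_upper) auto
  then have "(INF y\<in>?B. norm_Rn n (x - y)) < ball_excess n E F + e" using e by simp
  then show ?thesis using ne by (subst (asm) cINF_less_iff[OF _ bdd_below_norm]) auto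
qed

lemma ball_excess_nonneg:
  assumes "E \<in> Grassmannian n k" "F \<in> Grassmannian n k"
  shows "0 \<le> ball_excess n E F"
proof (rule ccontr)
  assume "\<not> ?thesis"
  then obtain y where "norm_Rn n (0 - y) < ball_excess n E F + - ball_excess n E F"
    using ball_excess_approx[OF assms(2) Grassmannian_0[OF assms(1)], of "- ball_excess n E F"] by auto
  then show False using norm_Rn_nonneg[of n "0 - y"] by linarith
qed

lemma Grassmannian_dist_eq:
  assumes "E \<in> Grassmannian n k" "F \<in> Grassmannian n k"
  shows "Grassmannian_dist n E F = max (ball_excess n E F) (ball_excess n F E)"
  using ball_excess_nonneg[OF assms] by (simp add: Grassmannian_dist_def max_def)

text \<open>For a unit vector z of \<open>E\<close>, the remainder r with respect to
  \<open>F\<close> satisfies |r|^2 = inner product of r and z - y for every y in \<open>F\<close>,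
  so |r| is at most the distance of z to each y, and hence 0.\<close>

lemma ball_excess_0_subset:
  assumes E: "E \<in> Grassmannian n k" and F: "F \<in> Grassmannian n k" and k: "1 \<le> k"
    and le: "ball_excess n E F \<le> 0"
  shows "E \<subseteq> F"
proof
  fix x assume x: "x \<in> E"
  obtain v where v: "orthonormal n k v" "F = span (v ` {..<k})"
    using orthonormal_basis_exists[OF F k] by blast
  show "x \<in> F"
  proof (cases "x = 0")
    case True
    then show ?thesis using Grassmannian_0[OF F] by simp
  next
    case False
    then have nx: "norm_Rn n x \<noteq> 0" using Grassmannian_Rn[OF E x] by (simp add: norm_Rn_eq_0)
    let ?z = "normalize_Rn n x"
    have z: "?z \<in> E" "norm_Rn n ?z \<le> 1" "?z \<in> Rn n"
      using Grassmannian_scale[OF E x] nx Grassmannian_Rn[OF E] norm_normalize_Rn[OF nx] by (auto simp: normalize_Rn_def)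
    have "norm_Rn n (resid n k v ?z) \<le> 0"
    proof (rule field_le_epsilon)
      fix e :: real assume "0 < e"
      then obtain y where y: "y \<in> F" "norm_Rn n (?z - y) < ball_excess n E F + e"
        using ball_excess_approx[OF F z(1,2)] by blast
      let ?r = "resid n k v ?z"
      have orth: "inner_Rn n ?r (comb k v a) = 0" for a
        unfolding inner_comb_right using inner_resid[OF v(1)] by simp
      have ycomb: "y = comb k v (\<lambda>i. inner_Rn n y (v i))"
        using span_orthonormal_comb[OF v(1)] y(1) v(2) by blast
      have "inner_Rn n ?r y = 0" by (subst ycomb) (rule orth)
      moreover have "inner_Rn n ?r ?r = inner_Rn n ?r ?z - inner_Rn n ?r (comb k v (\<lambda>i. inner_Rn n ?z (v i)))"
        by (subst (2) resid_def) (rule inner_Rn_diff_right)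
      ultimately have "(norm_Rn n ?r)\<^sup>2 = inner_Rn n ?r (?z - y)"
        unfolding inner_Rn_self[symmetric] inner_Rn_diff_right orth by simp
      also have "\<dots> \<le> norm_Rn n ?r * norm_Rn n (?z - y)"
        using inner_Rn_Cauchy_Schwarz[of n ?r "?z - y"] by linarith
      finally have sq: "norm_Rn n ?r * norm_Rn n ?r \<le> norm_Rn n ?r * norm_Rn n (?z - y)"
        by (simp only: power2_eq_square)
      have "norm_Rn n ?r \<le> norm_Rn n (?z - y)"
      proof (rule ccontr)
        assume "\<not> ?thesis"
        then have lt: "norm_Rn n (?z - y) < norm_Rn n ?r" by simp
        then have "0 < norm_Rn n ?r" using norm_Rn_nonneg by (rule le_less_trans[rotated])
        then show False using sq lt by (simp only: mult_le_cancel_left_pos)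
      qed
      then show "norm_Rn n ?r \<le> 0 + e" using y(2) le by linarith
    qed
    then have "resid n k v ?z = 0"
      using norm_Rn_eq_0[OF resid_in_Rn[OF v(1) z(3)]] norm_Rn_nonneg by (metis order_antisym)
    then have "?z \<in> F" using resid_eq_0_span v(2) by simp
    then have "norm_Rn n x *\<^sub>R ?z \<in> F" by (rule Grassmannian_scale[OF F])
    then show ?thesis using nx by (simp add: normalize_Rn_def)
  qed
qed

lemma ball_excess_triangle:
  assumes E: "E \<in> Grassmannian n k" and F: "F \<in> Grassmannian n k" and G: "G \<in> Grassmannian n k"
  shows "ball_excess n E G \<le> ball_excess n E F + ball_excess n F G"
proof (rule field_le_epsilon)
  fix e :: real assume e: "0 < e"
  show "ball_excess n E G \<le> ball_excess n E F + ball_excess n F G + e"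
  proof (rule ball_excess_le[OF E])
    fix x assume x: "x \<in> E" "norm_Rn n x \<le> 1"
    obtain y where y: "y \<in> F" "norm_Rn n y \<le> 1" "norm_Rn n (x - y) < ball_excess n E F + e/2"
      using ball_excess_approx[OF F x, of "e/2"] e by auto
    obtain z where z: "z \<in> G" "norm_Rn n z \<le> 1" "norm_Rn n (y - z) < ball_excess n F G + e/2"
      using ball_excess_approx[OF G y(1,2), of "e/2"] e by auto
    show "\<exists>z\<in>G. norm_Rn n z \<le> 1 \<and> norm_Rn n (x - z) \<le> ball_excess n E F + ball_excess n F G + e"
      using z y norm_Rn_triangle_diff[of n x z y] by (intro bexI[of _ z]) auto
  qed
qed

lemma ball_excess_self: "E \<in> Grassmannian n k \<Longrightarrow> ball_excess n E E \<le> 0"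
  by (rule ball_excess_le) (auto intro: bexI)

lemma Metric_space_Grassmannian:
  assumes k: "1 \<le> k"
  shows "Metric_space (Grassmannian n k) (Grassmannian_dist n)"
proof
  fix E F G
  show "0 \<le> Grassmannian_dist n E F" by (simp add: Grassmannian_dist_def)
  show "Grassmannian_dist n E F = Grassmannian_dist n F E" by (simp add: Grassmannian_dist_def max.commute)
  assume E: "E \<in> Grassmannian n k" and F: "F \<in> Grassmannian n k"
  show "Grassmannian_dist n E F = 0 \<longleftrightarrow> E = F"
  proof
    assume "Grassmannian_dist n E F = 0"
    then have "ball_excess n E F \<le> 0" "ball_excess n F E \<le> 0"
      by (auto simp: Grassmannian_dist_eq[OF E F] max_def split: if_splits)
    then show "E = F" using ball_excess_0_subset[OF E F k] ball_excess_0_subset[OF F E k] by blast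
  next
    assume "E = F"
    then show "Grassmannian_dist n E F = 0" using ball_excess_self[OF E] by (simp add: Grassmannian_dist_def)
  qed
  assume G: "G \<in> Grassmannian n k"
  show "Grassmannian_dist n E G \<le> Grassmannian_dist n E F + Grassmannian_dist n F G"
    using ball_excess_triangle[OF E F G] ball_excess_triangle[OF G F E]
    by (simp add: Grassmannian_dist_eq[OF E F] Grassmannian_dist_eq[OF F G] Grassmannian_dist_eq[OF E G])
      linarith
qed

lemma ball_excess_image:
  assumes T: "T \<in> orthogonal_maps n" and E: "E \<subseteq> Rn n" and F: "F \<subseteq> Rn n"
  shows "ball_excess n (T ` E) (T ` F) = ball_excess n E F"
proof -
  have B: "{x \<in> T ` E. norm_Rn n x \<le> 1} = T ` {x \<in> E. norm_Rn n x \<le> 1}" if "E \<subseteq> Rn n" for E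
    using that by (auto simp: orthogonal_mapsD(4)[OF T] subset_iff)
  have "(INF y\<in>{y \<in> F. norm_Rn n y \<le> 1}. norm_Rn n (T x - T y)) = (INF y\<in>{y \<in> F. norm_Rn n y \<le> 1}. norm_Rn n (x - y))"
    if "x \<in> E" for x
    using that E F by (intro INF_cong refl) (auto intro!: orthogonal_mapsD(5)[OF T])
  then show ?thesis
    unfolding ball_excess_def B[OF E] B[OF F] image_image by (intro SUP_cong refl) auto
qed

lemma Grassmannian_dist_image:
  "T \<in> orthogonal_maps n \<Longrightarrow> E \<in> Grassmannian n k \<Longrightarrow> F \<in> Grassmannian n k \<Longrightarrow>
    Grassmannian_dist n (T ` E) (T ` F) = Grassmannian_dist n E F"
  unfolding Grassmannian_dist_def by (auto simp: ball_excess_image Grassmannian_def)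

lemma image_span_frame: "linear T \<Longrightarrow> T ` span (v ` {..<k}) = span ((\<lambda>i. T (v i)) ` {..<k})"
  by (simp add: linear_span_image[symmetric] image_image)

lemma Grassmannian_image:
  assumes T: "T \<in> orthogonal_maps n" and F: "F \<in> Grassmannian n k" and k: "1 \<le> k"
  shows "T ` F \<in> Grassmannian n k"
proof -
  obtain v where v: "orthonormal n k v" "F = span (v ` {..<k})"
    using orthonormal_basis_exists[OF F k] by blast
  then show ?thesis
    using span_orthonormal_Grassmannian[OF orthogonal_maps_orthonormal[OF T v(1)]]
    by (simp add: image_span_frame[OF orthogonal_mapsD(1)[OF T]])
qed

lemma Grassmannian_transitive:
  assumes E: "E \<in> Grassmannian n k" and F: "F \<in> Grassmannian n k" and k: "1 \<le> k"
  shows "\<exists>T\<in>orthogonal_maps n. T ` E = F"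
proof -
  obtain u where u: "orthonormal n k u" "E = span (u ` {..<k})"
    using orthonormal_basis_exists[OF E k] by blast
  obtain v where v: "orthonormal n k v" "F = span (v ` {..<k})"
    using orthonormal_basis_exists[OF F k] by blast
  obtain T where T: "T \<in> orthogonal_maps n" "\<forall>i<k. T (u i) = v i"
    using orthogonal_maps_transitive[OF u(1) v(1)] by blast
  have "(\<lambda>i. T (u i)) ` {..<k} = v ` {..<k}" using T(2) by (intro image_cong) auto
  then have "T ` E = F" unfolding u(2) v(2) image_span_frame[OF orthogonal_mapsD(1)[OF T(1)]] by simp
  then show ?thesis using T(1) by blast
qed

section \<open>Random subspaces as spans of random frames\<close>

lemma norm_comb_le: "norm_Rn n (comb k v a) \<le> (\<Sum>i<k. \<bar>a i\<bar> * norm_Rn n (v i))"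
proof (induction k)
  case 0
  show ?case by (simp add: comb_def norm_Rn_sqrt)
next
  case (Suc k)
  have "norm_Rn n (comb (Suc k) v a) \<le> norm_Rn n (comb k v a) + norm_Rn n (a k *\<^sub>R v k)"
    unfolding comb_Suc by (rule norm_Rn_triangle)
  then show ?case using Suc by simp
qed

text \<open>Taking the same coefficients in both frames preserves the norm and moves a point of the
  unit ball by at most the sum, since each coefficient is at most 1 in absolute value.\<close>

lemma ball_excess_span_le:
  assumes v: "orthonormal n k v" and w: "orthonormal n k w"
  shows "ball_excess n (span (v ` {..<k})) (span (w ` {..<k})) \<le> (\<Sum>i<k. norm_Rn n (v i - w i))"
proof (rule ball_excess_le[OF span_orthonormal_Grassmannian[OF v]])
  fix x assume x: "x \<in> span (v ` {..<k})" "norm_Rn n x \<le> 1"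
  define a where "a = (\<lambda>i. inner_Rn n x (v i))"
  have xa: "x = comb k v a" unfolding a_def by (rule span_orthonormal_comb[OF v x(1)])
  then have a: "norm_Rn k a \<le> 1" using x(2) norm_comb_orthonormal[OF v] by simp
  have "norm_Rn n (x - comb k w a) \<le> (\<Sum>i<k. \<bar>a i\<bar> * norm_Rn n (v i - w i))"
    unfolding xa comb_diff_frame[symmetric] by (rule norm_comb_le)
  also have "\<dots> \<le> (\<Sum>i<k. 1 * norm_Rn n (v i - w i))"
    using abs_coord_le_norm_Rn[of _ k a] a by (intro sum_mono mult_right_mono) (auto intro: order_trans)
  finally show "\<exists>y\<in>span (w ` {..<k}). norm_Rn n y \<le> 1 \<and> norm_Rn n (x - y) \<le> (\<Sum>i<k. norm_Rn n (v i - w i))"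
    using a by (intro bexI[OF _ comb_in_span]) (auto simp: norm_comb_orthonormal[OF w])
qed

lemma Grassmannian_dist_span_le:
  assumes v: "orthonormal n k v" and w: "orthonormal n k w"
  shows "Grassmannian_dist n (span (v ` {..<k})) (span (w ` {..<k})) \<le> (\<Sum>i<k. norm_Rn n (v i - w i))"
proof -
  have "(\<Sum>i<k. norm_Rn n (w i - v i)) = (\<Sum>i<k. norm_Rn n (v i - w i))"
    by (intro sum.cong refl norm_Rn_minus_commute)
  then show ?thesis
    using ball_excess_span_le[OF v w] ball_excess_span_le[OF w v]
      Grassmannian_dist_eq[OF span_orthonormal_Grassmannian[OF v] span_orthonormal_Grassmannian[OF w]] by simp
qed

text \<open>The default outside the orthonormal families is a fixed element of the Grassmannian for
  k \<le> n. It makes the map total: the exceptional set is null but still has to be sent into the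
  space.\<close>

definition frame_span :: "nat \<Rightarrow> nat \<Rightarrow> (nat \<Rightarrow> nat \<Rightarrow> real) \<Rightarrow> (nat \<Rightarrow> real) set" where
  "frame_span n k v = (if orthonormal n k v then span (v ` {..<k}) else span (unit_vec ` {..<k}))"

lemma open_frame_ball: "open {w. (\<Sum>i<k. norm_Rn n (v i - w i)) < r}"
  by (intro open_Collect_less continuous_on_sum continuous_norm_Rn continuous_vec_diff
      continuous_on_const continuous_on_product_coordinates)

text \<open>The span commutes with orthogonal maps and depends on the frame in a Lipschitz way. The
  first fact makes its law invariant; the second gives measurability and carries a countable dense
  set of frames to one of subspaces.\<close>

lemma Grassmannian_measure_frames:
  assumes k: "1 \<le> k" "k \<le> n"
  shows "frame_span n k \<in> measurable (frames n k) (borel_of (Grassmannian_topology n k))"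
    and "Grassmannian_measure n k = distr (frames n k) (borel_of (Grassmannian_topology n k)) (frame_span n k)"
proof -
  interpret Metric_space "Grassmannian n k" "Grassmannian_dist n" by (rule Metric_space_Grassmannian[OF k(1)])
  interpret fr: prob_space "frames n k" by (rule prob_space_frames)
  have top: "Grassmannian_topology n k = mtopology" by (simp add: Grassmannian_topology_def)
  let ?B = "borel_of mtopology" and ?s = "frame_span n k"
  have in_G: "?s v \<in> Grassmannian n k" for v
    using k by (simp add: frame_span_def span_orthonormal_Grassmannian orthonormal_unit_vec)
  have m: "?s \<in> measurable (frames n k) ?B"
  proof (rule measurable_borel_ofI)
    fix U assume U: "openin mtopology U"
    have "openin (top_of_set {v. orthonormal n k v}) {v. orthonormal n k v \<and> ?s v \<in> U}"
    proof (subst openin_subopen, safe)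
      fix v assume v: "orthonormal n k v" "?s v \<in> U"
      then obtain r where r: "0 < r" "mball (?s v) r \<subseteq> U" using U unfolding openin_mtopology by blast
      let ?W = "{v. orthonormal n k v} \<inter> {w. (\<Sum>i<k. norm_Rn n (v i - w i)) < r}"
      have "openin (top_of_set {v. orthonormal n k v}) ?W"
        by (rule openin_open_Int[OF open_frame_ball])
      moreover have "v \<in> ?W" using v r by simp
      moreover have "?W \<subseteq> {v. orthonormal n k v \<and> ?s v \<in> U}"
      proof safe
        fix w assume w: "orthonormal n k w" "(\<Sum>i<k. norm_Rn n (v i - w i)) < r"
        have "?s w \<in> mball (?s v) r"
          using Grassmannian_dist_span_le[OF v(1) w(1)] w in_G[of v] in_G[of w] v(1) by (simp add: frame_span_def)
        then show "?s w \<in> U" using r by auto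
      qed
      ultimately show "\<exists>T. openin (top_of_set {v. orthonormal n k v}) T \<and> v \<in> T \<and> T \<subseteq> {v. orthonormal n k v \<and> ?s v \<in> U}"
        by blast
    qed
    then obtain T where T: "open T" "{v. orthonormal n k v \<and> ?s v \<in> U} = {v. orthonormal n k v} \<inter> T"
      unfolding openin_open by auto
    \<comment> \<open>Openness holds only relative to the orthonormal frames. On their complement
      the map is constant, which contributes all of the complement or nothing.\<close>
    have "?s -` U = ({v. orthonormal n k v} \<inter> T) \<union> (if span (unit_vec ` {..<k}) \<in> U then - {v. orthonormal n k v} else {})"
      unfolding T(2)[symmetric] by (auto simp: frame_span_def split: if_splits)
    moreover have "{v. orthonormal n k v} \<inter> T \<in> sets borel" using T(1) by (intro sets.Int sets_orthonormal) auto
    moreover have "- {v. orthonormal n k v} \<in> sets borel" by (intro borel_comp sets_orthonormal)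
    ultimately show "?s -` U \<inter> space (frames n k) \<in> sets (frames n k)" by auto
  qed (simp add: in_G)
  then show "?s \<in> measurable (frames n k) (borel_of (Grassmannian_topology n k))" by (simp add: top)
  let ?\<mu> = "distr (frames n k) ?B ?s"
  obtain T where T: "countable T" "T \<subseteq> {v. orthonormal n k v}" "\<And>U. open U \<Longrightarrow> U \<inter> {v. orthonormal n k v} \<noteq> {} \<Longrightarrow> U \<inter> T \<noteq> {}"
    using countable_dense_subset[of "{v. orthonormal n k v}"] by blast
  have "countably_dense (?s ` T)"
    unfolding countably_dense_def
  proof (intro conjI ballI allI impI)
    show "countable (?s ` T)" using T(1) by simp
    show "?s ` T \<subseteq> Grassmannian n k" using in_G by auto
    fix F and e :: real assume F: "F \<in> Grassmannian n k" and e: "0 < e"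
    obtain v where v: "orthonormal n k v" "F = span (v ` {..<k})"
      using orthonormal_basis_exists[OF F k(1)] by blast
    have "v \<in> {w. (\<Sum>i<k. norm_Rn n (v i - w i)) < e} \<inter> {v. orthonormal n k v}" using v e by simp
    then have "{w. (\<Sum>i<k. norm_Rn n (v i - w i)) < e} \<inter> T \<noteq> {}"
      using T(3)[OF open_frame_ball] by blast
    then obtain w where w: "w \<in> T" "(\<Sum>i<k. norm_Rn n (v i - w i)) < e" by blast
    then have "Grassmannian_dist n F (?s w) < e"
      using Grassmannian_dist_span_le[OF v(1), of w] T(2) v(2) by (auto simp: frame_span_def)
    then show "\<exists>q\<in>?s ` T. Grassmannian_dist n F q < e" using w(1) by blast
  qed
  then have "haar_prob mtopology ((`) ` orthogonal_maps n) = ?\<mu>"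
  proof (rule haar_prob_eqI)
    show "prob_space ?\<mu>" by (rule fr.prob_space_distr[OF m])
    fix E F assume EF: "E \<in> Grassmannian n k" "F \<in> Grassmannian n k"
    show "\<exists>g\<in>(`) ` orthogonal_maps n. g E = F"
      using Grassmannian_transitive[OF EF k(1)] by auto
  next
    fix g E assume "g \<in> (`) ` orthogonal_maps n" "E \<in> Grassmannian n k"
    then show "g E \<in> Grassmannian n k" using Grassmannian_image[OF _ _ k(1)] by auto
  next
    fix g E F assume "g \<in> (`) ` orthogonal_maps n" "E \<in> Grassmannian n k" "F \<in> Grassmannian n k"
    then show "Grassmannian_dist n (g E) (g F) = Grassmannian_dist n E F" by (auto intro: Grassmannian_dist_image)
  next
    fix g assume "g \<in> (`) ` orthogonal_maps n"
    then obtain T where T: "T \<in> orthogonal_maps n" "g = (`) T" by auto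
    let ?w = "\<lambda>i. T (unit_vec i)"
    let ?R = "\<lambda>v i. comb n ?w (v i)"
    have w: "orthonormal n n ?w" by (rule orthogonal_maps_orthonormal[OF T(1) orthonormal_unit_vec]) simp
    have gm: "g \<in> measurable ?B ?B"
      using T Grassmannian_image[OF T(1) _ k(1)] Grassmannian_dist_image[OF T(1)] by (intro measurable_isometry) auto
    have Rm: "?R \<in> measurable (frames n k) (frames n k)" by measurable
    have "distr ?\<mu> ?\<mu> g = distr ?\<mu> ?B g" by (rule distr_cong) auto
    also have "\<dots> = distr (frames n k) ?B (g \<circ> ?s)" by (rule distr_distr[OF gm m])
    also have "\<dots> = distr (frames n k) ?B (?s \<circ> ?R)"
    proof (rule distr_cong_AE)
      show "AE v in frames n k. (g \<circ> ?s) v = (?s \<circ> ?R) v"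
        using AE_frames_orthonormal[OF k(2)]
      proof eventually_elim
        case (elim v)
        have eq: "comb n ?w (v i) = T (v i)" if "i < k" for i
          using orthogonal_map_eq_comb[OF T(1) orthonormalD(1)[OF elim that]] by simp
        have "orthonormal n k (?R v)"
          using orthogonal_maps_orthonormal[OF T(1) elim] eq by (subst orthonormal_cong[where w="\<lambda>i. T (v i)"]) auto
        moreover have "?R v ` {..<k} = (\<lambda>i. T (v i)) ` {..<k}" using eq by (intro image_cong) auto
        ultimately show ?case
          using elim by (simp add: frame_span_def T(2) image_span_frame[OF orthogonal_mapsD(1)[OF T(1)]])
      qed
    qed (use measurable_comp[OF m gm] measurable_comp[OF Rm m] in auto)
    also have "\<dots> = distr (distr (frames n k) (frames n k) ?R) ?B ?s"
      by (rule distr_distr[OF m Rm, symmetric])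
    also have "distr (frames n k) (frames n k) ?R = distr (frames n k) borel ?R" by (rule distr_cong) auto
    also have "\<dots> = frames n k" by (rule frames_rotation[OF w])
    finally show "distr ?\<mu> ?\<mu> g = ?\<mu>" .
  qed simp
  then show "Grassmannian_measure n k = distr (frames n k) (borel_of (Grassmannian_topology n k)) ?s"
    by (simp add: Grassmannian_measure_def top)
qed

subsection \<open>Compactness\<close>

text \<open>A closed subset of a product of intervals [-1, 1] and points 0, which is compact by
  Tychonoff's theorem.\<close>

lemma compact_unit_sphere: "compact (unit_sphere n)"
proof -
  have "compactin (powertop_real UNIV) (PiE UNIV (\<lambda>i. if i < n then {-1..1} else {0 :: real}))"
    by (subst compactin_PiE) auto
  then have c: "compact (PiE UNIV (\<lambda>i :: nat. if i < n then {-1..1} else {0 :: real}))" (is "compact ?P")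
    by (simp add: euclidean_product_topology)
  have "unit_sphere n = ?P \<inter> {x. norm_Rn n x = 1}"
  proof (intro set_eqI iffI)
    fix x assume "x \<in> unit_sphere n"
    then show "x \<in> ?P \<inter> {x. norm_Rn n x = 1}"
      using abs_coord_le_norm_Rn[of _ n x] by (auto simp: unit_sphere_def mem_Rn PiE_iff abs_le_iff)
  next
    fix x assume "x \<in> ?P \<inter> {x. norm_Rn n x = 1}"
    then have "x i = 0" if "i \<ge> n" for i using that by (auto simp: PiE_iff dest: spec[of _ i])
    then show "x \<in> unit_sphere n" using \<open>x \<in> ?P \<inter> {x. norm_Rn n x = 1}\<close> by (auto simp: unit_sphere_def mem_Rn)
  qed
  moreover have "closed {x. norm_Rn n x = 1}"
    by (intro closed_Collect_eq continuous_norm_Rn continuous_on_const continuous_on_id)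
  ultimately show ?thesis using c by (simp add: compact_Int_closed)
qed

lemma continuous_on_comb: "continuous_on S (comb k v)"
  unfolding comb_def[abs_def]
  by (intro continuous_on_coordinatewise_then_product continuous_on_sum continuous_on_mult continuous_on_const)
    (rule continuous_on_subset[OF continuous_on_product_coordinates], simp)

text \<open>An orthonormal basis presents the section as a continuous image of the unit sphere of
  dimension \<open>k\<close>.\<close>

lemma compact_sphere_Int_Grassmannian:
  assumes F: "F \<in> Grassmannian n k" and k: "1 \<le> k"
  shows "compact (unit_sphere n \<inter> F)" "unit_sphere n \<inter> F \<noteq> {}"
proof -
  obtain v where v: "orthonormal n k v" "F = span (v ` {..<k})"
    using orthonormal_basis_exists[OF F k] by blast
  have "unit_sphere n \<inter> F = comb k v ` unit_sphere k"
  proof (intro set_eqI iffI)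
    fix x assume x: "x \<in> unit_sphere n \<inter> F"
    define a where "a = (\<lambda>i. if i < k then inner_Rn n x (v i) else 0)"
    have "x = comb k v (\<lambda>i. inner_Rn n x (v i))" using x v span_orthonormal_comb[OF v(1)] by blast
    also have "\<dots> = comb k v a" by (rule comb_cong) (auto simp: a_def)
    finally have xa: "x = comb k v a" .
    moreover have "a \<in> Rn k" by (simp add: a_def mem_Rn)
    moreover have "norm_Rn k a = 1" using x norm_comb_orthonormal[OF v(1), of a] xa by (simp add: unit_sphere_def)
    ultimately show "x \<in> comb k v ` unit_sphere k" by (auto simp: unit_sphere_def)
  next
    fix x assume "x \<in> comb k v ` unit_sphere k"
    then show "x \<in> unit_sphere n \<inter> F"
      using comb_in_span v by (auto simp: unit_sphere_def norm_comb_orthonormal comb_Rn)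
  qed
  moreover have "compact (comb k v ` unit_sphere k)"
    by (rule compact_continuous_image[OF continuous_on_comb compact_unit_sphere])
  moreover have "unit_vec 0 \<in> unit_sphere k"
    using orthonormalD[OF orthonormal_unit_vec[of k k], of 0] k by (simp add: unit_sphere_def)
  ultimately show "compact (unit_sphere n \<inter> F)" "unit_sphere n \<inter> F \<noteq> {}" by auto
qed

text \<open>Continuity refers to the product topology, in which norm balls are open because
  \<open>norm_Rn n\<close> depends continuously on finitely many coordinates.\<close>

lemma continuous_on_norm_Lipschitz:
  fixes f :: "(nat \<Rightarrow> real) \<Rightarrow> real"
  assumes lip: "\<And>x y. x \<in> S \<Longrightarrow> y \<in> S \<Longrightarrow> \<bar>f x - f y\<bar> \<le> L * norm_Rn n (x - y)"
  shows "continuous_on S f"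
  unfolding continuous_on_topological
proof safe
  fix x B assume x: "x \<in> S" and B: "open B" "f x \<in> B"
  then obtain e where e: "0 < e" "\<And>z. \<bar>z - f x\<bar> < e \<Longrightarrow> z \<in> B"
    unfolding open_dist dist_real_def by blast
  define d where "d = e / (\<bar>L\<bar> + 1)"
  have d: "0 < d" using e by (simp add: d_def add_pos_nonneg)
  show "\<exists>A. open A \<and> x \<in> A \<and> (\<forall>y\<in>S. y \<in> A \<longrightarrow> f y \<in> B)"
  proof (intro exI conjI ballI impI)
    show "open {y. norm_Rn n (x - y) < d}" by (rule open_norm_ball)
    show "x \<in> {y. norm_Rn n (x - y) < d}" using d by simp
    fix y assume y: "y \<in> S" "y \<in> {y. norm_Rn n (x - y) < d}"
    have "\<bar>f y - f x\<bar> \<le> L * norm_Rn n (y - x)" by (rule lip[OF y(1) x])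
    also have "\<dots> \<le> (\<bar>L\<bar> + 1) * norm_Rn n (y - x)" by (intro mult_right_mono) auto
    also have "\<dots> < (\<bar>L\<bar> + 1) * d" using y by (intro mult_strict_left_mono) (auto simp: norm_Rn_minus_commute)
    also have "\<dots> = e" by (simp add: d_def)
    finally show "f y \<in> B" by (rule e(2))
  qed
qed

text \<open>On the compact sphere of \<open>F\<close> the strict inequalities hold with a margin m.
  A unit vector of a nearby E is within 2 d of some y in F, and normalising y costs at most another
  2 d, so \<open>f\<close> changes by at most 4 d L < m.\<close>

lemma openin_Grassmannian_between:
  fixes f :: "(nat \<Rightarrow> real) \<Rightarrow> real"
  assumes k: "1 \<le> k" and L: "0 \<le> L"
    and lip: "\<And>x y. x \<in> Rn n \<Longrightarrow> y \<in> Rn n \<Longrightarrow> \<bar>f x - f y\<bar> \<le> L * norm_Rn n (x - y)"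
  shows "openin (Grassmannian_topology n k) {F \<in> Grassmannian n k. \<forall>x\<in>unit_sphere n \<inter> F. \<alpha> < f x \<and> f x < \<beta>}"
proof -
  interpret Metric_space "Grassmannian n k" "Grassmannian_dist n" by (rule Metric_space_Grassmannian[OF k])
  have top: "Grassmannian_topology n k = mtopology" by (simp add: Grassmannian_topology_def)
  let ?A = "{F \<in> Grassmannian n k. \<forall>x\<in>unit_sphere n \<inter> F. \<alpha> < f x \<and> f x < \<beta>}"
  show ?thesis unfolding top openin_mtopology
  proof (intro conjI allI impI)
    fix F assume F: "F \<in> ?A"
    then have FG: "F \<in> Grassmannian n k" by simp
    let ?C = "unit_sphere n \<inter> F"
    define g where "g x = max (f x - \<beta>) (\<alpha> - f x)" for x
    have cont: "continuous_on ?C f"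
      using unit_sphere_subset_Rn by (intro continuous_on_norm_Lipschitz[where L=L and n=n] lip) auto
    then have "continuous_on ?C g" unfolding g_def by (intro continuous_intros)
    then obtain x0 where x0: "x0 \<in> ?C" "\<And>y. y \<in> ?C \<Longrightarrow> g y \<le> g x0"
      using continuous_attains_sup[OF compact_sphere_Int_Grassmannian[OF FG k]] by blast
    define m where "m = - g x0"
    have m: "0 < m" using F x0(1) by (auto simp: m_def g_def)
    define d where "d = min (1/4) (m / (4 * (L + 1)))"
    have d: "0 < d" "d \<le> 1/4" "4 * d * L < m"
    proof -
      show "0 < d" using m L by (auto simp: d_def)
      show "d \<le> 1/4" unfolding d_def by (rule min.cobounded1)
      have "4 * d * (L + 1) \<le> 4 * (m / (4 * (L + 1))) * (L + 1)" using L by (intro mult_right_mono) (auto simp: d_def)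
      also have "\<dots> = m" using L by (simp add: field_simps)
      finally show "4 * d * L < m" using \<open>0 < d\<close> by (simp add: algebra_simps)
    qed
    have "mball F d \<subseteq> ?A"
    proof
      fix E assume "E \<in> mball F d"
      then have E: "E \<in> Grassmannian n k" "ball_excess n E F < d"
        using Grassmannian_dist_eq[OF FG, of E] by auto
      have "\<alpha> < f x \<and> f x < \<beta>" if x: "x \<in> unit_sphere n \<inter> E" for x
      proof -
        have x1: "x \<in> E" "norm_Rn n x = 1" "x \<in> Rn n" using x by (auto simp: unit_sphere_def)
        obtain y where y: "y \<in> F" "norm_Rn n y \<le> 1" "norm_Rn n (x - y) < ball_excess n E F + d"
          using ball_excess_approx[OF FG x1(1), of d] x1(2) d(1) by auto
        have xy: "norm_Rn n (x - y) < 2 * d" using y(3) E(2) by linarith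
        then have ny: "1 - 2 * d < norm_Rn n y"
          using norm_Rn_triangle_sub[of n x y] x1(2) by linarith
        then have ny0: "0 < norm_Rn n y" using d(2) by linarith
        let ?z = "normalize_Rn n y"
        have zF: "?z \<in> F" unfolding normalize_Rn_def by (rule Grassmannian_scale[OF FG y(1)])
        then have z: "?z \<in> ?C" "?z \<in> Rn n"
          using ny0 Grassmannian_Rn[OF FG] by (auto simp: unit_sphere_def norm_normalize_Rn)
        have "y - ?z = (norm_Rn n y - 1) *\<^sub>R ?z"
          using ny0 by (auto simp: normalize_Rn_def fun_eq_iff field_simps)
        then have "norm_Rn n (y - ?z) = \<bar>norm_Rn n y - 1\<bar>"
          using ny0 by (simp only: norm_Rn_scaleR norm_normalize_Rn[of n y]) simp
        then have "norm_Rn n (x - ?z) \<le> 4 * d"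
          using norm_Rn_triangle_diff[of n x ?z y] xy ny y(2) by linarith
        then have "L * norm_Rn n (x - ?z) \<le> L * (4 * d)" using L by (rule mult_left_mono)
        then have "\<bar>f x - f ?z\<bar> < m"
          using lip[OF x1(3) z(2)] d(3) by (simp add: mult_ac)
        moreover have "g ?z \<le> - m" using x0(2)[OF z(1)] by (simp add: m_def)
        ultimately show ?thesis unfolding g_def by (auto simp: max_def split: if_splits)
      qed
      then show "E \<in> ?A" using E(1) by blast
    qed
    then show "\<exists>r>0. mball F r \<subseteq> ?A" using d(1) by blast
  qed auto
qed

section \<open>The norm of a symmetric convex body\<close>

locale body =
  fixes n :: nat and K :: "(nat \<Rightarrow> real) set"
  assumes n: "1 \<le> n" and body: "symmetric_convex_body n K"
begin

lemma K_Rn: "K \<subseteq> Rn n" and K_compact: "compact K"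
proof -
  have "compactin (top_of_set (Rn n)) K"
    using body Euclidean_space_top_of_set[of n] by (simp add: symmetric_convex_body_def)
  then show "K \<subseteq> Rn n" "compact K" by (auto simp: compactin_subtopology)
qed

lemma K_convex: "convex K" and K_uminus: "x \<in> K \<Longrightarrow> - x \<in> K"
  using body by (auto simp: symmetric_convex_body_def)

text \<open>By symmetry and convexity, the midpoint of p + x and -(p - x), which is x, lies in K; so
  a ball around an interior point p gives a ball around 0.\<close>

lemma contains_ball: "\<exists>r>0. \<forall>x\<in>Rn n. norm_Rn n x \<le> r \<longrightarrow> x \<in> K"
proof -
  interpret Metric_space "Rn n" "\<lambda>x y. norm_Rn n (x - y)" by (rule Metric_space_Rn) simp
  have top: "mtopology = Euclidean_space n"
    using mtopology_Rn[of "Rn n" n] Euclidean_space_top_of_set[of n] by simp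
  let ?U = "(Euclidean_space n) interior_of K"
  have U: "?U \<noteq> {}" "openin mtopology ?U" "?U \<subseteq> K"
    using body by (auto simp: symmetric_convex_body_def top interior_of_subset)
  then obtain p e where p: "p \<in> ?U" "0 < e" "mball p e \<subseteq> ?U" unfolding openin_mtopology by blast
  then have pR: "p \<in> Rn n" using U(3) K_Rn by auto
  have "x \<in> K" if x: "x \<in> Rn n" "norm_Rn n x \<le> e/2" for x
  proof -
    have "p + x \<in> mball p e" "p - x \<in> mball p e"
      using x p pR by (auto intro: Rn_add Rn_diff)
    then have "p + x \<in> K" "- (p - x) \<in> K" using p U K_uminus by blast+
    then have "(1/2) *\<^sub>R (p + x) + (1/2) *\<^sub>R (- (p - x)) \<in> K"
      by (intro convexD[OF K_convex]) auto
    moreover have "(1/2) *\<^sub>R (p + x) + (1/2) *\<^sub>R (- (p - x)) = x" by (auto simp: fun_eq_iff field_simps)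
    ultimately show ?thesis by simp
  qed
  then show ?thesis using p(2) by (intro exI[of _ "e/2"]) auto
qed

lemma contained_in_ball: "\<exists>R>0. \<forall>x\<in>K. norm_Rn n x \<le> R"
proof -
  have "continuous_on K (norm_Rn n)" by (intro continuous_norm_Rn continuous_on_id)
  then have "bounded (norm_Rn n ` K)" using K_compact by (intro compact_imp_bounded compact_continuous_image)
  then obtain R where R: "0 < R" "\<And>y. y \<in> norm_Rn n ` K \<Longrightarrow> norm y \<le> R" unfolding bounded_pos by blast
  have "norm_Rn n x \<le> R" if "x \<in> K" for x using R(2)[of "norm_Rn n x"] that by simp
  then show ?thesis using R(1) by auto
qed

definition scales :: "(nat \<Rightarrow> real) \<Rightarrow> real set" where
  "scales x = {r. 0 < r \<and> (1 / r) *\<^sub>R x \<in> K}"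

lemma body_norm_Inf: "body_norm K x = Inf (scales x)"
proof -
  have "x \<in> (\<lambda>y. r *\<^sub>R y) ` K \<longleftrightarrow> (1 / r) *\<^sub>R x \<in> K" if "0 < r" for r
  proof
    assume "x \<in> (\<lambda>y. r *\<^sub>R y) ` K"
    then show "(1 / r) *\<^sub>R x \<in> K" using that by auto
  next
    assume "(1 / r) *\<^sub>R x \<in> K"
    then show "x \<in> (\<lambda>y. r *\<^sub>R y) ` K" using that by (intro image_eqI[of _ _ "(1 / r) *\<^sub>R x"]) auto
  qed
  then show ?thesis unfolding body_norm_def scales_def by (metis (mono_tags, lifting))
qed

lemma bdd_below_scales: "bdd_below (scales x)"
  by (rule bdd_belowI[of _ 0]) (auto simp: scales_def)

lemma scales_nonempty: "x \<in> Rn n \<Longrightarrow> scales x \<noteq> {}"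
proof -
  assume x: "x \<in> Rn n"
  obtain r where r: "0 < r" "\<And>x. x \<in> Rn n \<Longrightarrow> norm_Rn n x \<le> r \<Longrightarrow> x \<in> K" using contains_ball by blast
  define t where "t = norm_Rn n x / r + 1"
  have t: "0 < t" unfolding t_def using r(1) by (intro add_nonneg_pos) auto
  have "norm_Rn n x \<le> r * t" using r(1) by (simp add: t_def field_simps)
  then have "norm_Rn n ((1 / t) *\<^sub>R x) \<le> r" using t by (simp add: field_simps)
  then have "t \<in> scales x" using r(2)[OF Rn_scaleR[OF x]] t by (simp add: scales_def)
  then show ?thesis by blast
qed

lemma body_norm_nonneg: "x \<in> Rn n \<Longrightarrow> 0 \<le> body_norm K x"
  unfolding body_norm_Inf by (rule cInf_greatest[OF scales_nonempty]) (auto simp: scales_def)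

lemma body_norm_upper: "\<exists>B>0. \<forall>x\<in>Rn n. body_norm K x \<le> B * norm_Rn n x"
proof -
  obtain r where r: "0 < r" "\<And>x. x \<in> Rn n \<Longrightarrow> norm_Rn n x \<le> r \<Longrightarrow> x \<in> K" using contains_ball by blast
  have "body_norm K x \<le> (1 / r) * norm_Rn n x" if x: "x \<in> Rn n" for x
  proof (rule field_le_epsilon)
    fix e :: real assume e: "0 < e"
    define t where "t = (1 / r) * norm_Rn n x + e"
    have t: "0 < t" "norm_Rn n x \<le> r * t" using r e by (auto simp: t_def add_nonneg_pos field_simps)
    then have "norm_Rn n ((1 / t) *\<^sub>R x) \<le> r" by (simp add: field_simps)
    then have "t \<in> scales x" using r(2)[OF Rn_scaleR[OF x]] t by (simp add: scales_def)
    then show "body_norm K x \<le> (1 / r) * norm_Rn n x + e"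
      unfolding body_norm_Inf t_def[symmetric] by (rule cInf_lower[OF _ bdd_below_scales])
  qed
  then show ?thesis using r(1) by (intro exI[of _ "1 / r"]) auto
qed

lemma body_norm_lower: "\<exists>B>0. \<forall>x\<in>Rn n. B * norm_Rn n x \<le> body_norm K x"
proof -
  obtain R where R: "0 < R" "\<And>x. x \<in> K \<Longrightarrow> norm_Rn n x \<le> R" using contained_in_ball by blast
  have "(1 / R) * norm_Rn n x \<le> body_norm K x" if x: "x \<in> Rn n" for x
    unfolding body_norm_Inf
  proof (rule cInf_greatest[OF scales_nonempty[OF x]])
    fix t assume "t \<in> scales x"
    then have t: "0 < t" "(1 / t) *\<^sub>R x \<in> K" by (auto simp: scales_def)
    with R(2)[OF t(2)] show "(1 / R) * norm_Rn n x \<le> t" using R(1) by (simp add: field_simps)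
  qed
  then show ?thesis using R(1) by (intro exI[of _ "1 / R"]) auto
qed

lemma body_norm_0: "body_norm K 0 = 0"
proof -
  obtain B where "\<forall>x\<in>Rn n. body_norm K x \<le> B * norm_Rn n x" using body_norm_upper by blast
  then have "body_norm K 0 \<le> B * norm_Rn n 0" using Rn_0 by blast
  then show ?thesis using body_norm_nonneg[of 0] by simp
qed

lemma body_norm_scale_pos:
  assumes x: "x \<in> Rn n" and c: "0 < c"
  shows "body_norm K (c *\<^sub>R x) = c * body_norm K x"
proof -
  have le: "body_norm K (c *\<^sub>R x) \<le> c * body_norm K x" if x: "x \<in> Rn n" and c: "0 < c" for x c
  proof -
    have "body_norm K (c *\<^sub>R x) / c \<le> body_norm K x"
      unfolding body_norm_Inf[of x]
    proof (rule cInf_greatest[OF scales_nonempty[OF x]])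
      fix t assume "t \<in> scales x"
      then have "c * t \<in> scales (c *\<^sub>R x)" using c by (simp add: scales_def)
      then have "body_norm K (c *\<^sub>R x) \<le> c * t"
        unfolding body_norm_Inf by (rule cInf_lower[OF _ bdd_below_scales])
      then show "body_norm K (c *\<^sub>R x) / c \<le> t" using c by (simp add: field_simps)
    qed
    then show ?thesis using c by (simp add: field_simps)
  qed
  have "body_norm K ((1 / c) *\<^sub>R (c *\<^sub>R x)) \<le> (1 / c) * body_norm K (c *\<^sub>R x)"
    using c by (intro le Rn_scaleR x) auto
  then have "c * body_norm K x \<le> body_norm K (c *\<^sub>R x)" using c by (simp add: field_simps)
  then show ?thesis using le[OF x c] by simp
qed

lemma body_norm_uminus: "body_norm K (- x) = body_norm K x"
proof -
  have "scales (- x) \<subseteq> scales x" for x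
    using K_uminus[of "(1 / _) *\<^sub>R (- x)"] by (auto simp: scales_def)
  from this[of x] this[of "- x"] show ?thesis unfolding body_norm_Inf by simp
qed

lemma body_norm_scale:
  assumes x: "x \<in> Rn n"
  shows "body_norm K (c *\<^sub>R x) = \<bar>c\<bar> * body_norm K x"
proof -
  consider "c = 0" | "0 < c" | "c < 0" by linarith
  then show ?thesis
  proof cases
    case 3
    then show ?thesis
      using body_norm_scale_pos[OF x, of "- c"] body_norm_uminus[of "c *\<^sub>R x"] by simp
  qed (auto simp: body_norm_0 body_norm_scale_pos[OF x])
qed

lemma body_norm_triangle:
  assumes x: "x \<in> Rn n" and y: "y \<in> Rn n"
  shows "body_norm K (x + y) \<le> body_norm K x + body_norm K y"
proof (rule field_le_epsilon)
  fix e :: real assume e: "0 < e"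
  obtain r where r: "r \<in> scales x" "r < body_norm K x + e/2"
    using cInf_less_iff[OF scales_nonempty[OF x] bdd_below_scales, of "body_norm K x + e/2"] e
    unfolding body_norm_Inf by auto
  obtain s where s: "s \<in> scales y" "s < body_norm K y + e/2"
    using cInf_less_iff[OF scales_nonempty[OF y] bdd_below_scales, of "body_norm K y + e/2"] e
    unfolding body_norm_Inf by auto
  have rs: "0 < r" "0 < s" "(1 / r) *\<^sub>R x \<in> K" "(1 / s) *\<^sub>R y \<in> K" using r s by (auto simp: scales_def)
  have "(r / (r + s)) *\<^sub>R ((1 / r) *\<^sub>R x) + (s / (r + s)) *\<^sub>R ((1 / s) *\<^sub>R y) \<in> K"
    using rs by (intro convexD[OF K_convex]) (auto simp: add_divide_distrib[symmetric])
  moreover have "(r / (r + s)) *\<^sub>R ((1 / r) *\<^sub>R x) + (s / (r + s)) *\<^sub>R ((1 / s) *\<^sub>R y) = (1 / (r + s)) *\<^sub>R (x + y)"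
    using rs by (auto simp: fun_eq_iff field_simps)
  ultimately have "r + s \<in> scales (x + y)" using rs by (simp add: scales_def)
  then have "body_norm K (x + y) \<le> r + s"
    unfolding body_norm_Inf by (rule cInf_lower[OF _ bdd_below_scales])
  then show "body_norm K (x + y) \<le> body_norm K x + body_norm K y + e" using r s by linarith
qed

abbreviation "b \<equiv> max_norm n K"
abbreviation "M \<equiv> mean_norm n K"

lemma sphere_nonempty: "unit_vec 0 \<in> unit_sphere n"
  using orthonormalD[OF orthonormal_unit_vec[of n n], of 0] n by (simp add: unit_sphere_def)

lemma bdd_above_sphere: "bdd_above (body_norm K ` unit_sphere n)"
proof -
  obtain B where B: "\<forall>x\<in>Rn n. body_norm K x \<le> B * norm_Rn n x" using body_norm_upper by blast
  then show ?thesis by (intro bdd_aboveI2[of _ _ B]) (auto simp: unit_sphere_def)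
qed

lemma body_norm_le_max: "x \<in> Rn n \<Longrightarrow> body_norm K x \<le> b * norm_Rn n x"
proof (cases "x = 0")
  case False
  assume x: "x \<in> Rn n"
  then have nx: "norm_Rn n x \<noteq> 0" using False by (simp add: norm_Rn_eq_0)
  have z: "normalize_Rn n x \<in> unit_sphere n"
    using x nx by (simp add: unit_sphere_def norm_normalize_Rn) (simp add: normalize_Rn_def Rn_scaleR)
  have "body_norm K x = body_norm K (norm_Rn n x *\<^sub>R normalize_Rn n x)" using nx by (simp add: normalize_Rn_def)
  also have "\<dots> = norm_Rn n x * body_norm K (normalize_Rn n x)"
    using z by (subst body_norm_scale) (auto simp: unit_sphere_def)
  also have "\<dots> \<le> norm_Rn n x * b"
    unfolding max_norm_def by (intro mult_left_mono cSUP_upper[OF z bdd_above_sphere]) simp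
  finally show ?thesis by (simp add: mult.commute)
qed (simp add: body_norm_0)

lemma max_pos: "0 < b"
proof -
  obtain B where B: "0 < B" "\<forall>x\<in>Rn n. B * norm_Rn n x \<le> body_norm K x" using body_norm_lower by blast
  have "B \<le> body_norm K (unit_vec 0)" using B(2) sphere_nonempty by (force simp: unit_sphere_def)
  also have "\<dots> \<le> b" unfolding max_norm_def by (rule cSUP_upper[OF sphere_nonempty bdd_above_sphere])
  finally show ?thesis using B(1) by simp
qed

lemma body_norm_Lipschitz:
  assumes "x \<in> Rn n" "y \<in> Rn n"
  shows "\<bar>body_norm K x - body_norm K y\<bar> \<le> b * norm_Rn n (x - y)"
proof -
  have "body_norm K x \<le> body_norm K y + b * norm_Rn n (x - y)" if "x \<in> Rn n" "y \<in> Rn n" for x y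
    using body_norm_triangle[OF that(2) Rn_diff[OF that]] body_norm_le_max[OF Rn_diff[OF that]] by simp
  from this[OF assms] this[OF assms(2,1)] show ?thesis by (simp add: norm_Rn_minus_commute abs_le_iff)
qed

text \<open>If \<open>u\<close> maximises the norm on the sphere, then \<open>b = \<parallel>u\<parallel> \<le> b \<bar>u - s y\<bar> + s \<parallel>y\<parallel>\<close> for every \<open>s > 0\<close>; the first
  order terms in \<open>s\<close> give the supporting hyperplane at \<open>u\<close>.\<close>

lemma supporting_vector: "\<exists>u\<in>unit_sphere n. \<forall>x\<in>Rn n. b * \<bar>inner_Rn n x u\<bar> \<le> body_norm K x"
proof -
  have "continuous_on (unit_sphere n) (body_norm K)"
    using unit_sphere_subset_Rn by (intro continuous_on_norm_Lipschitz[where L=b and n=n] body_norm_Lipschitz) auto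
  then obtain u where u: "u \<in> unit_sphere n" "\<And>y. y \<in> unit_sphere n \<Longrightarrow> body_norm K y \<le> body_norm K u"
    using continuous_attains_sup[OF compact_unit_sphere] sphere_nonempty by blast
  have "b \<le> body_norm K u" unfolding max_norm_def using u by (intro cSUP_least) auto
  moreover have uR: "u \<in> Rn n" "norm_Rn n u = 1" using u by (auto simp: unit_sphere_def)
  ultimately have bu: "body_norm K u = b" using body_norm_le_max[of u] by simp
  have main: "b * inner_Rn n y u \<le> body_norm K y" if y: "y \<in> Rn n" for y
  proof (rule field_le_epsilon)
    fix e :: real assume e: "0 < e"
    define q where "q = b * (norm_Rn n y)\<^sup>2"
    have q: "0 \<le> q" using max_pos by (simp add: q_def)
    \<comment> \<open>Makes the second order term s q at most e.\<close>
    define s where "s = e / (q + 1)"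
    have s: "0 < s" "s * q \<le> e"
    proof -
      show "0 < s" using e q by (simp add: s_def)
      have "s * q \<le> s * (q + 1)" using \<open>0 < s\<close> by simp
      also have "\<dots> = e" using q by (simp add: s_def)
      finally show "s * q \<le> e" .
    qed
    define w where "w = u - s *\<^sub>R y"
    have w: "w \<in> Rn n" unfolding w_def by (intro Rn_diff Rn_scaleR uR y)
    have "(norm_Rn n w)\<^sup>2 = 1 - 2 * s * inner_Rn n y u + s\<^sup>2 * (norm_Rn n y)\<^sup>2"
      using uR(2) unfolding w_def inner_Rn_self[symmetric] inner_Rn_simps
      by (simp add: inner_Rn_self inner_Rn_commute[of n u y] power2_eq_square algebra_simps)
    \<comment> \<open>The inequality 2 t \<le> 1 + t^2 replaces the square root by a polynomial in
      s; it is sharp at s = 0, where |w| = 1, so the first order term is not lost.\<close>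
    moreover have "2 * norm_Rn n w \<le> 1 + (norm_Rn n w)\<^sup>2"
      using zero_le_power2[of "norm_Rn n w - 1"] by (simp add: power2_eq_square algebra_simps)
    ultimately have nw: "norm_Rn n w \<le> 1 - s * inner_Rn n y u + s\<^sup>2 * (norm_Rn n y)\<^sup>2 / 2" by simp
    have "b = body_norm K (w + s *\<^sub>R y)" by (simp add: w_def bu)
    also have "\<dots> \<le> body_norm K w + body_norm K (s *\<^sub>R y)" by (intro body_norm_triangle w Rn_scaleR y)
    also have "\<dots> \<le> b * norm_Rn n w + s * body_norm K y"
      using body_norm_le_max[OF w] body_norm_scale[OF y, of s] s(1) by simp
    also have "\<dots> \<le> b * (1 - s * inner_Rn n y u + s\<^sup>2 * (norm_Rn n y)\<^sup>2 / 2) + s * body_norm K y"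
      using nw max_pos by simp
    finally have "s * (b * inner_Rn n y u) \<le> s * (body_norm K y + s * q / 2)"
      by (simp add: q_def power2_eq_square algebra_simps)
    then have "b * inner_Rn n y u \<le> body_norm K y + s * q / 2" using s(1) by simp
    moreover have "s * q / 2 \<le> e" using s(2) e by linarith
    ultimately show "b * inner_Rn n y u \<le> body_norm K y + e" by linarith
  qed
  have "b * \<bar>inner_Rn n x u\<bar> \<le> body_norm K x" if x: "x \<in> Rn n" for x
  proof -
    have "inner_Rn n (- x) u = - inner_Rn n x u" by (simp add: inner_Rn_def sum_negf)
    then show ?thesis
      using main[OF x] main[OF Rn_uminus[OF x]] by (simp add: body_norm_uminus abs_if)
  qed
  then show ?thesis using u(1) by blast
qed

subsection \<open>The mean of the norm\<close>

text \<open>\<open>comb n unit_vec\<close> truncates a sequence to \<open>\<real>\<^sup>n\<close>, so \<open>ext\<close> is a continuous extension of the norm.\<close>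

definition ext :: "(nat \<Rightarrow> real) \<Rightarrow> real" where
  "ext x = body_norm K (comb n unit_vec x)"

lemma unit_comb_Rn: "comb n unit_vec x \<in> Rn n"
  by (rule comb_Rn[OF orthonormal_unit_vec]) simp

lemma ext_eq: "x \<in> Rn n \<Longrightarrow> ext x = body_norm K x"
  by (simp add: ext_def comb_unit_vec)

lemma ext_nonneg: "0 \<le> ext x"
  unfolding ext_def by (rule body_norm_nonneg[OF unit_comb_Rn])

lemma ext_scale: "ext (c *\<^sub>R x) = \<bar>c\<bar> * ext x"
  unfolding ext_def comb_scaleR by (rule body_norm_scale[OF unit_comb_Rn])

lemma ext_Lipschitz: "\<bar>ext x - ext y\<bar> \<le> b * norm_Rn n (x - y)"
proof -
  have "norm_Rn n (comb n unit_vec x - comb n unit_vec y) = norm_Rn n (x - y)"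
    unfolding comb_diff[symmetric] by (rule norm_comb_orthonormal[OF orthonormal_unit_vec]) simp
  then show ?thesis unfolding ext_def using body_norm_Lipschitz[OF unit_comb_Rn unit_comb_Rn, of x y] by simp
qed

lemma measurable_ext [measurable]: "ext \<in> borel_measurable borel"
  by (intro borel_measurable_continuous_onI continuous_on_norm_Lipschitz[where L=b and n=n] ext_Lipschitz)

lemma ext_le: "ext x \<le> b * norm_Rn n x"
proof -
  have "ext 0 = 0" by (simp add: ext_eq body_norm_0)
  then show ?thesis using ext_Lipschitz[of x 0] by simp
qed

lemma measurable_sphere: "f \<in> measurable borel N \<Longrightarrow> f \<in> measurable (sphere_measure n) N"
  unfolding measurable_cong_sets[OF sets_sphere_measure[OF n] refl] by (rule measurable_restrict_space1)

lemma mean_ennreal: "ennreal M = (\<integral>\<^sup>+x. ennreal (ext x) \<partial>sphere_measure n)"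
  and mean_le_max: "M \<le> b" and mean_nonneg: "0 \<le> M"
proof -
  interpret prob_space "sphere_measure n" by (rule prob_space_sphere_measure[OF n])
  have sp: "space (sphere_measure n) = unit_sphere n" by (rule space_sphere_measure[OF n])
  have M: "M = (\<integral>x. ext x \<partial>sphere_measure n)"
    unfolding mean_norm_def
    by (intro Bochner_Integration.integral_cong refl) (simp add: sp ext_eq[OF subsetD[OF unit_sphere_subset_Rn]])
  have [measurable]: "ext \<in> borel_measurable (sphere_measure n)"
    by (rule measurable_sphere[OF measurable_ext])
  have le: "ext x \<le> b" if "x \<in> unit_sphere n" for x
    using that ext_le[of x] by (simp add: unit_sphere_def)
  have int: "integrable (sphere_measure n) ext"
    by (rule integrable_const_bound[of _ b]) (auto intro!: AE_I2 simp: sp le ext_nonneg)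
  show "ennreal M = (\<integral>\<^sup>+x. ennreal (ext x) \<partial>sphere_measure n)"
    unfolding M by (rule nn_integral_eq_integral[OF int, symmetric]) (simp add: ext_nonneg)
  have "M \<le> (\<integral>x. b \<partial>sphere_measure n)"
    unfolding M by (intro integral_mono int) (auto simp: sp le)
  then show "M \<le> b" using prob_space by simp
  show "0 \<le> M" unfolding M by (intro Bochner_Integration.integral_nonneg ext_nonneg)
qed

text \<open>The first absolute moment is bounded below by the second and fourth, 1 / n and 3 / (n (n
  + 2)), through a polynomial lying below the absolute value. Both moments are the case k = 1 of
  \<open>proj_sq_moments\<close>.\<close>

lemma sphere_mean_inner:
  assumes u: "u \<in> unit_sphere n"
  shows "ennreal (1 / sqrt (3 * n)) \<le> (\<integral>\<^sup>+x. ennreal \<bar>inner_Rn n x u\<bar> \<partial>sphere_measure n)"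
proof -
  interpret prob_space "frames n 1" by (rule prob_space_frames)
  define X where "X v = inner_Rn n (v 0) u" for v :: "nat \<Rightarrow> nat \<Rightarrow> real"
  have [measurable]: "X \<in> borel_measurable borel" unfolding X_def inner_Rn_def by measurable
  have X2: "proj_sq n 1 v u = (X v)\<^sup>2" for v by (simp add: proj_sq_def X_def)
  have m2: "(\<integral>v. (X v)\<^sup>2 \<partial>frames n 1) = 1 / n"
    using proj_sq_moments(1)[OF n n u] unfolding X2 by simp
  have m4: "(\<integral>v. (X v) ^ 4 \<partial>frames n 1) = 3 / (real n * (real n + 2))"
    using proj_sq_moments(2)[OF n n u] unfolding X2 by (simp flip: power_mult)
  have X1: "AE v in frames n 1. \<bar>X v\<bar> \<le> 1"
    using AE_frames_orthonormal[OF n]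
  proof eventually_elim
    case (elim v)
    then show ?case
      using inner_Rn_Cauchy_Schwarz[of n "v 0" u] orthonormalD(2)[OF elim, of 0] u by (simp add: X_def unit_sphere_def)
  qed
  have i1: "integrable (frames n 1) (\<lambda>v. \<bar>X v\<bar>)"
    by (rule integrable_const_bound[of _ 1]) (use X1 in auto)
  have i2: "integrable (frames n 1) (\<lambda>v. (X v)\<^sup>2)"
    by (rule integrable_const_bound[of _ 1])
       (use X1 in \<open>auto elim!: eventually_mono simp: abs_square_le_1\<close>)
  have X4: "AE v in frames n 1. norm ((X v) ^ 4) \<le> 1"
    using X1
  proof eventually_elim
    case (elim v)
    then have "\<bar>X v\<bar> ^ 4 \<le> 1" by (intro power_le_one) auto
    then show ?case by (simp add: power_abs)
  qed
  have i4: "integrable (frames n 1) (\<lambda>v. (X v) ^ 4)"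
    by (rule integrable_const_bound[OF X4]) measurable
  \<comment> \<open>With the fourth moment bounded by 3 / n^2, this scale optimises the resulting
    bound, which becomes \<beta> (1/2 - 1/6) = \<beta> / 3.\<close>
  define \<beta> where "\<beta> = sqrt (3 / n)"
  have be: "0 < \<beta>" "\<beta>\<^sup>2 = 3 / n" using n by (auto simp: \<beta>_def)
  \<comment> \<open>\<open>y \<ge> 3/2 y\<^sup>2 - 1/2 y\<^sup>4\<close> for \<open>y \<ge> 0\<close>, with equality at \<open>y = 1\<close>\<close>
  have pw: "\<beta> * (3 / 2 * (n / 3) * (X v)\<^sup>2 - 1 / 2 * (n / 3)\<^sup>2 * (X v) ^ 4) \<le> \<bar>X v\<bar>" for v
  proof -
    define y where "y = \<bar>X v\<bar> / \<beta>"
    have y: "0 \<le> y" "\<bar>X v\<bar> = \<beta> * y" using be by (auto simp: y_def)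
    have "0 \<le> y * ((y - 1)\<^sup>2 * (y + 2))" using y by simp
    then have "3 / 2 * y\<^sup>2 - 1 / 2 * y ^ 4 \<le> y"
      by (simp add: power2_eq_square power4_eq_xxxx algebra_simps)
    moreover have "(X v)\<^sup>2 = 3 / n * y\<^sup>2"
      using y(2) be(2) by (metis power2_abs power_mult_distrib)
    moreover have "(X v) ^ 4 = (3 / n)\<^sup>2 * y ^ 4"
    proof -
      have "(X v) ^ 4 = ((X v)\<^sup>2)\<^sup>2" by (simp flip: power_mult)
      also have "\<dots> = (3 / n * y\<^sup>2)\<^sup>2" by (simp only: \<open>(X v)\<^sup>2 = 3 / n * y\<^sup>2\<close>)
      also have "\<dots> = (3 / n)\<^sup>2 * y ^ 4" by (subst power_mult_distrib) (simp flip: power_mult)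
      finally show ?thesis .
    qed
    ultimately have "3 / 2 * (n / 3) * (X v)\<^sup>2 - 1 / 2 * (n / 3)\<^sup>2 * (X v) ^ 4 \<le> y"
      using n by (simp add: power_divide)
    then show ?thesis using y be(1) by (simp add: mult_left_mono)
  qed
  have "1 / sqrt (3 * n) = \<beta> / 3"
    using n by (simp add: \<beta>_def real_sqrt_divide real_sqrt_mult field_simps)
  also have "\<dots> \<le> \<beta> * (3 / 2 * (n / 3) * (1 / n) - 1 / 2 * (n / 3)\<^sup>2 * (3 / (real n * (real n + 2))))"
  proof -
    have "1 / 2 * (n / 3)\<^sup>2 * (3 / (real n * (real n + 2))) \<le> 1 / 2 * (n / 3)\<^sup>2 * (3 / (real n * real n))"
      using n by (intro mult_left_mono divide_left_mono) auto
    also have "\<dots> = 1 / 6" using n by (simp add: power2_eq_square)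
    finally have "1 / 2 * (n / 3)\<^sup>2 * (3 / (real n * (real n + 2))) \<le> 1 / 6" .
    moreover have "3 / 2 * (n / 3) * (1 / n) = (1 / 2 :: real)" using n by simp
    ultimately have "1 / 3 \<le> 3 / 2 * (n / 3) * (1 / n) - 1 / 2 * (n / 3)\<^sup>2 * (3 / (real n * (real n + 2)))"
      by linarith
    then have "\<beta> * (1 / 3) \<le> \<beta> * (3 / 2 * (n / 3) * (1 / n) - 1 / 2 * (n / 3)\<^sup>2 * (3 / (real n * (real n + 2))))"
      using be(1) by (intro mult_left_mono) auto
    then show ?thesis by simp
  qed
  also have "\<dots> = (\<integral>v. \<beta> * (3 / 2 * (n / 3) * (X v)\<^sup>2 - 1 / 2 * (n / 3)\<^sup>2 * (X v) ^ 4) \<partial>frames n 1)"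
    using i2 i4 m2 m4 by simp
  also have "\<dots> \<le> (\<integral>v. \<bar>X v\<bar> \<partial>frames n 1)"
    using i1 i2 i4 pw by (intro integral_mono) auto
  finally have "ennreal (1 / sqrt (3 * n)) \<le> ennreal (\<integral>v. \<bar>X v\<bar> \<partial>frames n 1)" by (rule ennreal_leI)
  also have "\<dots> = (\<integral>\<^sup>+v. ennreal \<bar>X v\<bar> \<partial>frames n 1)" by (rule nn_integral_eq_integral[symmetric, OF i1]) simp
  also have "\<dots> = (\<integral>\<^sup>+v. ennreal \<bar>inner_Rn n (comb 1 v (unit_vec 0)) u\<bar> \<partial>frames n 1)"
  proof -
    have "comb 1 v (unit_vec 0) = v 0" for v by (simp add: comb_def unit_vec_def)
    then show ?thesis by (simp add: X_def)
  qed
  also have "\<dots> = (\<integral>\<^sup>+x. ennreal \<bar>inner_Rn n x u\<bar> \<partial>sphere_measure n)"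
    by (rule nn_integral_sphere_frames[symmetric, OF _ n]) (simp, measurable)
  finally show ?thesis .
qed

text \<open>The supporting inequality integrated over the sphere. It yields M > 0 and settles the
  small dimensions in the upper bound.\<close>

lemma mean_lower: "b / sqrt (3 * n) \<le> M"
proof -
  obtain u where u: "u \<in> unit_sphere n" "\<And>x. x \<in> Rn n \<Longrightarrow> b * \<bar>inner_Rn n x u\<bar> \<le> body_norm K x"
    using supporting_vector by blast
  have "ennreal (b / sqrt (3 * n)) = ennreal b * ennreal (1 / sqrt (3 * n))"
    using max_pos by (simp add: ennreal_mult[symmetric])
  also have "\<dots> \<le> ennreal b * (\<integral>\<^sup>+x. ennreal \<bar>inner_Rn n x u\<bar> \<partial>sphere_measure n)"
    by (rule mult_left_mono[OF sphere_mean_inner[OF u(1)]]) simp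
  also have "\<dots> = (\<integral>\<^sup>+x. ennreal b * ennreal \<bar>inner_Rn n x u\<bar> \<partial>sphere_measure n)"
  proof (rule nn_integral_cmult[symmetric])
    show "(\<lambda>x. ennreal \<bar>inner_Rn n x u\<bar>) \<in> borel_measurable (sphere_measure n)"
      by (rule measurable_sphere) measurable
  qed
  also have "\<dots> \<le> (\<integral>\<^sup>+x. ennreal (ext x) \<partial>sphere_measure n)"
  proof (rule nn_integral_mono)
    fix x assume "x \<in> space (sphere_measure n)"
    then have x: "x \<in> Rn n" using space_sphere_measure[OF n] unit_sphere_subset_Rn by auto
    then show "ennreal b * ennreal \<bar>inner_Rn n x u\<bar> \<le> ennreal (ext x)"
      using u(2)[OF x] max_pos by (simp add: ext_eq ennreal_mult[symmetric] ennreal_leI)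
  qed
  also have "\<dots> = ennreal M" by (rule mean_ennreal[symmetric])
  finally show ?thesis using mean_nonneg by (simp add: ennreal_le_iff)
qed

lemma mean_pos: "0 < M"
proof -
  have "0 < b / sqrt (3 * n)" using max_pos n by simp
  then show ?thesis using mean_lower by linarith
qed

definition dev :: "(nat \<Rightarrow> real) \<Rightarrow> real" where
  "dev x = ext x - M * norm_Rn n x"

lemma measurable_dev [measurable]: "dev \<in> borel_measurable borel"
  unfolding dev_def by measurable

lemma dev_scale: "0 \<le> c \<Longrightarrow> dev (c *\<^sub>R x) = c * dev x"
  by (simp add: dev_def ext_scale algebra_simps)

text \<open>One b comes from the norm, the other from M |x| through M \<le> b.\<close>

lemma dev_Lipschitz: "\<bar>dev x - dev y\<bar> \<le> 2 * b * norm_Rn n (x - y)"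
proof -
  have "\<bar>norm_Rn n x - norm_Rn n y\<bar> \<le> norm_Rn n (x - y)"
    using norm_Rn_triangle_sub[of n x y] norm_Rn_triangle_sub[of n y x] norm_Rn_minus_commute[of n x y]
    by linarith
  then have "\<bar>M * norm_Rn n x - M * norm_Rn n y\<bar> \<le> b * norm_Rn n (x - y)"
    using mean_nonneg mean_le_max unfolding right_diff_distrib[symmetric] abs_mult by (intro mult_mono) auto
  then show ?thesis using ext_Lipschitz[of x y] unfolding dev_def by linarith
qed

lemma integrable_gauss_ext: "integrable (gauss n) ext"
proof (rule Bochner_Integration.integrable_bound[of "gauss n" "\<lambda>x. b * norm_Rn n x"])
  show "integrable (gauss n) (\<lambda>x. b * norm_Rn n x)" using integrable_gauss_norm by simp
  show "AE x in gauss n. norm (ext x) \<le> norm (b * norm_Rn n x)"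
    using ext_le ext_nonneg max_pos by (intro AE_I2) (simp add: abs_mult)
qed measurable

text \<open>The norm at x is |x| times its value at the direction of x, and length and direction are
  independent, so the Gaussian mean of the norm is M times the mean length.\<close>

lemma integral_gauss_dev: "(\<integral>x. dev x \<partial>gauss n) = 0"
proof -
  interpret prob_space "gauss n" by (rule prob_space_gauss)
  define c where "c = (\<integral>x. norm_Rn n x \<partial>gauss n)"
  have c: "(\<integral>\<^sup>+x. ennreal (norm_Rn n x) \<partial>gauss n) = ennreal c"
    unfolding c_def by (rule nn_integral_eq_integral[OF integrable_gauss_norm]) simp
  have c0: "0 < c"
  proof (rule ccontr)
    assume "\<not> 0 < c"
    moreover have "0 \<le> c" unfolding c_def by (intro Bochner_Integration.integral_nonneg) simp
    ultimately have "c = 0" by simp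
    then have "AE x in gauss n. norm_Rn n x = 0"
      unfolding c_def by (subst (asm) integral_nonneg_eq_0_iff_AE[OF integrable_gauss_norm]) auto
    with AE_gauss_nonzero[OF n] have "AE x in gauss n. False" by eventually_elim simp
    then show False by simp
  qed
  have "(\<integral>\<^sup>+x. ennreal (norm_Rn n x) * ennreal (ext (normalize_Rn n x)) \<partial>gauss n)
     = ennreal c * (\<integral>\<^sup>+x. ennreal (ext x) \<partial>sphere_measure n)"
    by (rule nn_integral_gauss_polar[OF n _ _ _ c c0]) (simp_all add: norm_comb_orthonormal)
  moreover have "(\<integral>\<^sup>+x. ennreal (norm_Rn n x) * ennreal (ext (normalize_Rn n x)) \<partial>gauss n) = (\<integral>\<^sup>+x. ennreal (ext x) \<partial>gauss n)"
  proof (rule nn_integral_cong_AE, use AE_gauss_nonzero[OF n] in eventually_elim)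
    case (elim x)
    then have "ext x = norm_Rn n x * ext (normalize_Rn n x)"
      unfolding normalize_Rn_def ext_scale by simp
    then show ?case by (simp add: ennreal_mult[symmetric] ext_nonneg)
  qed
  ultimately have "ennreal (\<integral>x. ext x \<partial>gauss n) = ennreal (c * M)"
    using nn_integral_eq_integral[OF integrable_gauss_ext] mean_ennreal ext_nonneg c0 mean_nonneg
    by (simp add: ennreal_mult)
  then have "(\<integral>x. ext x \<partial>gauss n) = c * M"
    using c0 mean_nonneg by (simp add: Bochner_Integration.integral_nonneg ext_nonneg)
  then show ?thesis
    unfolding dev_def using integrable_gauss_ext integrable_gauss_norm by (simp add: c_def)
qed

text \<open>Upper tails of \<open>dev\<close> and of its negative, both with Lipschitz constant 2 b;
  hence 64 = 16 * 4 and 10 = 2 * 5.\<close>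

lemma sphere_dev_tail:
  assumes \<eta>: "0 \<le> \<eta>"
  shows "(\<integral>\<^sup>+x. indicator {x. \<eta> * M \<le> \<bar>dev x\<bar>} x \<partial>sphere_measure n)
    \<le> ennreal (10 * exp (- (\<eta>\<^sup>2 * n * (M / b)\<^sup>2 / 64)))"
proof -
  let ?t = "\<eta> * M" and ?e = "5 * exp (- ((\<eta> * M)\<^sup>2 * n / (16 * (2 * b)\<^sup>2)))"
  have t: "0 \<le> ?t" using \<eta> mean_nonneg by simp
  have 1: "(\<integral>\<^sup>+x. indicator {x. ?t \<le> dev x} x \<partial>sphere_measure n) \<le> ennreal ?e"
  proof (rule sphere_upper_tail[OF n _ _ _ _ _ t])
    show "dev x - dev y \<le> 2 * b * norm_Rn n (x - y)" for x y using dev_Lipschitz[of x y] by linarith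
  qed (use max_pos in \<open>simp_all add: dev_scale integral_gauss_dev\<close>)
  have 2: "(\<integral>\<^sup>+x. indicator {x. ?t \<le> - dev x} x \<partial>sphere_measure n) \<le> ennreal ?e"
  proof (rule sphere_upper_tail[OF n _ _ _ _ _ t])
    show "- dev x - - dev y \<le> 2 * b * norm_Rn n (x - y)" for x y using dev_Lipschitz[of x y] by linarith
  qed (use max_pos in \<open>simp_all add: dev_scale integral_gauss_dev\<close>)
  have "Measurable.pred borel (\<lambda>x. ?t \<le> dev x)" "Measurable.pred borel (\<lambda>x. ?t \<le> - dev x)" by measurable
  then have s: "{x. ?t \<le> dev x} \<in> sets borel" "{x. ?t \<le> - dev x} \<in> sets borel" by simp_all
  have "(\<integral>\<^sup>+x. indicator {x. ?t \<le> \<bar>dev x\<bar>} x \<partial>sphere_measure n)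
     \<le> (\<integral>\<^sup>+x. indicator {x. ?t \<le> dev x} x + indicator {x. ?t \<le> - dev x} x \<partial>sphere_measure n)"
    by (intro nn_integral_mono) (auto simp: indicator_def)
  also have "\<dots> = (\<integral>\<^sup>+x. indicator {x. ?t \<le> dev x} x \<partial>sphere_measure n) + (\<integral>\<^sup>+x. indicator {x. ?t \<le> - dev x} x \<partial>sphere_measure n)"
    by (intro nn_integral_add measurable_sphere borel_measurable_indicator s)
  also have "\<dots> \<le> ennreal ?e + ennreal ?e" by (rule add_mono[OF 1 2])
  also have "\<dots> = ennreal (2 * ?e)" by (simp flip: ennreal_plus)
  also have "2 * ?e = 10 * exp (- (\<eta>\<^sup>2 * n * (M / b)\<^sup>2 / 64))"
    using max_pos by (simp add: power_mult_distrib power_divide mult_ac)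
  finally show ?thesis .
qed

end

section \<open>Nets\<close>

lemma sum_half_powers: "(\<Sum>j\<in>{- int N..int N}. (1/2 :: real) ^ nat \<bar>j\<bar>) \<le> 3"
proof -
  have "(\<Sum>j\<in>{- int N..int N}. (1/2 :: real) ^ nat \<bar>j\<bar>) = 3 - 2 * (1/2) ^ N"
  proof (induction N)
    case (Suc N)
    have "{- int (Suc N)..int (Suc N)} = insert (- int (Suc N)) (insert (int (Suc N)) {- int N..int N})"
      by auto
    moreover have "nat \<bar>- int (Suc N)\<bar> = Suc N" "nat \<bar>int (Suc N)\<bar> = Suc N" by linarith+
    ultimately show ?case using Suc by simp
  qed simp
  then show ?thesis by simp
qed

text \<open>The points of a scaled integer lattice near the sphere are counted with the weight \<open>\<Prod>i. 2 ^ - \<bar>m i\<bar>\<close>, whose sum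
  over the lattice factorises.\<close>

lemma sphere_net:
  assumes d: "0 < d" "d < 1" and k: "1 \<le> k"
  shows "\<exists>A. finite A \<and> real (card A) \<le> (3 * 2 powr (4 / d\<^sup>2)) ^ k \<and>
    (\<forall>a\<in>A. 1 - d \<le> norm_Rn k a \<and> norm_Rn k a \<le> 1 + d) \<and>
    (\<forall>x. norm_Rn k x = 1 \<longrightarrow> (\<exists>a\<in>A. norm_Rn k (x - a) \<le> d))"
proof -
  \<comment> \<open>A net point has norm at most 1 + d \<le> 2, so the squares of its integer
    coordinates sum to at most 4 / h^2 = R k. Since |m| \<le> m^2 for integers, the absolute values
    do so too.\<close>
  define R where "R = 4 / d\<^sup>2"
  \<comment> \<open>A cube of side h in k dimensions has diagonal d.\<close>
  define h where "h = d / sqrt k"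
  have h: "0 < h" "h\<^sup>2 = d\<^sup>2 / k" using d k by (auto simp: h_def power_divide)
  \<comment> \<open>A cutoff that makes the box \<open>P\<close> finite; the weighted sum over the
    box stays below 3^k whatever its size.\<close>
  define N where "N = nat \<lceil>R * k\<rceil>"
  have N: "R * k \<le> real N" unfolding N_def by (rule of_nat_ceiling)
  define P where "P = PiE {..<k} (\<lambda>_. {- int N..int N})"
  have P: "finite P" unfolding P_def by (rule finite_PiE) auto
  define Z where "Z = {m \<in> P. real (\<Sum>i<k. nat \<bar>m i\<bar>) \<le> R * k}"
  have Z: "finite Z" "Z \<subseteq> P" unfolding Z_def using P by auto
  define f where "f m = (\<lambda>i. h * real_of_int (m i))" for m :: "nat \<Rightarrow> int"
  define A where "A = {a \<in> f ` Z. 1 - d \<le> norm_Rn k a \<and> norm_Rn k a \<le> 1 + d}"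
  have A: "finite A" unfolding A_def using Z by auto
  have half: "(1/2 :: real) ^ j = 2 powr - real j" for j
    by (simp add: powr_minus powr_realpow power_one_over inverse_eq_divide)
  have "real (card A) \<le> real (card Z)"
    using card_mono[of "f ` Z" A] card_image_le[OF Z(1), of f] Z(1) by (auto simp: A_def)
  also have "\<dots> = (\<Sum>m\<in>Z. 1)" by simp
  \<comment> \<open>Points of \<open>Z\<close> have weight at least 2^(-R k), so the factor 2^(R k)
    makes every summand at least 1.\<close>
  also have "\<dots> \<le> (\<Sum>m\<in>Z. 2 powr (R * k) * (\<Prod>i<k. (1/2) ^ nat \<bar>m i\<bar>))"
  proof (rule sum_mono)
    fix m assume m: "m \<in> Z"
    have "(\<Prod>i<k. (1/2 :: real) ^ nat \<bar>m i\<bar>) = (1/2) ^ (\<Sum>i<k. nat \<bar>m i\<bar>)" by (rule power_sum[symmetric])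
    also have "\<dots> = 2 powr - real (\<Sum>i<k. nat \<bar>m i\<bar>)" by (rule half)
    finally have "2 powr (R * k) * (\<Prod>i<k. (1/2 :: real) ^ nat \<bar>m i\<bar>) = 2 powr (R * k - real (\<Sum>i<k. nat \<bar>m i\<bar>))"
      by (simp add: powr_add[symmetric] del: of_nat_sum)
    moreover have "1 \<le> 2 powr (R * k - real (\<Sum>i<k. nat \<bar>m i\<bar>))"
      using m by (intro ge_one_powr_ge_zero) (auto simp: Z_def simp del: of_nat_sum)
    ultimately show "1 \<le> 2 powr (R * k) * (\<Prod>i<k. (1/2 :: real) ^ nat \<bar>m i\<bar>)" by simp
  qed
  also have "\<dots> \<le> (\<Sum>m\<in>P. 2 powr (R * k) * (\<Prod>i<k. (1/2) ^ nat \<bar>m i\<bar>))"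
    using Z P by (intro sum_mono2) (auto intro!: mult_nonneg_nonneg prod_nonneg)
  also have "\<dots> = 2 powr (R * k) * (\<Sum>m\<in>P. \<Prod>i<k. (1/2) ^ nat \<bar>m i\<bar>)"
    by (rule sum_distrib_left[symmetric])
  also have "(\<Sum>m\<in>P. \<Prod>i<k. (1/2 :: real) ^ nat \<bar>m i\<bar>) = (\<Prod>i<k. \<Sum>j\<in>{- int N..int N}. (1/2) ^ nat \<bar>j\<bar>)"
    unfolding P_def by (rule prod_sum_PiE[symmetric]) auto
  also have "2 powr (R * k) * \<dots> \<le> 2 powr (R * k) * 3 ^ k"
    using power_mono[OF sum_half_powers, of N k] by (simp add: sum_nonneg)
  also have "\<dots> = (3 * 2 powr R) ^ k"
    by (simp add: power_mult_distrib powr_powr[symmetric] powr_realpow[symmetric])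
  finally have card: "real (card A) \<le> (3 * 2 powr (4 / d\<^sup>2)) ^ k" by (simp add: R_def)
  have net: "\<exists>a\<in>A. norm_Rn k (x - a) \<le> d" if x: "norm_Rn k x = 1" for x
  proof -
    \<comment> \<open>Rounding down to the lattice changes each coordinate by at most h.\<close>
    define m where "m = restrict (\<lambda>i. \<lfloor>x i / h\<rfloor>) {..<k}"
    have c: "(x i - f m i)\<^sup>2 \<le> h\<^sup>2" if "i < k" for i
    proof -
      have "real_of_int (m i) \<le> x i / h" "x i / h \<le> real_of_int (m i) + 1" using that by (auto simp: m_def)
      then have "h * real_of_int (m i) \<le> x i" "x i \<le> h * real_of_int (m i) + h" using h(1) by (auto simp: field_simps)
      then show ?thesis unfolding f_def by (intro power_mono) auto
    qed
    have "(norm_Rn k (x - f m))\<^sup>2 \<le> (\<Sum>i<k. h\<^sup>2)"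
      unfolding norm_Rn_power2 minus_apply using c by (intro sum_mono) auto
    also have "\<dots> = d\<^sup>2" using k by (simp add: h)
    finally have nd: "norm_Rn k (x - f m) \<le> d" by (rule power2_le_imp_le) (use d in auto)
    have lo: "1 - d \<le> norm_Rn k (f m)" and hi: "norm_Rn k (f m) \<le> 1 + d"
      using norm_Rn_triangle_sub[of k x "f m"] norm_Rn_triangle_sub[of k "f m" x] x nd norm_Rn_minus_commute[of k x "f m"]
      by linarith+
    have sq: "real (nat \<bar>m i\<bar>) \<le> (real_of_int (m i))\<^sup>2" for i
    proof (cases "m i = 0")
      case False
      then have "\<bar>m i\<bar> * 1 \<le> \<bar>m i\<bar> * \<bar>m i\<bar>" by (intro mult_left_mono) auto
      then have "\<bar>m i\<bar> \<le> (m i)\<^sup>2" by (simp add: power2_eq_square)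
      then have "real_of_int \<bar>m i\<bar> \<le> real_of_int ((m i)\<^sup>2)" by (simp only: of_int_le_iff)
      then show ?thesis by simp
    qed simp
    have "real (\<Sum>i<k. nat \<bar>m i\<bar>) \<le> (\<Sum>i<k. (real_of_int (m i))\<^sup>2)"
      unfolding of_nat_sum by (intro sum_mono sq)
    also have "\<dots> = (norm_Rn k (f m))\<^sup>2 / h\<^sup>2"
      using h(1) by (simp add: norm_Rn_power2 f_def power_mult_distrib sum_distrib_left[symmetric])
    also have "\<dots> \<le> 2\<^sup>2 / h\<^sup>2"
      using hi d by (intro divide_right_mono power_mono) auto
    also have "\<dots> = R * k" by (simp add: h R_def)
    finally have sum: "real (\<Sum>i<k. nat \<bar>m i\<bar>) \<le> R * k" .
    have "m i \<in> {- int N..int N}" if "i < k" for i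
    proof -
      have "nat \<bar>m i\<bar> \<le> (\<Sum>i<k. nat \<bar>m i\<bar>)" using that by (intro member_le_sum) auto
      then have "real (nat \<bar>m i\<bar>) \<le> real N" using sum N by (meson of_nat_le_iff order_trans)
      then show ?thesis by auto
    qed
    then have "m \<in> P" unfolding P_def m_def by (auto simp: PiE_iff)
    then have "m \<in> Z" using sum by (simp add: Z_def)
    then have "f m \<in> A" using lo hi by (simp add: A_def)
    then show ?thesis using nd by blast
  qed
  show ?thesis using A card net by (intro exI[of _ A]) (auto simp: A_def)
qed

text \<open>Its k-th power bounds the size of the net for distance \<epsilon> / 8 in dimension
  k.\<close>

definition net_base :: "real \<Rightarrow> real" where
  "net_base \<epsilon> = 3 * 2 powr (4 / (\<epsilon> / 8)\<^sup>2)"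

lemma net_base_ge_1: "1 \<le> net_base \<epsilon>"
proof -
  have "1 \<le> 2 powr (4 / (\<epsilon> / 8)\<^sup>2)" by (rule ge_one_powr_ge_zero) auto
  then show ?thesis unfolding net_base_def by linarith
qed

section \<open>The dimension of almost Euclidean sections\<close>

context body
begin

lemma openin_almost_Euclidean:
  assumes "1 \<le> k"
  shows "openin (Grassmannian_topology n k) (almost_Euclidean n K \<epsilon> k)"
  unfolding almost_Euclidean_def
  by (rule openin_Grassmannian_between[OF assms _ body_norm_Lipschitz]) (use max_pos in auto)

text \<open>Replaces the Grassmannian measure by \<open>frames\<close>, where families are almost
  surely orthonormal and moments are available.\<close>

lemma measure_almost_Euclidean:
  assumes k: "1 \<le> k" "k \<le> n"
  shows "frame_span n k -` almost_Euclidean n K \<epsilon> k \<in> sets borel"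
    and "measure (Grassmannian_measure n k) (almost_Euclidean n K \<epsilon> k)
      = measure (frames n k) (frame_span n k -` almost_Euclidean n K \<epsilon> k)"
proof -
  note m = Grassmannian_measure_frames(1)[OF k]
  have o: "almost_Euclidean n K \<epsilon> k \<in> sets (borel_of (Grassmannian_topology n k))"
    by (rule openin_sets_borel_of[OF openin_almost_Euclidean[OF k(1)]])
  show "frame_span n k -` almost_Euclidean n K \<epsilon> k \<in> sets borel"
    using measurable_sets[OF m o] by simp
  show "measure (Grassmannian_measure n k) (almost_Euclidean n K \<epsilon> k)
      = measure (frames n k) (frame_span n k -` almost_Euclidean n K \<epsilon> k)"
    unfolding Grassmannian_measure_frames(2)[OF k] using measure_distr[OF m o] by simp
qed

text \<open>Below dimension 16, \<open>mean_lower\<close> gives the constant 16 * 3 = 48. From 16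
  on, Chebyshev's failure probability 8 / k is at most 1/2, against the probability above 1/2
  demanded by \<open>typical_dims\<close>.\<close>

lemma typical_dim_upper:
  assumes k: "k \<in> typical_dims n K \<epsilon>" and \<epsilon>: "0 < \<epsilon>" "\<epsilon> < 1"
  shows "real k \<le> 48 * real n * (M / b)\<^sup>2"
proof (cases "k < 16")
  case True
  have "(b / sqrt (3 * n))\<^sup>2 \<le> M\<^sup>2" using mean_lower max_pos by (intro power_mono) auto
  then have "1 \<le> 3 * n * (M / b)\<^sup>2"
    using max_pos n by (simp add: power_divide field_simps)
  then show ?thesis using True by linarith
next
  case False
  have kn: "1 \<le> k" "k \<le> n" using k by (auto simp: typical_dims_def)
  interpret prob_space "frames n k" by (rule prob_space_frames)
  obtain u where u: "u \<in> unit_sphere n" "\<And>x. x \<in> Rn n \<Longrightarrow> b * \<bar>inner_Rn n x u\<bar> \<le> body_norm K x"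
    using supporting_vector by blast
  have uR: "u \<in> Rn n" "norm_Rn n u = 1" using u by (auto simp: unit_sphere_def)
  define X where "X v = proj_sq n k v u" for v
  define V where "V = frame_span n k -` almost_Euclidean n K \<epsilon> k"
  have V: "V \<in> sets borel" "1/2 < prob V"
    using measure_almost_Euclidean[OF kn] k by (auto simp: V_def typical_dims_def)
  have mX [measurable]: "X \<in> borel_measurable borel" unfolding X_def by measurable
  \<comment> \<open>The vector ?y = P u has length sqrt (X v) and inner product X v with u. Its
    normalisation is a unit vector of the subspace, where the supporting inequality reads b sqrt (X
    v) < 2 M.\<close>
  have key: "X v \<le> 4 * (M / b)\<^sup>2" if v: "orthonormal n k v" "v \<in> V" for v
  proof (cases "X v = 0")
    case False
    define a where "a = (\<lambda>i. inner_Rn n (v i) u)"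
    have "(norm_Rn k a)\<^sup>2 = X v" by (simp add: a_def X_def proj_sq_def norm_Rn_power2)
    then have na: "norm_Rn k a = sqrt (X v)" by (metis norm_Rn_nonneg real_sqrt_unique)
    have X0: "0 < X v" using False by (simp add: X_def proj_sq_def sum_nonneg less_le)
    let ?y = "comb k v a"
    have ny: "norm_Rn n ?y = sqrt (X v)" using norm_comb_orthonormal[OF v(1)] na by simp
    have iy: "inner_Rn n ?y u = X v"
      by (simp add: inner_comb_left a_def X_def proj_sq_def power2_eq_square)
    have yF: "?y \<in> frame_span n k v" using comb_in_span v(1) by (simp add: frame_span_def)
    have yR: "?y \<in> Rn n" by (rule comb_Rn[OF v(1)])
    let ?z = "normalize_Rn n ?y"
    have F: "frame_span n k v \<in> Grassmannian n k" using v by (simp add: V_def almost_Euclidean_def)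
    have zR: "?z \<in> Rn n" using yR by (simp add: normalize_Rn_def Rn_scaleR)
    then have "?z \<in> unit_sphere n \<inter> frame_span n k v"
      using Grassmannian_scale[OF F yF] ny X0
      by (auto simp: unit_sphere_def norm_normalize_Rn normalize_Rn_def)
    then have "body_norm K ?z < (1 + \<epsilon>) * M" using v(2) by (auto simp: V_def almost_Euclidean_def)
    also have "\<dots> \<le> 2 * M" using \<epsilon> mean_nonneg by (intro mult_right_mono) auto
    finally have "b * \<bar>inner_Rn n ?z u\<bar> < 2 * M" using u(2)[OF zR] by linarith
    moreover have "inner_Rn n ?z u = sqrt (X v)"
      using X0 by (simp add: normalize_Rn_def inner_Rn_simps iy ny real_div_sqrt)
    ultimately have "sqrt (X v) < 2 * (M / b)" using max_pos X0 by (simp add: field_simps)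
    then have "(sqrt (X v))\<^sup>2 \<le> (2 * (M / b))\<^sup>2" using X0 by (intro power_mono) auto
    then show ?thesis using X0 by (simp add: power_mult_distrib power_divide)
  qed simp
  have bounded: "AE v in frames n k. \<bar>X v\<bar> \<le> real k"
    using AE_frames_orthonormal[OF kn(2)]
  proof eventually_elim
    case (elim v)
    have "(inner_Rn n (v i) u)\<^sup>2 \<le> 1" if "i < k" for i
      using inner_Rn_Cauchy_Schwarz[of n "v i" u] orthonormalD(2)[OF elim that] uR(2) by (simp add: abs_square_le_1)
    then have "X v \<le> (\<Sum>i<k. 1)" unfolding X_def proj_sq_def by (intro sum_mono) auto
    moreover have "0 \<le> X v" by (simp add: X_def proj_sq_def sum_nonneg)
    ultimately show ?case by simp
  qed
  have iX: "integrable (frames n k) X"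
    by (rule integrable_const_bound[of _ "real k"]) (use bounded in auto)
  have iX2: "integrable (frames n k) (\<lambda>v. (X v)\<^sup>2)"
    by (rule integrable_const_bound[of _ "(real k)\<^sup>2"])
       (use bounded in \<open>auto elim!: eventually_mono simp: power2_le_iff_abs_le\<close>)
  have EX: "expectation X = k / n" and EX2: "expectation (\<lambda>v. (X v)\<^sup>2) = real k * (real k + 2) / (real n * (real n + 2))"
    using proj_sq_moments[OF n kn(2) u(1)] unfolding X_def by auto
  show ?thesis
  proof (rule ccontr)
    assume "\<not> ?thesis"
    then have big: "48 * real n * (M / b)\<^sup>2 < real k" by simp
    \<comment> \<open>On \<open>V\<close> the variable X is at most half its mean k / n, a deviation
      by at least k / (2 n).\<close>
    have "AE v in frames n k. v \<in> V \<longrightarrow> k / n / 2 \<le> \<bar>X v - expectation X\<bar>"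
      using AE_frames_orthonormal[OF kn(2)]
    proof eventually_elim
      case (elim v)
      show ?case
      proof
        assume "v \<in> V"
        then have "X v \<le> 4 * (M / b)\<^sup>2" by (rule key[OF elim])
        also have "4 * (M / b)\<^sup>2 \<le> k / n / 2"
        proof -
          have "8 * (n * (M / b)\<^sup>2) \<le> 48 * (n * (M / b)\<^sup>2)" by (intro mult_right_mono) auto
          then have "8 * (n * (M / b)\<^sup>2) \<le> k" using big by (simp add: mult.assoc)
          then show ?thesis using n by (simp add: field_simps)
        qed
        finally have "X v \<le> k / n / 2" .
        then show "k / n / 2 \<le> \<bar>X v - expectation X\<bar>" unfolding EX by linarith
      qed
    qed
    then have "prob V \<le> prob {v \<in> space (frames n k). k / n / 2 \<le> \<bar>X v - expectation X\<bar>}"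
      by (intro finite_measure_mono_AE) auto
    also have "\<dots> \<le> variance X / (k / n / 2)\<^sup>2"
      using kn n by (intro Chebyshev_inequality iX2) auto
    also have "variance X = real k * (real k + 2) / (real n * (real n + 2)) - (k / n)\<^sup>2"
      using variance_eq[OF iX iX2] by (simp add: EX EX2)
    \<comment> \<open>Replacing n + 2 by n bounds the variance by 2 k / n^2; dividing by (k / (2
      n))^2 leaves 8 / k.\<close>
    also have "\<dots> / (k / n / 2)\<^sup>2 \<le> 8 / k"
    proof -
      have "real k * (real k + 2) / (real n * (real n + 2)) \<le> real k * (real k + 2) / (real n * real n)"
        using n by (intro divide_left_mono mult_left_mono) auto
      then have "real k * (real k + 2) / (real n * (real n + 2)) - (k / n)\<^sup>2 \<le> 2 * k / (real n)\<^sup>2"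
        by (simp add: power2_eq_square add_divide_distrib diff_divide_distrib algebra_simps)
      then have "(real k * (real k + 2) / (real n * (real n + 2)) - (k / n)\<^sup>2) / (k / n / 2)\<^sup>2 \<le> 2 * k / (real n)\<^sup>2 / (k / n / 2)\<^sup>2"
        by (rule divide_right_mono) simp
      also have "\<dots> = 8 / k" using n kn by (simp add: field_simps power2_eq_square)
      finally show ?thesis .
    qed
    also have "\<dots> \<le> 1/2" using False by (simp add: field_simps)
    finally show False using V(2) by simp
  qed
qed

section \<open>From a net to the whole section: the lower bound\<close>

lemma ext_sub: "ext x \<le> ext y + ext (x - y)"
  unfolding ext_def comb_diff
  using body_norm_triangle[OF unit_comb_Rn Rn_diff[OF unit_comb_Rn unit_comb_Rn], of y x y] by simp

lemma net_implies_almost_Euclidean: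
  assumes v: "orthonormal n k v" and k: "1 \<le> k" and \<epsilon>: "0 < \<epsilon>" "\<epsilon> < 1" and d: "d = \<epsilon> / 8"
    and A: "\<And>a. a \<in> A \<Longrightarrow> 1 - d \<le> norm_Rn k a \<and> norm_Rn k a \<le> 1 + d"
      "\<And>x. norm_Rn k x = 1 \<Longrightarrow> \<exists>a\<in>A. norm_Rn k (x - a) \<le> d"
    and good: "\<And>a. a \<in> A \<Longrightarrow> \<bar>dev (comb k v a)\<bar> < d * M * norm_Rn k a"
  shows "frame_span n k v \<in> almost_Euclidean n K \<epsilon> k"
proof -
  let ?F = "span (v ` {..<k})"
  have F: "?F \<in> Grassmannian n k" by (rule span_orthonormal_Grassmannian[OF v])
  let ?C = "unit_sphere n \<inter> ?F"
  have d01: "0 < d" "d < 1/8" using d \<epsilon> by auto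
  have "continuous_on ?C ext" by (rule continuous_on_norm_Lipschitz[where L=b and n=n]) (rule ext_Lipschitz)
  then obtain x1 where x1: "x1 \<in> ?C" "\<And>y. y \<in> ?C \<Longrightarrow> ext y \<le> ext x1"
    using continuous_attains_sup[OF compact_sphere_Int_Grassmannian[OF F k]] by blast
  define s where "s = ext x1"
  have s: "ext (comb k v c) \<le> s * norm_Rn k c" for c
  proof (cases "norm_Rn k c = 0")
    case True
    then have "norm_Rn n (comb k v c) = 0" by (simp add: norm_comb_orthonormal[OF v])
    then show ?thesis using ext_le[of "comb k v c"] True by simp
  next
    case False
    let ?y = "comb k v c"
    have ny: "norm_Rn n ?y = norm_Rn k c" by (rule norm_comb_orthonormal[OF v])
    have "normalize_Rn n ?y \<in> Rn n" using comb_Rn[OF v] by (simp add: normalize_Rn_def Rn_scaleR)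
    then have "normalize_Rn n ?y \<in> ?C"
      using Grassmannian_scale[OF F comb_in_span] False ny
      by (auto simp: unit_sphere_def norm_normalize_Rn) (auto simp: normalize_Rn_def)
    then have "ext (normalize_Rn n ?y) \<le> s" unfolding s_def by (rule x1(2))
    then have "norm_Rn k c * ext (normalize_Rn n ?y) \<le> norm_Rn k c * s" by (rule mult_left_mono) simp
    moreover have "norm_Rn k c * ext (normalize_Rn n ?y) = ext ?y"
      using False unfolding normalize_Rn_def ext_scale ny by simp
    ultimately show ?thesis by (simp add: mult.commute)
  qed
  have near: "\<exists>a\<in>A. x = comb k v (\<lambda>i. inner_Rn n x (v i)) \<and> ext (x - comb k v a) \<le> s * d \<and> ext (comb k v a - x) \<le> s * d" if x: "x \<in> ?C" for x
  proof -
    define c where "c = (\<lambda>i. inner_Rn n x (v i))"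
    have xc: "x = comb k v c" unfolding c_def using x by (intro span_orthonormal_comb[OF v]) auto
    have "norm_Rn k c = 1" using x norm_comb_orthonormal[OF v, of c] by (simp add: xc[symmetric] unit_sphere_def)
    then obtain a where a: "a \<in> A" "norm_Rn k (c - a) \<le> d" using A(2) by blast
    have s0: "0 \<le> s" unfolding s_def by (rule ext_nonneg)
    have "ext (x - comb k v a) \<le> s * norm_Rn k (c - a)" using s[of "c - a"] by (simp add: comb_diff xc[symmetric])
    moreover have "ext (comb k v a - x) \<le> s * norm_Rn k (a - c)" using s[of "a - c"] by (simp add: comb_diff xc[symmetric])
    moreover have "s * norm_Rn k (c - a) \<le> s * d" using a(2) s0 by (rule mult_left_mono)
    ultimately show ?thesis using a(1) xc norm_Rn_minus_commute[of k c a] unfolding c_def by (intro bexI[of _ a]) auto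
  qed
  have net_upper: "ext (comb k v a) \<le> (1 + d)\<^sup>2 * M" and net_lower: "(1 - d)\<^sup>2 * M \<le> ext (comb k v a)" if a: "a \<in> A" for a
  proof -
    have "\<bar>ext (comb k v a) - M * norm_Rn k a\<bar> < d * M * norm_Rn k a"
      using good[OF a] unfolding dev_def norm_comb_orthonormal[OF v] .
    then have *: "ext (comb k v a) \<le> (1 + d) * (norm_Rn k a * M)" "(1 - d) * (norm_Rn k a * M) \<le> ext (comb k v a)"
      by (simp_all add: abs_less_iff algebra_simps)
    have "(1 + d) * (norm_Rn k a * M) \<le> (1 + d) * ((1 + d) * M)"
      using A(1)[OF a] d01 mean_nonneg by (intro mult_left_mono mult_right_mono) auto
    then show "ext (comb k v a) \<le> (1 + d)\<^sup>2 * M" using *(1) by (simp add: power2_eq_square mult.assoc)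
    have "(1 - d) * ((1 - d) * M) \<le> (1 - d) * (norm_Rn k a * M)"
      using A(1)[OF a] d01 mean_nonneg by (intro mult_left_mono mult_right_mono) auto
    then show "(1 - d)\<^sup>2 * M \<le> ext (comb k v a)" using *(2) by (simp add: power2_eq_square mult.assoc)
  qed
  have s_lt: "s < (1 + 8 * d) * M"
  proof -
    obtain a where a: "a \<in> A" "ext (x1 - comb k v a) \<le> s * d" using near[OF x1(1)] by blast
    have "s \<le> (1 + d)\<^sup>2 * M + s * d" using ext_sub[of x1 "comb k v a"] net_upper[OF a(1)] a(2) unfolding s_def by linarith
    then have "s * (1 - d) \<le> (1 + d)\<^sup>2 * M" by (simp add: algebra_simps)
    also have "\<dots> < ((1 + 8 * d) * (1 - d)) * M"
    proof (rule mult_strict_right_mono[OF _ mean_pos])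
      have "d * (9 * d) < d * 5" using d01 by (intro mult_strict_left_mono) auto
      then show "(1 + d)\<^sup>2 < (1 + 8 * d) * (1 - d)" by (simp add: power2_eq_square algebra_simps)
    qed
    finally have "s * (1 - d) < ((1 + 8 * d) * M) * (1 - d)" by (simp add: mult_ac)
    then show ?thesis using d01 by (simp add: mult_less_cancel_right_disj)
  qed
  have lower: "(1 - 8 * d) * M < ext x" if x: "x \<in> ?C" for x
  proof -
    obtain a where a: "a \<in> A" "ext (comb k v a - x) \<le> s * d" using near[OF x] by blast
    have "s * d \<le> (1 + 8 * d) * M * d" using s_lt d01 by (intro mult_right_mono) auto
    moreover have "(1 - d)\<^sup>2 * M \<le> ext x + s * d"
      using ext_sub[of "comb k v a" x] net_lower[OF a(1)] a(2) by linarith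
    moreover have "(1 - 8 * d) * M + (1 + 8 * d) * M * d < (1 - d)\<^sup>2 * M"
    proof -
      have "d * (7 * d) < d * 5" using d01 by (intro mult_strict_left_mono) auto
      then have "(1 - 8 * d) + (1 + 8 * d) * d < (1 - d)\<^sup>2" by (simp add: power2_eq_square algebra_simps)
      then have "((1 - 8 * d) + (1 + 8 * d) * d) * M < (1 - d)\<^sup>2 * M" by (rule mult_strict_right_mono[OF _ mean_pos])
      then show ?thesis by (simp add: algebra_simps)
    qed
    ultimately show ?thesis by linarith
  qed
  have d8: "8 * d = \<epsilon>" by (simp add: d)
  have "(1 - \<epsilon>) * M < body_norm K x \<and> body_norm K x < (1 + \<epsilon>) * M" if x: "x \<in> ?C" for x
  proof -
    have "ext x = body_norm K x" using x by (intro ext_eq) (auto simp: unit_sphere_def)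
    moreover have "ext x \<le> s" unfolding s_def by (rule x1(2)[OF x])
    ultimately show ?thesis using lower[OF x] s_lt unfolding d8 by linarith
  qed
  then show ?thesis using F v by (simp add: almost_Euclidean_def frame_span_def)
qed

lemma typical_dim_lower:
  assumes k: "1 \<le> k" "k \<le> n" and \<epsilon>: "0 < \<epsilon>" "\<epsilon> < 1"
    and small: "k * ln (20 * net_base \<epsilon>) < (\<epsilon> / 8)\<^sup>2 * n * (M / b)\<^sup>2 / 64"
  shows "k \<in> typical_dims n K \<epsilon>"
proof -
  interpret prob_space "frames n k" by (rule prob_space_frames)
  define d where "d = \<epsilon> / 8"
  have d: "0 < d" "d < 1" using \<epsilon> by (auto simp: d_def)
  obtain A where A: "finite A" "real (card A) \<le> net_base \<epsilon> ^ k"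
    "\<forall>a\<in>A. 1 - d \<le> norm_Rn k a \<and> norm_Rn k a \<le> 1 + d"
    "\<forall>x. norm_Rn k x = 1 \<longrightarrow> (\<exists>a\<in>A. norm_Rn k (x - a) \<le> d)"
    using sphere_net[OF d k(1)] unfolding net_base_def d_def[symmetric] by blast
  define q where "q = d\<^sup>2 * n * (M / b)\<^sup>2 / 64"
  define Bad where "Bad a = {v. d * M * norm_Rn k a \<le> \<bar>dev (comb k v a)\<bar>}" for a
  have mcomb [measurable]: "(\<lambda>v. comb k v a) \<in> borel_measurable borel" for a
    by (intro measurable_comb) measurable
  have mBad: "Bad a \<in> sets borel" for a
  proof -
    have "Measurable.pred borel (\<lambda>v. d * M * norm_Rn k a \<le> \<bar>dev (comb k v a)\<bar>)" by measurable
    then show ?thesis by (simp add: Bad_def)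
  qed
  have bad: "prob (Bad a) \<le> 10 * exp (- q)" if a: "a \<in> A" for a
  proof -
    have na: "0 < norm_Rn k a" using A(3) a d by force
    \<comment> \<open>Net points need not have length 1; homogeneity of \<open>dev\<close> moves
      each of them to the sphere, where the law is known.\<close>
    let ?u = "normalize_Rn k a"
    have nu: "norm_Rn k ?u = 1" using na by (intro norm_normalize_Rn) simp
    have "dev (comb k v a) = norm_Rn k a * dev (comb k v ?u)" for v
      using na dev_scale[of "norm_Rn k a" "comb k v ?u"] unfolding comb_scaleR[symmetric] normalize_Rn_def by simp
    then have eq: "v \<in> Bad a \<longleftrightarrow> comb k v ?u \<in> {x. d * M \<le> \<bar>dev x\<bar>}" for v
      using na by (simp add: Bad_def abs_mult mult.commute[of "d * M"])
    have "Measurable.pred borel (\<lambda>x. d * M \<le> \<bar>dev x\<bar>)" by measurable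
    then have s: "{x. d * M \<le> \<bar>dev x\<bar>} \<in> sets borel" by simp
    have "emeasure (frames n k) (Bad a) = (\<integral>\<^sup>+v. indicator (Bad a) v \<partial>frames n k)" using mBad by simp
    also have "\<dots> = (\<integral>\<^sup>+v. indicator {x. d * M \<le> \<bar>dev x\<bar>} (comb k v ?u) \<partial>frames n k)"
      using eq by (intro nn_integral_cong) (simp add: indicator_def)
    also have "\<dots> = (\<integral>\<^sup>+x. indicator {x. d * M \<le> \<bar>dev x\<bar>} x \<partial>sphere_measure n)"
      by (rule nn_integral_sphere_frames[OF nu k(2), symmetric]) (rule borel_measurable_indicator[OF s])
    also have "\<dots> \<le> ennreal (10 * exp (- q))" unfolding q_def by (rule sphere_dev_tail) (use d in simp)
    finally show ?thesis by (simp add: emeasure_eq_measure)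
  qed
  define W where "W = frame_span n k -` almost_Euclidean n K \<epsilon> k"
  have W: "W \<in> sets borel" unfolding W_def by (rule measure_almost_Euclidean(1)[OF k])
  have "AE v in frames n k. v \<in> - W \<longrightarrow> v \<in> (\<Union>a\<in>A. Bad a)"
    using AE_frames_orthonormal[OF k(2)]
  proof eventually_elim
    case (elim v)
    have "v \<in> W" if "v \<notin> (\<Union>a\<in>A. Bad a)"
      unfolding W_def vimage_eq
      by (rule net_implies_almost_Euclidean[OF elim k(1) \<epsilon> d_def, of A]) (use A that in \<open>auto simp: Bad_def not_le\<close>)
    then show ?case by blast
  qed
  then have "prob (- W) \<le> prob (\<Union>a\<in>A. Bad a)"
    using A(1) mBad by (intro finite_measure_mono_AE) auto
  also have "\<dots> \<le> (\<Sum>a\<in>A. prob (Bad a))"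
    using A(1) mBad by (intro finite_measure_subadditive_finite) auto
  also have "\<dots> \<le> (\<Sum>a\<in>A. 10 * exp (- q))" by (intro sum_mono bad)
  also have "\<dots> = card A * (10 * exp (- q))" by simp
  also have "\<dots> \<le> net_base \<epsilon> ^ k * (10 * exp (- q))" using A(2) by (intro mult_right_mono) auto
  also have "\<dots> < 1/2"
  proof -
    note nb = net_base_ge_1[of \<epsilon>]
    \<comment> \<open>Absorbing the factor 20 = 2 * 10 into the base keeps the condition on k
      linear.\<close>
    have "20 * net_base \<epsilon> ^ k \<le> 20 ^ k * net_base \<epsilon> ^ k"
      using nb k(1) self_le_power[of 20 k] by (intro mult_right_mono) auto
    also have "\<dots> = (20 * net_base \<epsilon>) ^ k" by (simp add: power_mult_distrib)
    also have "\<dots> = exp (k * ln (20 * net_base \<epsilon>))"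
      using nb by (simp add: exp_of_nat_mult)
    also have "\<dots> < exp q" using small by (simp add: q_def d_def)
    finally have "20 * net_base \<epsilon> ^ k < exp q" .
    then show ?thesis by (simp add: exp_minus field_simps)
  qed
  finally have "prob (- W) < 1/2" .
  moreover have "prob (- W) = 1 - prob W" using prob_compl[of W] W by (simp add: Compl_eq_Diff_UNIV)
  ultimately have "1/2 < prob W" by simp
  then show ?thesis
    using k measure_almost_Euclidean(2)[OF k, of \<epsilon>] by (simp add: typical_dims_def W_def)
qed

end

text \<open>The upper bound holds for every typical dimension and the lower bound exhibits one of
  them, so the maximum satisfies both. If no dimension from 1 on qualifies, the claim is that the
  lower bound is below 1, which is what remains of it when k(K) counts as 0.\<close>

theorem theoremB:
  shows "\<exists>C::real. C > 0 \<and> (\<exists>Cbar::real \<Rightarrow> real. (\<forall>\<epsilon>. 0 < \<epsilon> \<and> \<epsilon> < 1 \<longrightarrow> Cbar \<epsilon> > 0) \<and>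
    (\<forall>(n::nat) K (\<epsilon>::real). n \<ge> 1 \<longrightarrow> symmetric_convex_body n K \<longrightarrow> 0 < \<epsilon> \<longrightarrow> \<epsilon> < 1 \<longrightarrow>
      (typical_dims n K \<epsilon> \<noteq> {} \<longrightarrow>
         C * real n * (mean_norm n K / max_norm n K)\<^sup>2 \<ge> real (critical_dim n K \<epsilon>) \<and>
         real (critical_dim n K \<epsilon>) \<ge> Cbar \<epsilon> * real n * (mean_norm n K / max_norm n K)\<^sup>2) \<and>
      (typical_dims n K \<epsilon> = {} \<longrightarrow>
         Cbar \<epsilon> * real n * (mean_norm n K / max_norm n K)\<^sup>2 < 1)))"
proof -
  \<comment> \<open>The factor 2 in the last denominator leaves room for the strict inequality
    required by \<open>typical_dim_lower\<close>.\<close>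
  define c where "c \<epsilon> = (\<epsilon> / 8)\<^sup>2 / 64 / (2 * ln (20 * net_base \<epsilon>))" for \<epsilon> :: real
  note nb = net_base_ge_1
  have ln: "1 \<le> ln (20 * net_base \<epsilon>)" for \<epsilon>
  proof -
    have "exp 1 \<le> 20 * net_base \<epsilon>" using exp_le nb[of \<epsilon>] by linarith
    then show ?thesis using nb[of \<epsilon>] by (subst ln_ge_iff) auto
  qed
  have c: "0 < c \<epsilon>" "c \<epsilon> \<le> 1" if "0 < \<epsilon>" "\<epsilon> < 1" for \<epsilon>
  proof -
    show "0 < c \<epsilon>" using that ln[of \<epsilon>] by (simp add: c_def)
    have "(\<epsilon> / 8)\<^sup>2 \<le> 1" using that by (intro power_le_one) auto
    then have "(\<epsilon> / 8)\<^sup>2 / 64 \<le> 2 * ln (20 * net_base \<epsilon>)" using ln[of \<epsilon>] by linarith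
    then show "c \<epsilon> \<le> 1" using ln[of \<epsilon>] by (simp add: c_def)
  qed
  have main: "(typical_dims n K \<epsilon> \<noteq> {} \<longrightarrow>
         48 * real n * (mean_norm n K / max_norm n K)\<^sup>2 \<ge> real (critical_dim n K \<epsilon>) \<and>
         real (critical_dim n K \<epsilon>) \<ge> c \<epsilon> / 2 * real n * (mean_norm n K / max_norm n K)\<^sup>2) \<and>
      (typical_dims n K \<epsilon> = {} \<longrightarrow> c \<epsilon> / 2 * real n * (mean_norm n K / max_norm n K)\<^sup>2 < 1)"
    if n: "n \<ge> 1" and K: "symmetric_convex_body n K" and \<epsilon>: "0 < \<epsilon>" "\<epsilon> < 1" for n K \<epsilon>
  proof -
    interpret body n K by standard (fact n, fact K)
    let ?T = "typical_dims n K \<epsilon>"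
    define t where "t = c \<epsilon> * n * (M / b)\<^sup>2"
    have fin: "finite ?T" by (rule finite_subset[of _ "{1..n}"]) (auto simp: typical_dims_def)
    \<comment> \<open>The witness is the integer part of t. It is at most n because c \<le> 1 and M
      \<le> b, and at least t / 2 once t \<ge> 1, which is why the final constant is
      \<open>c \<epsilon> / 2\<close>.\<close>
    have large: "nat \<lfloor>t\<rfloor> \<in> ?T" "t / 2 \<le> real (nat \<lfloor>t\<rfloor>)" if t: "1 \<le> t"
    proof -
      let ?k = "nat \<lfloor>t\<rfloor>"
      have k: "real ?k \<le> t" "t < real ?k + 1" "1 \<le> ?k" using t by linarith+
      show "t / 2 \<le> real ?k" using k(2,3) by linarith
      have "(M / b)\<^sup>2 \<le> 1" using mean_le_max mean_nonneg max_pos by (intro power_le_one) auto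
      then have "c \<epsilon> * (M / b)\<^sup>2 \<le> 1 * 1" using c[OF \<epsilon>] by (intro mult_mono) auto
      then have "real n * (c \<epsilon> * (M / b)\<^sup>2) \<le> real n * 1" by (intro mult_left_mono) auto
      then have "real ?k \<le> real n" using k(1) by (simp add: t_def mult_ac)
      then have kn: "?k \<le> n" by simp
      show "?k \<in> ?T"
      proof (rule typical_dim_lower[OF k(3) kn \<epsilon>])
        let ?l = "ln (20 * net_base \<epsilon>)"
        have "real ?k * ?l \<le> t * ?l" using k(1) ln[of \<epsilon>] by (intro mult_right_mono) auto
        also have "\<dots> = ((\<epsilon> / 8)\<^sup>2 * n * (M / b)\<^sup>2 / 64) / 2" using ln[of \<epsilon>] by (simp add: t_def c_def)
        also have "\<dots> < (\<epsilon> / 8)\<^sup>2 * n * (M / b)\<^sup>2 / 64"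
          using \<epsilon> n mean_pos max_pos by simp
        finally show "real ?k * ?l < (\<epsilon> / 8)\<^sup>2 * n * (M / b)\<^sup>2 / 64" .
      qed
    qed
    have half: "c \<epsilon> / 2 * real n * (M / b)\<^sup>2 = t / 2" by (simp add: t_def)
    have "real (critical_dim n K \<epsilon>) \<le> 48 * real n * (M / b)\<^sup>2 \<and> t / 2 \<le> real (critical_dim n K \<epsilon>)" if ne: "?T \<noteq> {}"
    proof
      have mem: "critical_dim n K \<epsilon> \<in> ?T" unfolding critical_dim_def by (rule Max_in[OF fin ne])
      show "real (critical_dim n K \<epsilon>) \<le> 48 * real n * (M / b)\<^sup>2" by (rule typical_dim_upper[OF mem \<epsilon>])
      show "t / 2 \<le> real (critical_dim n K \<epsilon>)"
      proof (cases "1 \<le> t")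
        case True
        have "nat \<lfloor>t\<rfloor> \<le> critical_dim n K \<epsilon>" unfolding critical_dim_def by (rule Max_ge[OF fin large(1)[OF True]])
        then show ?thesis using large(2)[OF True] by linarith
      next
        case False
        \<comment> \<open>For t < 1 the bound holds because typical dimensions start at 1.\<close>
        have "1 \<le> critical_dim n K \<epsilon>" using mem by (simp add: typical_dims_def)
        then show ?thesis using False by linarith
      qed
    qed
    moreover have "t / 2 < 1" if "?T = {}" using large(1) that by (cases "1 \<le> t") auto
    ultimately show ?thesis unfolding half by blast
  qed
  show ?thesis
    by (rule exI[of _ 48], rule conjI, simp, rule exI[of _ "\<lambda>\<epsilon>. c \<epsilon> / 2"]) (use main c in auto)
qed

end
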